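(* Let $X>0$ be a random variable with moments of Gamma type, let $Y=\log X$, and let $\gamma,\delta,\varkappa,C_1,\rho_+$ be the associated parameters (see context). Suppose that $\rho_+=\infty$ and $\gamma>0$. Then $$f_X(x)\sim C_2\,x^{c_1-1}e^{-c_2x^{1/\gamma}},\qquad x\to\infty,$$ $$f_Y(y)\sim\frac{C_1}{\sqrt{2\pi\gamma}}\,e^{c_1(y-\varkappa)-\gamma e^{(y-\varkappa)/\gamma}},\qquad y\to\infty,$$ where $c_1:=(\delta+1/2)/\gamma$, $c_2:=\gamma e^{-\varkappa/\gamma}$ and $C_2:=\dfrac{C_1}{\sqrt{2\pi\gamma}}\,e^{-c_1\varkappa}$.
   Context: A positive random variable $X$ has moments of Gamma type if there exist integers $J,K\ge0$ and real constants $C$, $D>0$, $a_j\ne0$, $b_j$ ($1\le j\le J$), $a'_k\neq0$, $b'_k$ ($1\le k\le K$) such that $$\mathbb E\,X^s=F(s):=C D^s\,\frac{\prod_{j=1}^J\Gamma(a_js+b_j)}{\prod_{k=1}^K\Gamma(a'_ks+b'_k)}$$ for all real $s$ in some interval of positive length. $F$ is regarded as a meromorphic function on $\mathbb C$ (removable singularities removed). Let $\rho_+:=\min\{x>0:x\text{ is a pole of }F\}$, with $\rho_+=\infty$ if there is no such pole. With $d=\log D$, define $$\gamma=\sum_{j}|a_j|-\sum_{k}|a'_k|,\quad \delta=\sum_j b_j-\sum_k b'_k-\frac{J-K}2,\quad \varkappa=\sum_j a_j\log|a_j|-\sum_k a'_k\log|a'_k|+d,$$ $$C_1=|C|\,(2\pi)^{(J-K)/2}\,\frac{\prod_j|a_j|^{b_j-1/2}}{\prod_k|a'_k|^{b'_k-1/2}}.$$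 When $\gamma>0$, $X$ and $Y$ are absolutely continuous with densities continuous on $(0,\infty)$ and $\mathbb R$, respectively; $f_X$ and $f_Y$ denote these. $f\sim g$ means $f/g\to1$. *)

theory Defs
  imports
    "HOL-Probability.Probability"
    "HOL-Complex_Analysis.Complex_Analysis"
    "HOL-Library.Landau_Symbols"
begin

(* The factors are indexed by {1..J} and {1..K}; a, b are the numerator coefficients and a', b' the
   denominator coefficients. At a pole of Gamma the library value is 0, and division by 0 yields 0,
   so the quotient agrees with the meromorphic function only off a discrete set. remove_sings
   repairs the value at every removable singularity; at a genuine pole the value is 0. *)
definition gamma_type_fun ::
  "nat \<Rightarrow> nat \<Rightarrow> real \<Rightarrow> real \<Rightarrow> (nat \<Rightarrow> real) \<Rightarrow> (nat \<Rightarrow> real) \<Rightarrow> (nat \<Rightarrow> real) \<Rightarrow> (nat \<Rightarrow> real) \<Rightarrow>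
    complex \<Rightarrow> complex" where
  "gamma_type_fun J K C D a b a' b' =
     remove_sings (\<lambda>s. of_real C * of_real D powr s *
       ((\<Prod>j\<in>{1..J}. Gamma (of_real (a j) * s + of_real (b j))) /
        (\<Prod>k\<in>{1..K}. Gamma (of_real (a' k) * s + of_real (b' k)))))"

(* The integrability conjunct says that the moment is finite: without it the Bochner integral
   would be 0 by convention. An open interval is no restriction, since every interval of positive
   length contains one. *)
definition moments_of_gamma_type ::
  "'w measure \<Rightarrow> ('w \<Rightarrow> real) \<Rightarrow>
   nat \<Rightarrow> nat \<Rightarrow> real \<Rightarrow> real \<Rightarrow> (nat \<Rightarrow> real) \<Rightarrow> (nat \<Rightarrow> real) \<Rightarrow> (nat \<Rightarrow> real) \<Rightarrow> (nat \<Rightarrow> real) \<Rightarrow> bool" where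
  "moments_of_gamma_type M X J K C D a b a' b' \<longleftrightarrow>
     D > 0 \<and> (\<forall>j\<in>{1..J}. a j \<noteq> 0) \<and> (\<forall>k\<in>{1..K}. a' k \<noteq> 0) \<and>
     (\<exists>u v. u < v \<and>
        (\<forall>s\<in>{u<..<v}.
           integrable M (\<lambda>\<omega>. X \<omega> powr s) \<and>
           of_real (integral\<^sup>L M (\<lambda>\<omega>. X \<omega> powr s)) =
             gamma_type_fun J K C D a b a' b' (of_real s)))"

(* The poles are isolated, so the infimum is a minimum when there is a positive pole; otherwise
   Inf {} = \<infinity>. *)
definition rho_plus :: "(complex \<Rightarrow> complex) \<Rightarrow> ereal" where
  "rho_plus F = Inf (ereal ` {x. 0 < x \<and> is_pole F (of_real x)})"

definition gamma_param :: "nat \<Rightarrow> nat \<Rightarrow> (nat \<Rightarrow> real) \<Rightarrow> (nat \<Rightarrow> real) \<Rightarrow> real" where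
  "gamma_param J K a a' = (\<Sum>j\<in>{1..J}. \<bar>a j\<bar>) - (\<Sum>k\<in>{1..K}. \<bar>a' k\<bar>)"

definition delta_param :: "nat \<Rightarrow> nat \<Rightarrow> (nat \<Rightarrow> real) \<Rightarrow> (nat \<Rightarrow> real) \<Rightarrow> real" where
  "delta_param J K b b' =
     (\<Sum>j\<in>{1..J}. b j) - (\<Sum>k\<in>{1..K}. b' k) - (real J - real K) / 2"

definition kappa_param :: "nat \<Rightarrow> nat \<Rightarrow> real \<Rightarrow> (nat \<Rightarrow> real) \<Rightarrow> (nat \<Rightarrow> real) \<Rightarrow> real" where
  "kappa_param J K D a a' =
     (\<Sum>j\<in>{1..J}. a j * ln \<bar>a j\<bar>) - (\<Sum>k\<in>{1..K}. a' k * ln \<bar>a' k\<bar>) + ln D"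

definition C1_param ::
  "nat \<Rightarrow> nat \<Rightarrow> real \<Rightarrow> (nat \<Rightarrow> real) \<Rightarrow> (nat \<Rightarrow> real) \<Rightarrow> (nat \<Rightarrow> real) \<Rightarrow> (nat \<Rightarrow> real) \<Rightarrow> real" where
  "C1_param J K C a b a' b' =
     \<bar>C\<bar> * (2 * pi) powr ((real J - real K) / 2) *
     ((\<Prod>j\<in>{1..J}. \<bar>a j\<bar> powr (b j - 1 / 2)) / (\<Prod>k\<in>{1..K}. \<bar>a' k\<bar> powr (b' k - 1 / 2)))"

end

(* The moment function E X^s is the Laplace transform of Y = log X. Its Taylor coefficients of even
   order at a real point are nonnegative, so by Landau's argument it converges as far as F continues
   without a pole. Hence, when rho_+ is infinite, E X^s = F(s) for Re s > 0, and F is holomorphic there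
   and zero-free: F is positive on the real axis and the zeros of 1/Gamma at affine arguments are real.

   The reflection formula replaces the Gamma factors with negative coefficients by factors with positive
   coefficients, at the price of a quotient of two products of sines. This quotient is holomorphic and
   zero-free in a half-plane; almost periodicity and Liouville's theorem make it constant. Stirling's
   formula then yields F(s) = C_1 exp(gamma (s log s - s) + delta log s + kappa s + O(1/Re s)) uniformly
   as Re s tends to infinity.

   Finally f_Y(y) is recovered from F by Fourier inversion on the vertical line through the saddle point
   s = exp((y - kappa)/gamma). With Im s = u sqrt(s), the integrand converges to a Gaussian, dominated
   because x arctan x - log(1 + x^2)/2 >= sqrt(1 + x^2) - 1. *)

theory Submission
  imports Defs
begin

section \<open>Stirling's formula in a half-plane\<close>

text \<open>The parameter gamma is built from absolute values, whereas Stirling's formula produces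
  signed sums of the coefficients. The two agree because the sine quotient is constant, which forces
  the negative coefficients of numerator and denominator to have the same total modulus. Stirling's
  error must be uniform in the imaginary part, since the path of integration moves to the right with
  y and all of it contributes; hence a remainder bounded through the real part alone. The absence of
  positive poles says nothing about the nonpositive axis, and the moments may be known only there,
  so the continuation must be led past 0. The sine constant is known only in modulus and C may have
  either sign, so the asymptotic constant is first found up to a phase; positivity of the moments on
  the real axis makes it \<open>C1_param\<close>. The saddle is the point where gamma (s log s - s)
  + kappa s - s y is stationary in s, that is, gamma log s = y - kappa.\<close>

lemma Ln_plus_one:
  assumes "Re z > 0"
  shows "Ln (z + 1) = Ln z + Ln (1 + 1 / z)"
proof -
  have "Re (1 / z) > 0"
    using assms by (simp add: Re_complex_div_gt_0)
  then have "Ln (z * (1 + 1/z)) = Ln z + Ln (1 + 1/z)"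
  proof -
    assume "Re (1 / z) > 0"
    then have p: "Re (1 + 1 / z) > 0" by (simp del: Re_divide_of_real)
    have nz: "z \<noteq> 0" using assms by auto
    have nz': "1 + 1 / z \<noteq> 0" using p by (metis less_irrefl zero_complex.simps(1))
    have "\<bar>Im (Ln z)\<bar> < pi/2" using Re_Ln_pos_lt[OF nz] assms by blast
    moreover have "\<bar>Im (Ln (1 + 1 / z))\<bar> < pi/2" using Re_Ln_pos_lt[OF nz'] p by blast
    ultimately show ?thesis using nz nz' by (intro Ln_times_simple) linarith+
  qed
  moreover have "z * (1 + 1/z) = z + 1" using assms by (auto simp: field_simps)
  ultimately show ?thesis by simp
qed

lemma norm_Ln_one_plus_cubic:
  assumes "norm (u::complex) \<le> 1/2"
  shows "norm (Ln (1 + u) - (u - u^2/2)) \<le> 2 * norm u ^ 3"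
proof -
  have lt: "norm u < 1" using assms by linarith
  have S: "(\<lambda>n. - ((- u) ^ (n+3)) / of_nat (n+3)) sums (Ln (1+u) - (\<Sum>n<3. - ((-u)^n) / of_nat n))"
    using Ln_series'[OF lt] by (subst sums_iff_shift) simp
  \<comment> \<open>The term at n = 0 is -1/0, which is 0 by convention, so these three terms are
    just the linear and the quadratic one.\<close>
  have E: "(\<Sum>n<3. - ((-u)^n) / of_nat n) = u - u^2/2"
    by (simp add: eval_nat_numeral)
  have sg: "summable (\<lambda>n. norm u ^ 3 * norm u ^ n)"
    using lt by (intro summable_mult summable_geometric) auto
  have bd: "norm (- ((- u) ^ (n+3)) / of_nat (n+3)) \<le> norm u ^ 3 * norm u ^ n" for n
  proof -
    have "norm (- ((- u) ^ (n+3)) / of_nat (n+3)) = norm u ^ (n+3) / real (n+3)"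
      by (simp add: norm_divide norm_power del: of_nat_add)
    also have "\<dots> \<le> norm u ^ (n+3) / 1" by (intro divide_left_mono) auto
    finally show ?thesis by (simp add: power_add mult.commute)
  qed
  have "norm (Ln (1+u) - (u - u^2/2)) \<le> (\<Sum>n. norm u ^ 3 * norm u ^ n)"
  proof -
    have "norm (\<Sum>n. - ((- u) ^ (n+3)) / of_nat (n+3)) \<le> (\<Sum>n. norm u ^ 3 * norm u ^ n)"
      by (rule norm_suminf_le[OF bd sg])
    then show ?thesis using sums_unique[OF S] unfolding E by (simp only:)
  qed
  also have "\<dots> = norm u ^ 3 * (1 / (1 - norm u))"
    using lt by (subst suminf_mult) (auto simp: suminf_geometric intro: summable_geometric)
  also have "\<dots> \<le> norm u ^ 3 * 2"
    using assms by (intro mult_left_mono) (auto simp: field_simps)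
  finally show ?thesis by simp
qed

section \<open>The remainder series in Stirling's formula\<close>

definition stirling_main :: "complex \<Rightarrow> complex" where
  "stirling_main z = (z - 1/2) * Ln z - z"

text \<open>The defect of \<open>exp (stirling_main z)\<close> in the functional equation
  \<open>Gamma (z + 1) = z * Gamma z\<close>, on the logarithmic scale; the defects along z, z + 1,
  ... add up to the remainder.\<close>

definition stirling_step :: "complex \<Rightarrow> complex" where
  "stirling_step z = (z + 1/2) * Ln (1 + 1/z) - 1"

lemma stirling_main_plus1:
  assumes "Re z > 0"
  shows "stirling_main (z + 1) = stirling_main z + Ln z + stirling_step z"
  using Ln_plus_one[OF assms]
  by (simp add: stirling_main_def stirling_step_def algebra_simps)

text \<open>With \<open>u = 1 / z\<close>, the product of \<open>z + 1/2\<close> and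
  \<open>u - u^2/2\<close> is \<open>1 - u^2/4\<close>: the shift by 1/2 cancels the term of order
  1/z and leaves a summable defect.\<close>

lemma norm_stirling_step_le:
  assumes "norm z \<ge> 2"
  shows "norm (stirling_step z) \<le> 4 / norm z ^ 2"
proof -
  define u where "u = 1 / z"
  have z0: "z \<noteq> 0" using assms by auto
  have nu: "norm u \<le> 1/2" "norm u = 1 / norm z" using assms by (auto simp: u_def norm_divide divide_simps)
  define r where "r = Ln (1 + u) - (u - u^2/2)"
  have r: "norm r \<le> 2 * norm u ^ 3" unfolding r_def by (rule norm_Ln_one_plus_cubic[OF nu(1)])
  have "stirling_step z = (z + 1/2) * r - u^2/4"
    using z0 unfolding stirling_step_def r_def u_def by (simp add: field_simps power2_eq_square)
  then have "norm (stirling_step z) \<le> norm (z + 1/2) * norm r + norm u ^ 2 / 4"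
    by (metis norm_triangle_ineq4 norm_mult norm_divide norm_power norm_numeral)
  also have "\<dots> \<le> (norm z + 1/2) * (2 * norm u ^ 3) + norm u ^ 2 / 4"
    using r norm_triangle_ineq[of z "1/2"] by (intro add_mono mult_mono) (auto simp: norm_divide)
  also have "\<dots> \<le> 4 / norm z ^ 2"
  proof -
    define v where "v = norm u"
    have v: "norm z * v = 1" "v \<le> 1/2" "v \<ge> 0" using nu z0 by (auto simp: v_def)
    have "(norm z + 1/2) * (2 * v ^ 3) + v ^ 2 / 4 = v^2 * (2 * (norm z * v) + v + 1/4)"
      by (simp add: algebra_simps power2_eq_square power3_eq_cube)
    also have "\<dots> \<le> v^2 * 4" unfolding v(1) using v by (intro mult_left_mono) auto
    finally show ?thesis using nu(2) by (simp add: v_def power_divide)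
  qed
  finally show ?thesis .
qed

text \<open>The quadratic bound is weakened to a telescoping difference, so that the series of
  bounds has an exact sum depending on \<open>Re z\<close> only.\<close>

lemma norm_stirling_step_shift_le:
  assumes "Re z \<ge> 2"
  shows "norm (stirling_step (z + of_nat k)) \<le> 8 * (1 / (Re z + real k) - 1 / (Re z + real (Suc k)))"
proof -
  define x where "x = Re z + real k"
  have x: "x \<ge> 2" using assms by (simp add: x_def)
  have n: "norm (z + of_nat k) \<ge> x" using complex_Re_le_cmod[of "z + of_nat k"] by (simp add: x_def)
  have "norm (stirling_step (z + of_nat k)) \<le> 4 / norm (z + of_nat k) ^ 2"
    using n x by (intro norm_stirling_step_le) auto
  also have "\<dots> \<le> 4 / x^2" using n x by (intro divide_left_mono power_mono mult_pos_pos zero_less_power) auto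
  also have "\<dots> \<le> 4 * (2 / (x * (x + 1)))"
  proof -
    have "1 / x^2 \<le> 2 / (x * (x + 1))" using x mult_left_mono[of 1 x x]
      by (intro frac_le[of 2 2 "x*(x+1)" "2*x^2", simplified]) (auto simp: algebra_simps power2_eq_square intro: add_pos_pos)
    then show ?thesis by simp
  qed
  also have "\<dots> = 8 * (1 / x - 1 / (x + 1))" using x by (simp add: divide_simps)
  finally show ?thesis by (simp add: x_def add_ac)
qed

text \<open>Gudermann's series for Binet's function, the error of Stirling's formula for log
  Gamma.\<close>

definition stirling_rest :: "complex \<Rightarrow> complex" where
  "stirling_rest z = (\<Sum>k. stirling_step (z + of_nat k))"

lemma telescope_inverse_sums:
  assumes "x > 0"
  shows "(\<lambda>k. 8 * (1 / (x + real k) - 1 / (x + real (Suc k)))) sums (8 / x)"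
proof -
  have "(\<lambda>k. 1 / (x + real k)) \<longlonglongrightarrow> 0" by real_asymp
  from sums_mult[OF telescope_sums'[OF this], of 8] show ?thesis by simp
qed

lemma summable_stirling_step:
  assumes "Re z \<ge> 2"
  shows "summable (\<lambda>k. stirling_step (z + of_nat k))"
proof (rule summable_comparison_test')
  show "summable (\<lambda>k. 8 * (1 / (Re z + real k) - 1 / (Re z + real (Suc k))))"
    using assms by (intro sums_summable[OF telescope_inverse_sums]) linarith
qed (rule norm_stirling_step_shift_le[OF assms])

lemma norm_stirling_rest_le:
  assumes "Re z \<ge> 2"
  shows "norm (stirling_rest z) \<le> 8 / Re z"
proof -
  have s: "(\<lambda>k. 8 * (1 / (Re z + real k) - 1 / (Re z + real (Suc k)))) sums (8 / Re z)"
    using assms by (intro telescope_inverse_sums) auto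
  have "norm (stirling_rest z) \<le> (\<Sum>k. 8 * (1 / (Re z + real k) - 1 / (Re z + real (Suc k))))"
    unfolding stirling_rest_def
    by (intro norm_suminf_le norm_stirling_step_shift_le assms sums_summable[OF s])
  then show ?thesis using sums_unique[OF s] by simp
qed

section \<open>The constant in Stirling's formula\<close>

definition stirling_ratio :: "complex \<Rightarrow> complex" where
  "stirling_ratio z = Gamma z / exp (stirling_main z)"

lemma Re_pos_not_nonpos_Int: "Re z > 0 \<Longrightarrow> z \<notin> \<int>\<^sub>\<le>\<^sub>0"
  by (auto elim!: nonpos_Ints_cases)

lemma stirling_ratio_plus1:
  assumes "Re z > 0"
  shows "stirling_ratio (z + 1) = stirling_ratio z * exp (- stirling_step z)"
proof -
  have "z \<noteq> 0" using assms by auto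
  then show ?thesis using Gamma_plus1[OF Re_pos_not_nonpos_Int[OF assms]]
    by (simp add: stirling_ratio_def stirling_main_plus1[OF assms] exp_add exp_minus exp_Ln divide_inverse)
qed

lemma stirling_ratio_plus_of_nat:
  assumes "Re z > 0"
  shows "stirling_ratio (z + of_nat n) = stirling_ratio z * exp (- (\<Sum>k<n. stirling_step (z + of_nat k)))"
proof (induction n)
  case (Suc n)
  have "stirling_ratio (z + of_nat (Suc n)) = stirling_ratio (z + of_nat n + 1)" by (simp add: add_ac)
  also have "\<dots> = stirling_ratio (z + of_nat n) * exp (- stirling_step (z + of_nat n))"
    using assms by (intro stirling_ratio_plus1) auto
  finally show ?case by (simp add: Suc exp_add exp_diff exp_minus field_simps)
qed simp

lemma stirling_ratio_shift_lim:
  assumes "Re z \<ge> 2"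
  shows "(\<lambda>n. stirling_ratio (z + of_nat n)) \<longlonglongrightarrow> stirling_ratio z * exp (- stirling_rest z)"
  using summable_LIMSEQ[OF summable_stirling_step[OF assms]] assms
  by (subst stirling_ratio_plus_of_nat) (auto intro!: tendsto_intros simp: stirling_rest_def)

text \<open>Gauss's limit formula for Gamma, rewritten through
  \<open>pochhammer z n = Gamma (z + of_nat n) / Gamma z\<close>.\<close>

lemma Gamma_plus_of_nat_quotient_lim:
  assumes "z \<notin> \<int>\<^sub>\<le>\<^sub>0"
  shows "(\<lambda>n. Gamma (z + of_nat n) / (Gamma (of_nat n) * exp (z * Ln (of_nat n)))) \<longlonglongrightarrow> 1"
proof -
  have nz: "Gamma z \<noteq> 0" using assms by (simp add: Gamma_eq_zero_iff)
  have "(\<lambda>n. Gamma z / Gamma_series' z n) \<longlonglongrightarrow> Gamma z / Gamma z"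
    by (intro tendsto_intros Gamma_series'_LIMSEQ nz)
  then have "(\<lambda>n. Gamma z / Gamma_series' z n) \<longlonglongrightarrow> 1" using nz by simp
  moreover have "\<forall>\<^sub>F n in sequentially. Gamma z / Gamma_series' z n = Gamma (z + of_nat n) / (Gamma (of_nat n) * exp (z * Ln (of_nat n)))"
    using eventually_gt_at_top[of 0]
  proof eventually_elim
    case (elim n)
    have "pochhammer z n = Gamma (z + of_nat n) / Gamma z" using assms by (rule pochhammer_Gamma)
    moreover have "Gamma (of_nat n) = (fact (n - 1) :: complex)"
      using elim Gamma_fact[of "n-1"] by (cases n) (auto simp: add_ac)
    moreover have "Ln (of_nat n) = of_real (ln (real n))" using elim
      by (metis Ln_of_real of_nat_0_less_iff of_real_of_nat_eq)
    ultimately show ?case using nz by (simp add: Gamma_series'_def field_simps)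
  qed
  ultimately show ?thesis by (rule Lim_transform_eventually)
qed

lemma Ln_add_of_nat:
  assumes "Re z > 0" "n > 0"
  shows "Ln (z + of_nat n) = Ln (of_nat n) + Ln (1 + z / of_nat n)"
proof -
  have "Re (1 + z / of_nat n) > 0" using assms by (simp add: add_pos_nonneg)
  then have "1 + z / of_nat n \<noteq> 0" by (metis less_irrefl zero_complex.simps(1))
  then have "Ln (of_nat n * (1 + z / of_nat n)) = ln (of_nat n) + Ln (1 + z / of_nat n)"
    using assms by (intro Ln_times_of_nat) auto
  moreover have "of_nat n * (1 + z / of_nat n) = z + of_nat n" using assms by (simp add: field_simps)
  ultimately show ?thesis by simp
qed

lemma scaled_Ln_lim: "(\<lambda>n. of_nat n * Ln (1 + z / of_nat n)) \<longlonglongrightarrow> z"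
proof -
  have "(\<lambda>n. z / of_nat n) \<longlonglongrightarrow> 0"
    by (rule tendsto_divide_0[OF tendsto_const tendsto_of_nat])
  have L: "(\<lambda>n. of_nat n * Ln (1 + z / of_nat n) - z) \<longlonglongrightarrow> 0"
  proof (rule Lim_null_comparison)
    show "(\<lambda>n. 2 * norm z ^ 2 / real n) \<longlonglongrightarrow> 0" by real_asymp
    have "\<forall>\<^sub>F n in sequentially. real n > max 1 (2 * norm z)"
      by (intro eventually_compose_filterlim[OF eventually_gt_at_top filterlim_real_sequentially])
    then show "\<forall>\<^sub>F n in sequentially. norm (of_nat n * Ln (1 + z / of_nat n) - z) \<le> 2 * norm z ^ 2 / real n"
    proof eventually_elim
      case (elim n)
      then have n: "real n > 1" "2 * norm z < real n" by auto
      define u where "u = z / of_nat n"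
      have nu: "norm u = norm z / real n" by (simp add: u_def norm_divide)
      have nu2: "norm u < 1/2" using n unfolding nu by (simp add: field_simps)
      have "norm (Ln (1 + u) - u) \<le> norm u ^ 2 / (1 - norm u)"
        using nu2 by (intro Ln_approx_linear) auto
      also have "\<dots> \<le> norm u ^ 2 / (1/2)" using nu2 by (intro divide_left_mono) auto
      finally have "real n * norm (Ln (1 + u) - u) \<le> real n * (2 * norm u ^ 2)"
        using n by (intro mult_left_mono) auto
      moreover have "of_nat n * Ln (1 + z / of_nat n) - z = of_nat n * (Ln (1 + u) - u)"
        using n by (simp add: u_def right_diff_distrib)
      ultimately have "norm (of_nat n * Ln (1 + z / of_nat n) - z) \<le> real n * (2 * norm u ^ 2)"
        by (simp add: norm_mult)
      also have "\<dots> = 2 * norm z ^ 2 / real n" using n by (simp add: nu power2_eq_square)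
      finally show ?case .
    qed
  qed
  then show ?thesis by (simp add: LIM_zero_iff)
qed

lemma Ln_one_plus_over_lim: "(\<lambda>n. Ln (1 + z / of_nat n)) \<longlonglongrightarrow> 0"
proof -
  have "(\<lambda>n. Ln (1 + z / of_nat n)) \<longlonglongrightarrow> Ln (1 + 0)"
    by (intro tendsto_intros tendsto_divide_0[OF tendsto_const tendsto_of_nat]) auto
  then show ?thesis by simp
qed

lemma stirling_main_shift_lim:
  assumes "Re z > 0"
  shows "(\<lambda>n. stirling_main (z + of_nat n) - stirling_main (of_nat n) - z * Ln (of_nat n)) \<longlonglongrightarrow> 0"
proof -
  have "(\<lambda>n. (z - 1/2) * Ln (1 + z / of_nat n) + of_nat n * Ln (1 + z / of_nat n) - z) \<longlonglongrightarrow> (z - 1/2) * 0 + z - z"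
    by (intro tendsto_intros Ln_one_plus_over_lim scaled_Ln_lim)
  moreover have "\<forall>\<^sub>F n in sequentially. (z - 1/2) * Ln (1 + z / of_nat n) + of_nat n * Ln (1 + z / of_nat n) - z =
      stirling_main (z + of_nat n) - stirling_main (of_nat n) - z * Ln (of_nat n)"
    using eventually_gt_at_top[of 0]
    by eventually_elim (simp add: Ln_add_of_nat[OF assms] stirling_main_def algebra_simps)
  ultimately show ?thesis using Lim_transform_eventually by fastforce
qed

text \<open>Gamma and its main term pick up the same factor \<open>exp (z * Ln (of_nat n))\<close>
  when n is shifted by z. Hence the limit of \<open>stirling_ratio\<close> along z, z + 1, ... is
  the same for all z, and it suffices to find it along the integers.\<close>

lemma stirling_ratio_quotient_lim:
  assumes "Re z > 0"
  shows "(\<lambda>n. stirling_ratio (z + of_nat n) / stirling_ratio (of_nat n)) \<longlonglongrightarrow> 1"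
proof -
  have "(\<lambda>n. Gamma (z + of_nat n) / (Gamma (of_nat n) * exp (z * Ln (of_nat n))) *
     exp (- (stirling_main (z + of_nat n) - stirling_main (of_nat n) - z * Ln (of_nat n)))) \<longlonglongrightarrow> 1 * exp (-0)"
    by (intro tendsto_intros Gamma_plus_of_nat_quotient_lim stirling_main_shift_lim assms Re_pos_not_nonpos_Int)
  moreover have "Gamma (z + of_nat n) / (Gamma (of_nat n) * exp (z * Ln (of_nat n))) *
     exp (- (stirling_main (z + of_nat n) - stirling_main (of_nat n) - z * Ln (of_nat n)))
     = stirling_ratio (z + of_nat n) / stirling_ratio (of_nat n)" for n
  proof -
    have "exp (- (A - B - w)) = exp B * exp w / exp A" for A B w :: complex
      by (simp add: exp_diff)
    then show ?thesis unfolding stirling_ratio_def by simp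
  qed
  ultimately show ?thesis by simp
qed

lemma stirling_ratio_of_nat_lim:
  obtains c where "c \<noteq> 0" "(\<lambda>n. stirling_ratio (of_nat n)) \<longlonglongrightarrow> c"
proof
  \<comment> \<open>The base point is 2 because the remainder series is controlled for real part at
    least 2.\<close>
  let ?c = "stirling_ratio 2 * exp (- stirling_rest 2)"
  have "(\<lambda>n. stirling_ratio (2 + of_nat n)) \<longlonglongrightarrow> ?c" by (rule stirling_ratio_shift_lim) simp
  moreover have "(\<lambda>n. stirling_ratio (2 + of_nat n)) = (\<lambda>n. stirling_ratio (of_nat (n + 2)))" by (simp add: add.commute)
  ultimately have "(\<lambda>n. stirling_ratio (of_nat (n + 2))) \<longlonglongrightarrow> ?c" by (simp only:)
  then show "(\<lambda>n. stirling_ratio (of_nat n)) \<longlonglongrightarrow> ?c" by (rule LIMSEQ_offset)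
  have "(2::complex) \<notin> \<int>\<^sub>\<le>\<^sub>0" by (rule Re_pos_not_nonpos_Int) simp
  then show "?c \<noteq> 0" by (simp add: stirling_ratio_def Gamma_eq_zero_iff)
qed

text \<open>The exponents in the duplication formula: the terms of order n log n and n cancel,
  leaving log 2 / 2 and a bracket that tends to 0.\<close>

lemma stirling_legendre_aux:
  assumes "n > 0"
  shows "stirling_main (of_nat (2*n)) - stirling_main (of_nat n) - stirling_main (1/2 + of_nat n)
     + (1 - 2 * of_nat n) * of_real (ln 2) =
     of_real (ln 2) / 2 - (stirling_main (1/2 + of_nat n) - stirling_main (of_nat n) - 1/2 * Ln (of_nat n))"
proof -
  have "Ln (of_nat (2*n)) = of_real (ln 2) + Ln (of_nat n)"
  proof -
    have "Ln 2 = complex_of_real (ln 2)" using Ln_of_real[of 2] by simp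
    moreover have "Ln (of_nat 2 * of_nat n) = ln (of_nat 2) + Ln (of_nat n :: complex)"
      using assms by (intro Ln_times_of_nat) auto
    ultimately show ?thesis by (simp only: of_nat_mult of_nat_numeral)
  qed
  then show ?thesis by (simp add: stirling_main_def field_simps)
qed

text \<open>In Legendre's duplication formula all three ratios tend to the same c, which gives c * c
  = sqrt 2 * sqrt pi * c; since c is nonzero, this determines it.\<close>

lemma stirling_ratio_of_nat_tendsto: "(\<lambda>n. stirling_ratio (of_nat n)) \<longlonglongrightarrow> of_real (sqrt (2 * pi))"
proof -
  obtain c where c: "c \<noteq> 0" "(\<lambda>n. stirling_ratio (of_nat n)) \<longlonglongrightarrow> c" by (rule stirling_ratio_of_nat_lim)
  have c2: "(\<lambda>n. stirling_ratio (of_nat (2*n))) \<longlonglongrightarrow> c"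
    by (rule filterlim_compose[OF c(2)], rule mult_nat_left_at_top) simp
  have half: "Re (1/2 :: complex) > 0" by simp
  have "(\<lambda>n. stirling_ratio (1/2 + of_nat n) / stirling_ratio (of_nat n)) \<longlonglongrightarrow> 1"
    by (rule stirling_ratio_quotient_lim[OF half])
  from tendsto_mult[OF this c(2)] have "(\<lambda>n. stirling_ratio (1/2 + of_nat n) / stirling_ratio (of_nat n) * stirling_ratio (of_nat n)) \<longlonglongrightarrow> c"
    by simp
  moreover have "\<forall>\<^sub>F n in sequentially. stirling_ratio (of_nat n) \<noteq> 0"
    using tendsto_imp_eventually_ne[OF c(2) c(1)] .
  ultimately have ch: "(\<lambda>n. stirling_ratio (1/2 + of_nat n)) \<longlonglongrightarrow> c"
    by (rule_tac Lim_transform_eventually) (auto elim: eventually_mono)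
  have L: "(\<lambda>n. stirling_ratio (of_nat n) * stirling_ratio (1/2 + of_nat n)) \<longlonglongrightarrow> c * c"
    by (intro tendsto_mult c ch)
  have "(\<lambda>n. exp (of_real (ln 2) / 2 - (stirling_main (1/2 + of_nat n) - stirling_main (of_nat n) - 1/2 * Ln (of_nat n)))
     * of_real (sqrt pi) * stirling_ratio (of_nat (2*n))) \<longlonglongrightarrow> exp (of_real (ln 2) / 2 - 0) * of_real (sqrt pi) * c"
    by (intro tendsto_intros c2 stirling_main_shift_lim[OF half])
  moreover have "\<forall>\<^sub>F n in sequentially. exp (of_real (ln 2) / 2 - (stirling_main (1/2 + of_nat n) - stirling_main (of_nat n) - 1/2 * Ln (of_nat n)))
     * of_real (sqrt pi) * stirling_ratio (of_nat (2*n)) = stirling_ratio (of_nat n) * stirling_ratio (1/2 + of_nat n)"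
    using eventually_gt_at_top[of 0]
  proof eventually_elim
    case (elim n)
    have "Gamma (of_nat n) * Gamma (of_nat n + 1/2) =
       exp ((1 - 2 * of_nat n) * of_real (ln 2)) * of_real (sqrt pi) * Gamma (2 * of_nat n :: complex)"
      using elim by (intro Gamma_legendre_duplication Re_pos_not_nonpos_Int) auto
    then show ?case
    proof -
      define A B D w where "A = stirling_main (of_nat n)" and "B = stirling_main (1/2 + of_nat n)"
        and "D = stirling_main (of_nat (2*n))" and "w = (1 - 2 * of_nat n) * complex_of_real (ln 2)"
      assume "Gamma (of_nat n) * Gamma (of_nat n + 1/2) =
        exp ((1 - 2 * of_nat n) * of_real (ln 2)) * of_real (sqrt pi) * Gamma (2 * of_nat n :: complex)"
      then have G: "Gamma (of_nat n) * Gamma (1/2 + of_nat n) = exp w * of_real (sqrt pi) * Gamma (of_nat (2*n))"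
        unfolding w_def by (simp only: add.commute[of "1/2"] of_nat_mult of_nat_numeral)
      have "exp (D - A - B + w) * of_real (sqrt pi) * (Gamma (of_nat (2*n)) / exp D) =
          (exp w * of_real (sqrt pi) * Gamma (of_nat (2*n))) / (exp A * exp B)"
        by (simp add: exp_add exp_diff)
      also have "\<dots> = Gamma (of_nat n) / exp A * (Gamma (1/2 + of_nat n) / exp B)"
        unfolding G[symmetric] by simp
      finally have "exp (D - A - B + w) * of_real (sqrt pi) * (Gamma (of_nat (2*n)) / exp D) =
          Gamma (of_nat n) / exp A * (Gamma (1/2 + of_nat n) / exp B)" .
      then show ?thesis
        unfolding stirling_legendre_aux[OF elim, symmetric] stirling_ratio_def A_def B_def D_def w_def .
    qed
  qed
  ultimately have "(\<lambda>n. stirling_ratio (of_nat n) * stirling_ratio (1/2 + of_nat n)) \<longlonglongrightarrow> exp (of_real (ln 2) / 2 - 0) * of_real (sqrt pi) * c"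
    by (rule Lim_transform_eventually)
  with L have "c * c = exp (of_real (ln 2) / 2) * of_real (sqrt pi) * c"
    using LIMSEQ_unique by fastforce
  then have "c = exp (of_real (ln 2) / 2) * of_real (sqrt pi)" using c by simp
  also have "exp (of_real (ln 2) / 2) = (of_real (sqrt 2) :: complex)"
  proof -
    have "exp (ln 2 / 2) = sqrt 2" using exp_ln[of "sqrt 2"] ln_sqrt[of 2] by (simp del: exp_ln)
    then have "exp (complex_of_real (ln 2 / 2)) = of_real (sqrt 2)" by (simp only: exp_of_real)
    then show ?thesis by simp
  qed
  finally show ?thesis using c by (simp add: real_sqrt_mult)
qed

theorem Gamma_stirling_complex:
  assumes "Re z \<ge> 2"
  shows "Gamma z = of_real (sqrt (2 * pi)) * exp ((z - 1/2) * Ln z - z + stirling_rest z)"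
proof -
  have "(\<lambda>n. stirling_ratio (z + of_nat n) / stirling_ratio (of_nat n) * stirling_ratio (of_nat n)) \<longlonglongrightarrow> 1 * of_real (sqrt (2 * pi))"
    using assms by (intro tendsto_intros stirling_ratio_quotient_lim stirling_ratio_of_nat_tendsto) auto
  moreover have "\<forall>\<^sub>F n in sequentially. stirling_ratio (of_nat n) \<noteq> 0"
    by (rule tendsto_imp_eventually_ne[OF stirling_ratio_of_nat_tendsto]) auto
  ultimately have "(\<lambda>n. stirling_ratio (z + of_nat n)) \<longlonglongrightarrow> of_real (sqrt (2 * pi))"
    by (rule_tac Lim_transform_eventually) (auto elim: eventually_mono)
  then have "stirling_ratio z * exp (- stirling_rest z) = of_real (sqrt (2 * pi))"
    using stirling_ratio_shift_lim[OF assms] LIMSEQ_unique by blast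
  then have "Gamma z = of_real (sqrt (2 * pi)) * (exp (stirling_main z) * exp (stirling_rest z))"
    by (simp add: stirling_ratio_def exp_minus field_simps)
  then show ?thesis by (simp add: stirling_main_def exp_add)
qed

section \<open>Quotients of products of sines\<close>

lemma norm_sin_bounds:
  fixes z :: complex
  shows "(exp \<bar>Im z\<bar> - exp (-\<bar>Im z\<bar>)) / 2 \<le> norm (sin z)"
    and "norm (sin z) \<le> (exp \<bar>Im z\<bar> + exp (-\<bar>Im z\<bar>)) / 2"
    and "\<bar>sin (Re z)\<bar> \<le> norm (sin z)"
proof -
  have n: "norm (exp (\<i> * z)) = exp (- Im z)" "norm (exp (- (\<i> * z))) = exp (Im z)" by simp_all
  have s: "norm (sin z) = norm (exp (\<i> * z) - exp (- (\<i> * z))) / 2"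
    by (simp add: sin_exp_eq norm_divide norm_mult)
  show "norm (sin z) \<le> (exp \<bar>Im z\<bar> + exp (-\<bar>Im z\<bar>)) / 2"
    using norm_triangle_ineq4[of "exp (\<i> * z)" "exp (- (\<i> * z))"] unfolding s n
    by (auto simp: abs_if)
  show "(exp \<bar>Im z\<bar> - exp (-\<bar>Im z\<bar>)) / 2 \<le> norm (sin z)"
    using norm_triangle_ineq3[of "exp (\<i> * z)" "exp (- (\<i> * z))"] unfolding s n
    by (auto simp: abs_if split: if_splits)
  \<comment> \<open>The real part of sin z is sin (Re z) * cosh (Im z), and cosh is at least
    1.\<close>
  have "1 \<le> (exp (Im z) + exp (- Im z)) / 2"
    using cosh_real_ge_1[of "Im z"] by (simp add: cosh_def)
  then have "\<bar>sin (Re z)\<bar> * 1 \<le> \<bar>sin (Re z)\<bar> * ((exp (Im z) + exp (- Im z)) / 2)"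
    by (intro mult_left_mono) auto
  also have "\<dots> = \<bar>Re (sin z)\<bar>" by (simp add: Re_sin abs_mult)
  also have "\<dots> \<le> norm (sin z)" by (rule abs_Re_le_cmod)
  finally show "\<bar>sin (Re z)\<bar> \<le> norm (sin z)" by simp
qed

lemma norm_sin_le_exp: "norm (sin (z::complex)) \<le> exp \<bar>Im z\<bar>"
proof -
  define p q where "p = exp \<bar>Im z\<bar>" and "q = exp (-\<bar>Im z\<bar>)"
  have "q \<le> p" by (simp add: p_def q_def)
  moreover have "norm (sin z) \<le> (p + q) / 2" unfolding p_def q_def by (rule norm_sin_bounds(2))
  ultimately show ?thesis unfolding p_def[symmetric] by simp
qed

lemma norm_sin_ge_exp:
  fixes z :: complex
  assumes "\<bar>Im z\<bar> \<ge> 1"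
  shows "exp \<bar>Im z\<bar> / 4 \<le> norm (sin z)"
proof -
  define p q where "p = exp \<bar>Im z\<bar>" and "q = exp (-\<bar>Im z\<bar>)"
  have "2 \<le> exp (1::real)" using exp_ge_add_one_self[of 1] by simp
  also have "\<dots> \<le> p" using assms by (simp add: p_def)
  finally have "2 \<le> p" .
  moreover have "q \<le> 1" by (simp add: q_def)
  moreover have "(p - q) / 2 \<le> norm (sin z)" unfolding p_def q_def by (rule norm_sin_bounds(1))
  ultimately show ?thesis unfolding p_def[symmetric] by simp
qed

text \<open>Two regimes: for |Im z| at least 1 the exponential lower bound applies; otherwise the
  exponential is at most 3, and three quarters of \<eta> lie below |sin (Re z)|.\<close>

lemma norm_sin_ge_exp_off_zeros:
  fixes z :: complex
  assumes "\<eta> \<le> \<bar>sin (Re z)\<bar>" "\<eta> > 0"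
  shows "\<eta> / 4 * exp \<bar>Im z\<bar> \<le> norm (sin z)"
proof (cases "\<bar>Im z\<bar> \<ge> 1")
  case True
  have "\<eta> \<le> 1" using assms abs_sin_le_one[of "Re z"] by linarith
  then have "\<eta> / 4 * exp \<bar>Im z\<bar> \<le> exp \<bar>Im z\<bar> / 4"
    using mult_right_mono[OF _ exp_ge_zero, of \<eta> 1 "\<bar>Im z\<bar>"] by simp
  then show ?thesis using norm_sin_ge_exp[OF True] by (rule order_trans)
next
  case False
  have "exp \<bar>Im z\<bar> \<le> exp 1" using False by simp
  also have "\<dots> \<le> (3::real)" by (rule exp_le)
  finally have "\<eta> / 4 * exp \<bar>Im z\<bar> \<le> \<eta> / 4 * 3" using assms by (intro mult_left_mono) auto
  then show ?thesis using norm_sin_bounds(3)[of z] assms by linarith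
qed

definition sin_prod :: "nat set \<Rightarrow> (nat \<Rightarrow> real) \<Rightarrow> (nat \<Rightarrow> real) \<Rightarrow> complex \<Rightarrow> complex" where
  "sin_prod I a b s = (\<Prod>i\<in>I. sin (of_real pi * (of_real (a i) * s + of_real (b i))))"

lemma holomorphic_sin_prod: "sin_prod I a b holomorphic_on A"
  unfolding sin_prod_def by (intro holomorphic_intros)

lemma prod_exp_abs_Im:
  assumes "finite I"
  shows "(\<Prod>i\<in>I. exp \<bar>Im (of_real pi * (of_real (a i) * s + of_real (b i)))\<bar>) = exp (pi * \<bar>Im s\<bar> * (\<Sum>i\<in>I. \<bar>a i\<bar>))"
  using assms by (simp add: exp_sum[symmetric] abs_mult sum_distrib_left mult_ac)

lemma norm_sin_prod_le:
  assumes "finite I"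
  shows "norm (sin_prod I a b s) \<le> exp (pi * \<bar>Im s\<bar> * (\<Sum>i\<in>I. \<bar>a i\<bar>))"
  unfolding sin_prod_def prod_norm[symmetric] prod_exp_abs_Im[OF assms, of a s b, symmetric]
  by (intro prod_mono conjI norm_sin_le_exp norm_ge_zero)

text \<open>The alternatives in the last hypothesis are vertical lines away from the zeros and
  horizontal lines far from the real axis: the two kinds of sides of a rectangle.\<close>

lemma norm_sin_prod_ge:
  assumes "finite I" "\<eta> > 0" "\<eta> \<le> 1"
    and "(\<forall>i\<in>I. \<eta> \<le> \<bar>sin (pi * (a i * Re s + b i))\<bar>) \<or> (\<forall>i\<in>I. \<bar>pi * a i * Im s\<bar> \<ge> 1)"
  shows "(\<eta>/4) ^ card I * exp (pi * \<bar>Im s\<bar> * (\<Sum>i\<in>I. \<bar>a i\<bar>)) \<le> norm (sin_prod I a b s)"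
proof -
  have "(\<eta>/4) ^ card I * exp (pi * \<bar>Im s\<bar> * (\<Sum>i\<in>I. \<bar>a i\<bar>)) =
      (\<Prod>i\<in>I. \<eta>/4 * exp \<bar>Im (of_real pi * (of_real (a i) * s + of_real (b i)))\<bar>)"
    unfolding prod.distrib prod_exp_abs_Im[OF assms(1)] by simp
  also have "\<dots> \<le> norm (sin_prod I a b s)"
    unfolding sin_prod_def prod_norm[symmetric]
  proof (intro prod_mono conjI)
    fix i assume i: "i \<in> I"
    define z where "z = of_real pi * (of_real (a i) * s + complex_of_real (b i))"
    show "\<eta> / 4 * exp \<bar>Im z\<bar> \<le> norm (sin z)"
      using assms(4)
    proof
      assume "\<forall>i\<in>I. \<eta> \<le> \<bar>sin (pi * (a i * Re s + b i))\<bar>"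
      then show ?thesis using i assms(2) by (intro norm_sin_ge_exp_off_zeros) (auto simp: z_def)
    next
      assume "\<forall>i\<in>I. \<bar>pi * a i * Im s\<bar> \<ge> 1"
      then have "\<bar>pi * a i * Im s\<bar> \<ge> 1" using i by blast
      then have "\<bar>Im z\<bar> \<ge> 1" by (simp add: z_def mult.assoc)
      then have "exp \<bar>Im z\<bar> / 4 \<le> norm (sin z)" by (rule norm_sin_ge_exp)
      moreover have "\<eta> / 4 * exp \<bar>Im z\<bar> \<le> exp \<bar>Im z\<bar> / 4"
        using assms(3) mult_right_mono[OF assms(3) exp_ge_zero] by simp
      ultimately show ?thesis by (rule order_trans[rotated])
    qed
  qed (use assms(2) in auto)
  finally show ?thesis .
qed

lemma sin_ratio_exp_lim:
  assumes "(a::real) \<noteq> 0"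
  shows "((\<lambda>h. norm (sin (of_real pi * (of_real a * Complex x h + of_real b))) / exp (pi * \<bar>h\<bar> * \<bar>a\<bar>)) \<longlongrightarrow> 1/2) at_top"
proof (rule tendsto_sandwich)
  define k where "k = pi * \<bar>a\<bar>"
  have k: "k > 0" using assms by (simp add: k_def)
  have im: "\<bar>Im (of_real pi * (of_real a * Complex x h + of_real b))\<bar> = k * \<bar>h\<bar>" for h
    by (simp add: k_def abs_mult)
  have e: "exp (pi * \<bar>h\<bar> * \<bar>a\<bar>) = exp (k * \<bar>h\<bar>)" for h by (simp add: k_def mult_ac)
  let ?f = "\<lambda>h. norm (sin (of_real pi * (of_real a * Complex x h + of_real b))) / exp (pi * \<bar>h\<bar> * \<bar>a\<bar>)"
  show "\<forall>\<^sub>F h in at_top. (1 - exp (-2 * k * h)) / 2 \<le> ?f h"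
    using eventually_ge_at_top[of 0]
  proof eventually_elim
    case (elim h)
    have "(1 - exp (-2 * k * h)) / 2 = (exp (k*h) - exp (-(k*h))) / 2 / exp (k*h)"
      by (simp add: diff_divide_distrib exp_diff[symmetric] exp_minus[symmetric] flip: exp_diff)
    also have "\<dots> \<le> ?f h" unfolding e
      using norm_sin_bounds(1)[of "of_real pi * (of_real a * Complex x h + of_real b)"] abs_of_nonneg[OF elim]
      unfolding im by (simp only:) (intro divide_right_mono, auto)
    finally show ?case .
  qed
  show "\<forall>\<^sub>F h in at_top. ?f h \<le> (1 + exp (-2 * k * h)) / 2"
    using eventually_ge_at_top[of 0]
  proof eventually_elim
    case (elim h)
    have "?f h \<le> (exp (k*h) + exp (-(k*h))) / 2 / exp (k*h)" unfolding e
      using norm_sin_bounds(2)[of "of_real pi * (of_real a * Complex x h + of_real b)"] abs_of_nonneg[OF elim]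
      unfolding im by (simp only:) (intro divide_right_mono, auto)
    also have "\<dots> = (1 + exp (-2 * k * h)) / 2"
      by (simp add: add_divide_distrib exp_minus[symmetric] flip: exp_diff)
    finally show ?case .
  qed
  have t: "filterlim (\<lambda>h. -2 * k * h) at_bot at_top"
    using k by (intro filterlim_tendsto_neg_mult_at_bot[OF tendsto_const _ filterlim_ident]) auto
  have "((\<lambda>h. exp (-2 * k * h)) \<longlongrightarrow> 0) at_top" by (rule filterlim_compose[OF exp_at_bot t])
  then have "((\<lambda>h. (1 - exp (-2 * k * h)) / 2) \<longlongrightarrow> (1 - 0) / 2) at_top"
    "((\<lambda>h. (1 + exp (-2 * k * h)) / 2) \<longlongrightarrow> (1 + 0) / 2) at_top" by (intro tendsto_intros; simp)+
  then show "((\<lambda>h. (1 - exp (-2 * k * h)) / 2) \<longlongrightarrow> 1/2) at_top" "((\<lambda>h. (1 + exp (-2 * k * h)) / 2) \<longlongrightarrow> 1/2) at_top"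
    by simp_all
qed

text \<open>Growth along a vertical line reveals both the total of the |a i| and the number of
  factors. For two proportional products this matches the totals and gives the modulus of the
  proportionality factor.\<close>

lemma sin_prod_exp_lim:
  assumes "finite I" "\<And>i. i \<in> I \<Longrightarrow> a i \<noteq> 0"
  shows "((\<lambda>h. norm (sin_prod I a b (Complex x h)) / exp (pi * \<bar>h\<bar> * (\<Sum>i\<in>I. \<bar>a i\<bar>))) \<longlongrightarrow> (1/2) ^ card I) at_top"
proof -
  have "((\<lambda>h. \<Prod>i\<in>I. norm (sin (of_real pi * (of_real (a i) * Complex x h + of_real (b i)))) / exp (pi * \<bar>h\<bar> * \<bar>a i\<bar>)) \<longlongrightarrow> (\<Prod>i\<in>I. 1/2)) at_top"
    using assms by (intro tendsto_prod sin_ratio_exp_lim) auto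
  then show ?thesis
    by (simp add: sin_prod_def prod_norm[symmetric] prod_dividef exp_sum[OF assms(1), symmetric] sum_distrib_left)
qed

text \<open>The bound excludes poles of A / B, so the quotient with its removable singularities
  filled in is entire and bounded, and Liouville's theorem applies.\<close>

lemma entire_dominated_imp_multiple:
  assumes A: "A holomorphic_on UNIV" and B: "B holomorphic_on UNIV"
    and nz: "B z0 \<noteq> 0" and le: "\<And>z::complex. norm (A z) \<le> M * norm (B z)"
  obtains c where "\<And>z. A z = c * B z"
proof -
  define Q where "Q = remove_sings (\<lambda>z. A z / B z)"
  have an: "A analytic_on UNIV" "B analytic_on UNIV"
    using A B by (auto simp: analytic_on_open)
  have mer: "(\<lambda>z. A z / B z) meromorphic_on UNIV"
    by (intro meromorphic_intros analytic_on_imp_meromorphic_on an)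
  have ev: "\<forall>\<^sub>F w in at z. B w \<noteq> 0" for z
    using non_zero_neighbour_alt[OF B, of z z0] nz by (auto elim: eventually_mono)
  have Qev: "\<forall>\<^sub>F w in at z. Q w * B w = A w \<and> norm (Q w) \<le> M" for z
  proof -
    have "\<forall>\<^sub>F w in at z. Q w = A w / B w" unfolding Q_def
      by (intro eventually_remove_sings_eq_at meromorphic_on_isolated_singularity meromorphic_on_subset[OF mer]) auto
    with ev[of z] show ?thesis
    proof eventually_elim
      case (elim w)
      then show ?case using le[of w] by (simp add: norm_divide divide_le_eq)
    qed
  qed
  have nm: "Q nicely_meromorphic_on UNIV" unfolding Q_def by (rule remove_sings_nicely_meromorphic[OF mer])
  have "\<not> is_pole Q z" for z
  proof
    assume "is_pole Q z"
    then have "\<forall>\<^sub>F w in at z. norm (Q w) \<ge> M + 1"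
      unfolding is_pole_def filterlim_at_infinity_conv_norm_at_top filterlim_at_top by blast
    with Qev[of z] have "\<forall>\<^sub>F w in at z. False" by eventually_elim auto
    then show False by (simp add: eventually_False)
  qed
  then have "Q analytic_on {z}" for z
    by (intro nicely_meromorphic_on_imp_analytic_at[OF nm]) auto
  then have Qan: "Q analytic_on UNIV" using analytic_on_analytic_at by blast
  then have Qh: "Q holomorphic_on UNIV" by (rule analytic_imp_holomorphic)
  have cont: "Q \<midarrow>z\<rightarrow> Q z" "A \<midarrow>z\<rightarrow> A z" "B \<midarrow>z\<rightarrow> B z" for z
    using Qh A B by (auto simp: isCont_def[symmetric] dest!: holomorphic_on_imp_continuous_on simp: continuous_on_eq_continuous_at)
  have "norm (Q z) \<le> M" for z
    by (rule tendsto_upperbound[OF tendsto_norm[OF cont(1)]]) (use Qev[of z] in \<open>auto elim: eventually_mono\<close>)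
  then have "bounded (range Q)" by (auto simp: bounded_iff)
  with Qh obtain c where c: "\<And>z. Q z = c"
    using Liouville_theorem[of Q] unfolding constant_on_def by blast
  have "A z = Q z * B z" for z
  proof (rule tendsto_unique[OF _ cont(2)])
    show "A \<midarrow>z\<rightarrow> Q z * B z"
      by (rule Lim_transform_eventually[OF tendsto_mult[OF cont(1) cont(3)]]) (use Qev[of z] in \<open>auto elim: eventually_mono\<close>)
  qed auto
  then show ?thesis using that c by auto
qed

section \<open>Common almost periods of finitely many sines\<close>

lemma simultaneous_recurrence:
  assumes "finite (I::nat set)"
  obtains T :: "nat \<Rightarrow> real" and p :: "nat \<Rightarrow> nat \<Rightarrow> int" where
    "\<And>n. T n \<ge> real n" "\<And>n i. i \<in> I \<Longrightarrow> \<bar>T n * a i / 2 - of_int (p n i)\<bar> < 1 / real (Suc n)"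
proof -
  obtain m where m: "\<And>i. i \<in> I \<Longrightarrow> i < m" using assms finite_nat_bounded[OF assms] by auto
  have "\<exists>T p. T \<ge> real n \<and> (\<forall>i\<in>I. \<bar>T * a i / 2 - of_int (p i :: int)\<bar> < 1 / real (Suc n))" for n
  proof -
    \<comment> \<open>Dirichlet's theorem is applied to \<open>n * a i / 2\<close> rather than
      \<open>a i / 2\<close>: the almost period \<open>q * n\<close> is then at least n, as q is a
      positive integer. The halves reflect the period 2 / a of sin (pi a s).\<close>
    obtain q p where q: "0 < q" "\<And>i. i < m \<Longrightarrow> \<bar>of_int q * (real n * a i / 2) - of_int (p i)\<bar> < 1 / real (Suc n)"
      using Dirichlet_approx_simult[of "Suc n" m "\<lambda>i. real n * a i / 2"] by blast
    have "real n \<le> of_int q * real n" using q(1) by (simp add: mult_le_cancel_right1)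
    with q(2) m show ?thesis by (intro exI[of _ "of_int q * real n"] exI[of _ p]) (auto simp: mult_ac)
  qed
  then obtain T p where "\<forall>n. T n \<ge> real n \<and> (\<forall>i\<in>I. \<bar>T n * a i / 2 - of_int (p n i :: int)\<bar> < 1 / real (Suc n))"
    by metis
  then show ?thesis by (intro that[of T p]) auto
qed

lemma sin_recurrence:
  fixes a b T :: real and s :: complex
  shows "sin (of_real pi * (of_real a * (s + of_real T) + of_real b)) =
    sin (of_real pi * (of_real a * s + of_real b) + of_real (2 * pi * (T * a / 2 - of_int p)))"
proof -
  have "of_real pi * (of_real a * (s + of_real T) + of_real b) =
     of_real pi * (of_real a * s + of_real b) + of_real (2 * pi * (T * a / 2 - of_int p)) + of_int p * (2 * of_real pi)"
    by (simp add: algebra_simps)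
  moreover have "sin (w + of_int p * (2 * of_real pi)) = sin w" for w :: complex
    by (rule sin.plus_of_int)
  ultimately show ?thesis by (simp only:)
qed

lemma sin_prod_recurrence_lim:
  assumes "\<And>i. i \<in> I \<Longrightarrow> (\<lambda>n. T n * a i / 2 - of_int (p n i)) \<longlonglongrightarrow> 0"
  shows "(\<lambda>n. sin_prod I a b (s + of_real (T n))) \<longlonglongrightarrow> sin_prod I a b s"
  unfolding sin_prod_def
proof (rule tendsto_prod)
  fix i assume "i \<in> I"
  have L: "(\<lambda>n. sin (of_real pi * (of_real (a i) * s + of_real (b i)) + of_real (2 * pi * (T n * a i / 2 - of_int (p n i)))))
     \<longlonglongrightarrow> sin (of_real pi * (of_real (a i) * s + of_real (b i)) + of_real (2 * pi * 0))"
    by (intro tendsto_intros assms \<open>i \<in> I\<close>)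
  show "(\<lambda>n. sin (of_real pi * (of_real (a i) * (s + of_real (T n)) + of_real (b i)))) \<longlonglongrightarrow>
      sin (of_real pi * (of_real (a i) * s + of_real (b i)))"
  proof -
    have "sin (of_real pi * (of_real (a i) * (s + of_real (T n)) + of_real (b i))) =
      sin (of_real pi * (of_real (a i) * s + of_real (b i)) + of_real (2 * pi * (T n * a i / 2 - of_int (p n i))))" for n
      by (rule sin_recurrence)
    then show ?thesis
      using L by simp
  qed
qed

lemma exists_line_off_zeros:
  assumes "finite I" "\<And>i. i \<in> I \<Longrightarrow> a i \<noteq> 0"
  obtains x where "x > s0" "\<And>i. i \<in> I \<Longrightarrow> sin (pi * (a i * x + b i)) \<noteq> 0"
proof -
  define Z where "Z = (\<Union>i\<in>I. range (\<lambda>n::int. (of_int n - b i) / a i))"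
  have "countable Z" unfolding Z_def using assms(1) by (auto intro!: countable_UN countable_finite[of I])
  then obtain x where x: "x \<in> {s0<..<s0+1}" "x \<notin> Z"
    using uncountable_open_interval[of s0 "s0+1"] by (metis countable_subset less_add_one subsetI)
  have "sin (pi * (a i * x + b i)) \<noteq> 0" if i: "i \<in> I" for i
  proof
    assume "sin (pi * (a i * x + b i)) = 0"
    then obtain n :: int where "pi * (a i * x + b i) = of_int n * pi" by (auto simp: sin_zero_iff_int2)
    then have "a i * x + b i = of_int n" by (simp add: mult.commute)
    then have "x = (of_int n - b i) / a i" using assms(2)[OF i] by (simp add: field_simps)
    then show False using x(2) i unfolding Z_def by blast
  qed
  then show ?thesis using that x(1) by auto
qed

text \<open>The quotient \<open>W\<close> is bounded on the boundary of rectangles whose vertical sides are translates, by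
  common almost periods of all the sines, of a line avoiding the zeros of the denominator; the bound
  in the half-plane is then carried to the whole plane by translating back.\<close>

lemma sin_prod_quotient_const_aux:
  assumes fin: "finite I" "finite I'"
    and nz: "\<And>i. i \<in> I \<Longrightarrow> a i \<noteq> 0" "\<And>i. i \<in> I' \<Longrightarrow> a' i \<noteq> 0"
    and W: "W holomorphic_on {s. Re s > s0}"
    and eq: "\<And>s. Re s > s0 \<Longrightarrow> sin_prod I' a' b' s = W s * sin_prod I a b s"
    and le: "(\<Sum>i\<in>I'. \<bar>a' i\<bar>) \<le> (\<Sum>i\<in>I. \<bar>a i\<bar>)"
  obtains c where "\<And>s. sin_prod I' a' b' s = c * sin_prod I a b s"
proof -
  let ?A = "sin_prod I' a' b'" and ?B = "sin_prod I a b"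
  obtain x0 where x0: "x0 > s0" "\<And>i. i \<in> I \<Longrightarrow> sin (pi * (a i * x0 + b i)) \<noteq> 0"
    using exists_line_off_zeros[of I a s0 b, OF fin(1) nz(1)] by blast
  define \<eta> where "\<eta> = Min (insert 1 ((\<lambda>i. \<bar>sin (pi * (a i * x0 + b i))\<bar>) ` I))"
  have \<eta>: "\<eta> > 0" "\<eta> \<le> 1" "\<And>i. i \<in> I \<Longrightarrow> \<eta> \<le> \<bar>sin (pi * (a i * x0 + b i))\<bar>"
    using fin(1) x0(2) by (auto simp: \<eta>_def)
  obtain T p where T: "\<And>n. T n \<ge> real n"
    "\<And>n i. i \<in> I \<Longrightarrow> \<bar>T n * a i / 2 - of_int (p n i)\<bar> < 1 / real (Suc n)"
    and T': "\<And>n i. i \<in> I' \<Longrightarrow> \<exists>q::int. \<bar>T n * a' i / 2 - of_int q\<bar> < 1 / real (Suc n)"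
  proof -
    obtain m where m: "\<And>i. i \<in> I \<Longrightarrow> i < m" using finite_nat_bounded[OF fin(1)] by auto
    \<comment> \<open>Both families of coefficients are coded on one index set, the second shifted
      by m beyond the first, so that a single T n is an almost period for the sines on both
      sides.\<close>
    define c where "c i = (if i < m then a i else a' (i - m))" for i
    have "finite (I \<union> (\<lambda>i. i + m) ` I')" using fin by auto
    then obtain T p where Tp: "\<And>n. T n \<ge> real n"
      "\<And>n i. i \<in> I \<union> (\<lambda>i. i + m) ` I' \<Longrightarrow> \<bar>T n * c i / 2 - of_int (p n i)\<bar> < 1 / real (Suc n)"
      by (rule simultaneous_recurrence[where a = c]) blast
    show ?thesis
    proof (rule that[OF Tp(1)])
      fix n i assume "i \<in> I" then show "\<bar>T n * a i / 2 - of_int (p n i)\<bar> < 1 / real (Suc n)"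
        using Tp(2)[of i n] m by (simp add: c_def)
    next
      fix n i assume "i \<in> I'" then show "\<exists>q::int. \<bar>T n * a' i / 2 - of_int q\<bar> < 1 / real (Suc n)"
        using Tp(2)[of "i+m" n] by (auto simp: c_def)
    qed
  qed
  define q where "q n i = (SOME q. \<bar>T n * a' i / 2 - of_int q\<bar> < 1 / real (Suc n))" for n i
  have q: "\<bar>T n * a' i / 2 - of_int (q n i)\<bar> < 1 / real (Suc n)" if "i \<in> I'" for n i
    unfolding q_def using someI_ex[OF T'[OF that]] .
  have z: "(\<lambda>n. 1 / real (Suc n)) \<longlonglongrightarrow> 0" using LIMSEQ_inverse_real_of_nat by (simp add: inverse_eq_divide)
  have limI: "(\<lambda>n. T n * a i / 2 - of_int (p n i)) \<longlonglongrightarrow> 0" if "i \<in> I" for i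
    by (rule Lim_null_comparison[OF _ z]) (use T(2)[OF that] in \<open>auto intro!: always_eventually less_imp_le simp del: of_nat_Suc\<close>)
  have limI': "(\<lambda>n. T n * a' i / 2 - of_int (q n i)) \<longlonglongrightarrow> 0" if "i \<in> I'" for i
    by (rule Lim_null_comparison[OF _ z]) (use q[OF that] in \<open>auto intro!: always_eventually less_imp_le simp del: of_nat_Suc\<close>)
  have Alim: "(\<lambda>n. ?A (s + of_real (T n))) \<longlonglongrightarrow> ?A s" for s by (intro sin_prod_recurrence_lim[where p = q] limI')
  have Blim: "(\<lambda>n. ?B (s + of_real (T n))) \<longlonglongrightarrow> ?B s" for s by (intro sin_prod_recurrence_lim[where p = p] limI)
  \<comment> \<open>Half of \<eta> is used because on the translated lines \<open>x0 + T n\<close>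
    the sines only come close to their values at \<open>x0\<close>.\<close>
  define M where "M = inverse ((\<eta>/2/4) ^ card I)"
  have M0: "M > 0" using \<eta> by (simp add: M_def)
  have bound: "norm (W s) \<le> M" if s: "Re s > s0"
    and good: "(\<forall>i\<in>I. \<eta>/2 \<le> \<bar>sin (pi * (a i * Re s + b i))\<bar>) \<or> (\<forall>i\<in>I. \<bar>pi * a i * Im s\<bar> \<ge> 1)" for s
  proof -
    let ?e = "exp (pi * \<bar>Im s\<bar> * (\<Sum>i\<in>I. \<bar>a i\<bar>))"
    have "(\<eta>/2/4) ^ card I * ?e \<le> norm (?B s)"
      using \<eta> good by (intro norm_sin_prod_ge fin) auto
    then have "?e \<le> M * norm (?B s)" using \<eta> by (simp add: M_def field_simps)
    moreover have "norm (?A s) \<le> ?e"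
    proof -
      have "norm (?A s) \<le> exp (pi * \<bar>Im s\<bar> * (\<Sum>i\<in>I'. \<bar>a' i\<bar>))" by (rule norm_sin_prod_le[OF fin(2)])
      also have "\<dots> \<le> ?e" using le by (auto intro!: mult_left_mono)
      finally show ?thesis .
    qed
    moreover have "norm (?B s) > 0"
    proof (rule ccontr)
      assume "\<not> ?thesis"
      then have "?B s = 0" by simp
      with \<open>?e \<le> M * norm (?B s)\<close> show False using exp_gt_zero[of "pi * \<bar>Im s\<bar> * (\<Sum>i\<in>I. \<bar>a i\<bar>)"] by simp
    qed
    moreover have "norm (?A s) = norm (W s) * norm (?B s)" using eq[OF s] by (simp add: norm_mult)
    ultimately have "norm (W s) * norm (?B s) \<le> M * norm (?B s)" by linarith
    then show ?thesis using \<open>norm (?B s) > 0\<close> by (rule mult_right_le_imp_le)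
  qed
  have goodT: "\<forall>\<^sub>F n in sequentially. \<forall>i\<in>I. \<eta>/2 \<le> \<bar>sin (pi * (a i * (x0 + T n) + b i))\<bar>"
  proof -
    have "\<forall>\<^sub>F n in sequentially. \<eta>/2 < \<bar>sin (pi * (a i * (x0 + T n) + b i))\<bar>" if i: "i \<in> I" for i
    proof (rule order_tendstoD(1))
      have "(\<lambda>n. sin_prod {i} a b (of_real x0 + of_real (T n))) \<longlonglongrightarrow> sin_prod {i} a b (of_real x0)"
        by (intro sin_prod_recurrence_lim[where p = p] limI) (use i in auto)
      then have "(\<lambda>n. sin (pi * (a i * (x0 + T n) + b i))) \<longlonglongrightarrow> sin (pi * (a i * x0 + b i))"
        by (simp add: sin_prod_def tendsto_of_real_iff sin_of_real flip: of_real_add of_real_mult)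
      then show "(\<lambda>n. \<bar>sin (pi * (a i * (x0 + T n) + b i))\<bar>) \<longlonglongrightarrow> \<bar>sin (pi * (a i * x0 + b i))\<bar>"
        by (rule tendsto_rabs)
      show "\<eta>/2 < \<bar>sin (pi * (a i * x0 + b i))\<bar>" using \<eta>(1) \<eta>(3)[OF i] by linarith
    qed
    then have "\<forall>\<^sub>F n in sequentially. \<eta>/2 \<le> \<bar>sin (pi * (a i * (x0 + T n) + b i))\<bar>" if "i \<in> I" for i
      using that by (blast intro: eventually_mono less_imp_le)
    then show ?thesis using fin(1) by (simp add: eventually_ball_finite_distrib)
  qed
  obtain h0 where h0: "h0 > 0" "\<And>i h. i \<in> I \<Longrightarrow> \<bar>h\<bar> \<ge> h0 \<Longrightarrow> \<bar>pi * a i * h\<bar> \<ge> 1"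
  proof -
    define h0 where "h0 = Max (insert 1 ((\<lambda>i. 1 / \<bar>pi * a i\<bar>) ` I))"
    have "\<bar>pi * a i * h\<bar> \<ge> 1" if "i \<in> I" "\<bar>h\<bar> \<ge> h0" for i h
    proof -
      have "1 / \<bar>pi * a i\<bar> \<le> h0" using fin(1) that(1) by (auto simp: h0_def)
      also note that(2)
      finally show ?thesis using nz(1)[OF that(1)] by (simp add: abs_mult field_simps)
    qed
    moreover have "h0 > 0" unfolding h0_def using fin(1) by (subst Max_gr_iff) auto
    ultimately show ?thesis using that by blast
  qed
  have Wbd: "norm (W s) \<le> M" if s: "Re s \<ge> x0" for s
  proof -
    have "\<forall>\<^sub>F n in sequentially. real n > max (Re s - x0) 1"
      by (intro eventually_compose_filterlim[OF eventually_gt_at_top filterlim_real_sequentially])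
    with goodT have "\<forall>\<^sub>F n in sequentially. real n > max (Re s - x0) 1 \<and> (\<forall>i\<in>I. \<eta>/2 \<le> \<bar>sin (pi * (a i * (x0 + T n) + b i))\<bar>)"
      by eventually_elim simp
    then obtain n where n: "real n > max (Re s - x0) 1" "\<forall>i\<in>I. \<eta>/2 \<le> \<bar>sin (pi * (a i * (x0 + T n) + b i))\<bar>"
      using eventually_happens'[OF sequentially_bot] by blast
    \<comment> \<open>The height covers s and puts both horizontal sides where the sines are large;
      the right side lies on a translated good line beyond s.\<close>
    define h where "h = max h0 \<bar>Im s\<bar>"
    define S where "S = cbox (Complex x0 (-h)) (Complex (x0 + T n) h)"
    have Ssub: "S \<subseteq> {s. Re s > s0}" using x0(1) by (auto simp: S_def in_cbox_complex_iff)
    show ?thesis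
    proof (rule maximum_modulus_frontier[of W S])
      show "W holomorphic_on interior S"
        by (rule holomorphic_on_subset[OF W order_trans[OF interior_subset Ssub]])
      have "closure S = S" by (simp add: S_def)
      then show "continuous_on (closure S) W"
        using holomorphic_on_imp_continuous_on[OF holomorphic_on_subset[OF W Ssub]] by simp
      show "bounded S" by (simp add: S_def)
      show "s \<in> S" using s n(1) T(1)[of n] by (auto simp: S_def in_cbox_complex_iff h_def)
      fix w assume "w \<in> frontier S"
      then have w: "w \<in> cbox (Complex x0 (-h)) (Complex (x0 + T n) h) - box (Complex x0 (-h)) (Complex (x0 + T n) h)"
        by (simp add: S_def frontier_cbox)
      then have "Re w = x0 \<or> Re w = x0 + T n \<or> \<bar>Im w\<bar> = h"
        by (auto simp: in_cbox_complex_iff in_box_complex_iff)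
      then have "(\<forall>i\<in>I. \<eta>/2 \<le> \<bar>sin (pi * (a i * Re w + b i))\<bar>) \<or> (\<forall>i\<in>I. \<bar>pi * a i * Im w\<bar> \<ge> 1)"
      proof (elim disjE)
        assume "Re w = x0" then show ?thesis using \<eta> by force
      next
        assume "\<bar>Im w\<bar> = h" then show ?thesis using h0(2)[of _ "Im w"] by (auto simp: h_def)
      qed (use n(2) in auto)
      moreover have "Re w > s0" using w Ssub by (auto simp: S_def)
      ultimately show "norm (W w) \<le> M" by (intro bound) auto
    qed
  qed
  \<comment> \<open>The translates \<open>s + T n\<close> eventually lie in the half-plane where W
    is bounded; as n grows, both products return to their values at s.\<close>
  have dom: "norm (?A s) \<le> M * norm (?B s)" for s
  proof (rule tendsto_le[OF _ tendsto_mult_left[OF tendsto_norm[OF Blim]] tendsto_norm[OF Alim]])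
    have "\<forall>\<^sub>F n in sequentially. real n > x0 - Re s"
      by (intro eventually_compose_filterlim[OF eventually_gt_at_top filterlim_real_sequentially])
    then show "\<forall>\<^sub>F n in sequentially. norm (?A (s + of_real (T n))) \<le> M * norm (?B (s + of_real (T n)))"
    proof eventually_elim
      case (elim n)
      have r: "Re (s + of_real (T n)) \<ge> x0" using elim T(1)[of n] by simp
      then have "norm (W (s + of_real (T n))) * norm (?B (s + of_real (T n))) \<le> M * norm (?B (s + of_real (T n)))"
        by (intro mult_right_mono Wbd) auto
      moreover have "Re (s + of_real (T n)) > s0" using r x0(1) by linarith
      ultimately show ?case by (subst eq) (auto simp: norm_mult)
    qed
  qed simp
  have "?B (of_real x0) \<noteq> 0"
    using x0(2) fin(1) by (simp add: sin_prod_def sin_of_real flip: of_real_add of_real_mult)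
  from entire_dominated_imp_multiple[OF holomorphic_sin_prod holomorphic_sin_prod this dom] that show ?thesis by blast
qed

text \<open>The auxiliary lemma needs a numerator that grows no faster than the denominator. Since W
  has no zeros, the roles can be exchanged otherwise; once the products are proportional, their
  growth on a vertical line shows that the totals are equal in either case.\<close>

theorem sin_prod_quotient_const:
  assumes fin: "finite I" "finite I'"
    and nz: "\<And>i. i \<in> I \<Longrightarrow> a i \<noteq> 0" "\<And>i. i \<in> I' \<Longrightarrow> a' i \<noteq> 0"
    and W: "W holomorphic_on {s. Re s > s0}"
    and W0: "\<And>s. Re s > s0 \<Longrightarrow> W s \<noteq> 0"
    and eq: "\<And>s. Re s > s0 \<Longrightarrow> sin_prod I' a' b' s = W s * sin_prod I a b s"
  obtains c where "\<And>s. sin_prod I' a' b' s = c * sin_prod I a b s"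
    "(\<Sum>i\<in>I'. \<bar>a' i\<bar>) = (\<Sum>i\<in>I. \<bar>a i\<bar>)" "norm c * 2 ^ card I' = 2 ^ card I"
proof -
  let ?A = "sin_prod I' a' b'" and ?B = "sin_prod I a b"
  let ?x = "\<Sum>i\<in>I'. \<bar>a' i\<bar>" and ?y = "\<Sum>i\<in>I. \<bar>a i\<bar>"
  have limA: "((\<lambda>h. norm (?A (Complex 0 h)) / exp (pi * \<bar>h\<bar> * ?x)) \<longlongrightarrow> (1/2) ^ card I') at_top"
    by (rule sin_prod_exp_lim) (use fin nz in auto)
  have limB: "((\<lambda>h. norm (?B (Complex 0 h)) / exp (pi * \<bar>h\<bar> * ?y)) \<longlongrightarrow> (1/2) ^ card I) at_top"
    by (rule sin_prod_exp_lim) (use fin nz in auto)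
  have ex: "\<exists>z. ?A z \<noteq> 0"
  proof (rule ccontr)
    assume "\<not> ?thesis"
    then show False using limA by (simp add: tendsto_const_iff)
  qed
  \<comment> \<open>If p were less than q, f divided by the larger exponential would tend to 0,
    whereas r * g divided by it has a positive limit.\<close>
  have key: "p = q \<and> r * 2 ^ m = 2 ^ n"
    if F: "((\<lambda>h. f h / exp (pi * \<bar>h\<bar> * p)) \<longlongrightarrow> (1/2) ^ m) at_top"
    and G: "((\<lambda>h. g h / exp (pi * \<bar>h\<bar> * q)) \<longlongrightarrow> (1/2) ^ n) at_top"
    and le: "p \<le> q" and fg: "\<And>h. f h = r * g h" and r: "r > 0"
    for f g :: "real \<Rightarrow> real" and p q r and m n :: nat
  proof -
    have "p = q"
    proof (rule ccontr)
      assume "p \<noteq> q" then have lt: "p - q < 0" using le by simp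
      have "filterlim (\<lambda>h. (pi * (p - q)) * h) at_bot at_top"
        using lt by (intro filterlim_tendsto_neg_mult_at_bot[OF tendsto_const _ filterlim_ident]) (simp add: mult_less_0_iff)
      from filterlim_compose[OF exp_at_bot this] have E: "((\<lambda>h. exp (pi * (p - q) * h)) \<longlongrightarrow> 0) at_top" .
      have "((\<lambda>h. (f h / exp (pi * \<bar>h\<bar> * p)) * exp (pi * (p - q) * h)) \<longlongrightarrow> (1/2) ^ m * 0) at_top"
        by (intro tendsto_mult F E)
      moreover have "\<forall>\<^sub>F h in at_top. (f h / exp (pi * \<bar>h\<bar> * p)) * exp (pi * (p - q) * h) = r * (g h / exp (pi * \<bar>h\<bar> * q))"
        using eventually_ge_at_top[of 0]
      proof eventually_elim
        case (elim h)
        have "exp (pi * (p - q) * h) = exp (pi * \<bar>h\<bar> * p) / exp (pi * \<bar>h\<bar> * q)"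
          using elim by (simp add: exp_diff[symmetric] algebra_simps)
        then show ?case by (simp add: fg)
      qed
      ultimately have "((\<lambda>h. r * (g h / exp (pi * \<bar>h\<bar> * q))) \<longlongrightarrow> (1/2) ^ m * 0) at_top"
        by (rule Lim_transform_eventually)
      moreover have "((\<lambda>h. r * (g h / exp (pi * \<bar>h\<bar> * q))) \<longlongrightarrow> r * (1/2) ^ n) at_top"
        by (intro tendsto_mult_left G)
      ultimately have "(1/2) ^ m * 0 = r * (1/2) ^ n" using tendsto_unique trivial_limit_at_top_linorder by blast
      then show False using r by simp
    qed
    moreover have "(1/2) ^ m = r * (1/2) ^ n"
    proof (rule tendsto_unique[OF _ F])
      have "((\<lambda>h. r * (g h / exp (pi * \<bar>h\<bar> * q))) \<longlongrightarrow> r * (1/2) ^ n) at_top"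
        by (intro tendsto_mult_left G)
      then show "((\<lambda>h. f h / exp (pi * \<bar>h\<bar> * p)) \<longlongrightarrow> r * (1/2) ^ n) at_top"
        by (simp add: fg \<open>p = q\<close>)
    qed simp
    ultimately show ?thesis by (simp add: power_one_over field_simps)
  qed
  show ?thesis
  proof (cases "?x \<le> ?y")
    case True
    obtain c where c: "\<And>s. ?A s = c * ?B s"
      using sin_prod_quotient_const_aux[OF fin nz W eq True] by blast
    have "c \<noteq> 0" using c ex by auto
    with key[OF limA limB True, of "norm c"] c show ?thesis
      by (intro that[of c]) (auto simp: norm_mult)
  next
    case False
    have eq': "?B s = inverse (W s) * ?A s" if "Re s > s0" for s
      using eq[OF that] W0[OF that] by simp
    have W': "(\<lambda>s. inverse (W s)) holomorphic_on {s. Re s > s0}" using W W0 by (intro holomorphic_intros) auto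
    from False have le': "?y \<le> ?x" by simp
    obtain c where c: "\<And>s. ?B s = c * ?A s"
      using sin_prod_quotient_const_aux[OF fin(2,1) nz(2,1) W' eq' le'] by blast
    have c0: "c \<noteq> 0"
    proof
      assume "c = 0" then have "\<And>s. ?B s = 0" using c by simp
      then show False using limB by (simp add: tendsto_const_iff)
    qed
    have "?y = ?x \<and> norm c * 2 ^ card I = 2 ^ card I'"
      using key[OF limB limA, of "norm c"] c False c0 by (auto simp: norm_mult)
    then show ?thesis using c c0
    proof (intro that[of "inverse c"])
      have n: "norm (inverse c) * norm c = 1" using c0 by (simp flip: norm_mult)
      have "norm (inverse c) * 2 ^ card I' = (norm (inverse c) * norm c) * 2 ^ card I"
        using \<open>?y = ?x \<and> norm c * 2 ^ card I = 2 ^ card I'\<close> by (simp only: mult.assoc)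
      then show "norm (inverse c) * 2 ^ card I' = 2 ^ card I" unfolding n by simp
    qed (use \<open>?y = ?x \<and> norm c * 2 ^ card I = 2 ^ card I'\<close> c c0 in auto)
  qed
qed

section \<open>Continuation of Laplace transforms\<close>

text \<open>The sign is that of a moment generating function, so that the transform of Y = log X at
  s is E X^s.\<close>

definition laplace :: "'w measure \<Rightarrow> ('w \<Rightarrow> real) \<Rightarrow> complex \<Rightarrow> complex" where
  "laplace M Y s = (LINT y|M. exp (s * of_real (Y y)))"

lemma exp_partial_sum_le:
  assumes "(x::real) \<ge> 0"
  shows "(\<Sum>k<n. x ^ k / fact k) \<le> exp x"
proof -
  have s: "(\<lambda>k. x ^ k / fact k) sums exp x"
    using exp_converges[of x] by (simp add: divide_inverse mult.commute)
  have "(\<Sum>k<n. x ^ k / fact k) \<le> (\<Sum>k. x ^ k / fact k)"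
    using assms by (intro sum_le_suminf sums_summable[OF s]) auto
  then show ?thesis using sums_unique[OF s] by simp
qed

lemma exp_abs_le:
  fixes x r y :: real
  shows "exp (x * y) * exp (r * \<bar>y\<bar>) \<le> exp ((x + r) * y) + exp ((x - r) * y)"
proof (cases "y \<ge> 0")
  case True
  then have "exp (x * y) * exp (r * \<bar>y\<bar>) = exp ((x + r) * y)" by (simp add: exp_add[symmetric] algebra_simps)
  then show ?thesis by simp
next
  case False
  then have "exp (x * y) * exp (r * \<bar>y\<bar>) = exp ((x - r) * y)" by (simp add: exp_add[symmetric] algebra_simps)
  then show ?thesis by simp
qed

text \<open>Termwise integration by dominated convergence: the partial sums of the exponential
  series are bounded by \<open>exp (Re c * Y y) * exp (r * \<bar>Y y\<bar>)\<close>, hence by the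
  sum of the exponentials at the two end points.\<close>

lemma laplace_power_series:
  fixes Y :: "'w \<Rightarrow> real" and c :: complex
  assumes [measurable]: "Y \<in> borel_measurable M" and r: "r > 0"
    and int1: "integrable M (\<lambda>y. exp ((Re c + r) * Y y))"
    and int2: "integrable M (\<lambda>y. exp ((Re c - r) * Y y))"
  shows "integrable M (\<lambda>y. exp (c * of_real (Y y)) * of_real (Y y) ^ k)"
    and "norm z \<le> r \<Longrightarrow> integrable M (\<lambda>y. exp ((c + z) * of_real (Y y)))"
    and "norm z \<le> r \<Longrightarrow> (\<lambda>k. (LINT y|M. exp (c * of_real (Y y)) * of_real (Y y) ^ k) / fact k * z ^ k)
       sums laplace M Y (c + z)"
proof -
  define w where "w y = exp ((Re c + r) * Y y) + exp ((Re c - r) * Y y)" for y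
  have wi: "integrable M w" unfolding w_def by (intro Bochner_Integration.integrable_add int1 int2)
  have wle: "exp (Re c * Y y) * exp (r * \<bar>Y y\<bar>) \<le> w y" for y
    unfolding w_def by (rule exp_abs_le)
  have partial: "exp (Re c * Y y) * (\<Sum>k<n. (r * \<bar>Y y\<bar>) ^ k / fact k) \<le> w y" for y n
  proof -
    have "exp (Re c * Y y) * (\<Sum>k<n. (r * \<bar>Y y\<bar>) ^ k / fact k) \<le> exp (Re c * Y y) * exp (r * \<bar>Y y\<bar>)"
      using r by (intro mult_left_mono exp_partial_sum_le) auto
    then show ?thesis using wle[of y] by (rule order_trans)
  qed
  show I: "integrable M (\<lambda>y. exp (c * of_real (Y y)) * of_real (Y y) ^ k)" for k
  proof (rule Bochner_Integration.integrable_bound)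
    show "integrable M (\<lambda>y. (fact k / r ^ k) * w y)" using wi by simp
    have "norm (exp (c * of_real (Y y)) * of_real (Y y) ^ k) \<le> (fact k / r ^ k) * w y" for y
    proof -
      have "(r * \<bar>Y y\<bar>) ^ k / fact k \<le> (\<Sum>k<Suc k. (r * \<bar>Y y\<bar>) ^ k / fact k)"
        using r by (intro member_le_sum) auto
      then have "exp (Re c * Y y) * ((r * \<bar>Y y\<bar>) ^ k / fact k) \<le> w y"
        by (intro order_trans[OF mult_left_mono partial[of y "Suc k"]]) auto
      then have "(fact k / r ^ k) * (exp (Re c * Y y) * ((r * \<bar>Y y\<bar>) ^ k / fact k)) \<le> (fact k / r ^ k) * w y"
        using r by (intro mult_left_mono) auto
      moreover have "(fact k / r ^ k) * (exp (Re c * Y y) * ((r * \<bar>Y y\<bar>) ^ k / fact k)) =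
          norm (exp (c * of_real (Y y)) * of_real (Y y) ^ k)"
        using r by (simp add: norm_mult norm_power power_mult_distrib)
      ultimately show ?thesis by simp
    qed
    then show "AE y in M. norm (exp (c * of_real (Y y)) * of_real (Y y) ^ k) \<le> norm ((fact k / r ^ k) * w y)"
      unfolding real_norm_def by (intro AE_I2 order_trans[OF _ abs_ge_self])
  qed simp
  assume z: "norm z \<le> r"
  define t where "t n y = (\<Sum>k<n. exp (c * of_real (Y y)) * of_real (Y y) ^ k / fact k * z ^ k)" for n y
  have lim: "(\<lambda>n. t n y) \<longlonglongrightarrow> exp ((c + z) * of_real (Y y))" for y
  proof -
    have "(\<lambda>k. exp (c * of_real (Y y)) * ((z * of_real (Y y)) ^ k /\<^sub>R fact k)) sums
       (exp (c * of_real (Y y)) * exp (z * of_real (Y y)))"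
      by (intro sums_mult exp_converges)
    moreover have "exp (c * of_real (Y y)) * ((z * of_real (Y y)) ^ k /\<^sub>R fact k) =
        exp (c * of_real (Y y)) * of_real (Y y) ^ k / fact k * z ^ k" for k
      by (simp add: power_mult_distrib scaleR_conv_of_real divide_inverse mult_ac)
    moreover have "exp (c * of_real (Y y)) * exp (z * of_real (Y y)) = exp ((c + z) * of_real (Y y))"
      by (simp only: exp_add distrib_right)
    ultimately show ?thesis unfolding sums_def t_def by (simp only:)
  qed
  have tb: "norm (t n y) \<le> w y" for n y
  proof -
    have "norm (t n y) \<le> (\<Sum>k<n. exp (Re c * Y y) * ((r * \<bar>Y y\<bar>) ^ k / fact k))"
      unfolding t_def
    proof (rule sum_norm_le)
      fix k
      have "norm (exp (c * of_real (Y y)) * of_real (Y y) ^ k / fact k * z ^ k) =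
         exp (Re c * Y y) * (\<bar>Y y\<bar> ^ k / fact k) * norm z ^ k"
        by (simp add: norm_mult norm_power norm_divide)
      also have "\<dots> \<le> exp (Re c * Y y) * (\<bar>Y y\<bar> ^ k / fact k) * r ^ k"
        using z by (intro mult_left_mono power_mono) auto
      finally show "norm (exp (c * of_real (Y y)) * of_real (Y y) ^ k / fact k * z ^ k) \<le>
        exp (Re c * Y y) * ((r * \<bar>Y y\<bar>) ^ k / fact k)" by (simp add: power_mult_distrib mult_ac)
    qed
    also have "\<dots> \<le> w y" unfolding sum_distrib_left[symmetric] by (rule partial)
    finally show ?thesis .
  qed
  have tm: "t n \<in> borel_measurable M" for n unfolding t_def by measurable
  show "integrable M (\<lambda>y. exp ((c + z) * of_real (Y y)))"
    by (rule integrable_dominated_convergence[where s = t and w = w]) (use wi lim tb tm in auto)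
  have "(\<lambda>n. integral\<^sup>L M (t n)) \<longlonglongrightarrow> laplace M Y (c + z)"
    unfolding laplace_def
    by (rule integral_dominated_convergence[where s = t and w = w]) (use wi lim tb tm in auto)
  moreover have "integral\<^sup>L M (t n) = (\<Sum>k<n. (LINT y|M. exp (c * of_real (Y y)) * of_real (Y y) ^ k) / fact k * z ^ k)" for n
    unfolding t_def using I by (subst Bochner_Integration.integral_sum) auto
  ultimately show "(\<lambda>k. (LINT y|M. exp (c * of_real (Y y)) * of_real (Y y) ^ k) / fact k * z ^ k)
       sums laplace M Y (c + z)"
    by (simp add: sums_def)
qed

lemma laplace_holomorphic_on_ball:
  assumes Y: "Y \<in> borel_measurable M" and r: "r > 0"
    and int1: "integrable M (\<lambda>y. exp ((Re c + r) * Y y))"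
    and int2: "integrable M (\<lambda>y. exp ((Re c - r) * Y y))"
  shows "laplace M Y holomorphic_on ball c r"
proof (rule power_series_holomorphic)
  fix w assume "w \<in> ball c r"
  then have "norm (w - c) \<le> r" by (simp add: dist_norm norm_minus_commute)
  from laplace_power_series(3)[OF assms this]
  show "(\<lambda>k. (LINT y|M. exp (c * of_real (Y y)) * of_real (Y y) ^ k) / fact k * (w - c) ^ k) sums laplace M Y w"
    by simp
qed

lemma islimpt_real_segment:
  assumes "e > 0"
  shows "complex_of_real x islimpt (complex_of_real ` {x - e<..<x + e})"
proof (rule islimptI)
  fix T assume "complex_of_real x \<in> T" "open T"
  then obtain d where d: "d > 0" "ball (complex_of_real x) d \<subseteq> T" using open_contains_ball by blast
  let ?y = "x + min d e / 2"
  have "complex_of_real ?y \<in> ball (complex_of_real x) d" using d(1) assms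
    by (simp add: dist_norm flip: of_real_add of_real_diff)
  moreover have "complex_of_real ?y \<in> complex_of_real ` {x - e<..<x + e}" using d(1) assms by (intro imageI) auto
  moreover have "complex_of_real ?y \<noteq> complex_of_real x" using d(1) assms by (simp flip: of_real_add)
  ultimately show "\<exists>y\<in>complex_of_real ` {x - e<..<x + e}. y \<in> T \<and> y \<noteq> complex_of_real x" using d(2) by blast
qed

text \<open>Landau's argument: the Taylor coefficients of even order at a real point are nonnegative,
  so the Laplace transform converges as far as the Taylor series of its continuation does.\<close>

lemma laplace_extend_ball:
  fixes Y :: "'w \<Rightarrow> real" and x R e :: real
  assumes [measurable]: "Y \<in> borel_measurable M" and e: "e > 0"
    and F: "F holomorphic_on ball (of_real x) R"
    and int: "\<And>s. \<bar>s - x\<bar> < e \<Longrightarrow> integrable M (\<lambda>y. exp (s * Y y))"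
    and eq: "\<And>s. \<bar>s - x\<bar> < e \<Longrightarrow> laplace M Y (of_real s) = F (of_real s)"
    and z: "norm z < R"
  shows "integrable M (\<lambda>y. exp ((of_real x + z) * of_real (Y y)))"
    and "laplace M Y (of_real x + z) = F (of_real x + z)"
proof -
  have R: "R > 0" using z norm_ge_zero[of z] by linarith
  define c where "c = complex_of_real x"
  \<comment> \<open>The bound e/2 keeps x + \<rho> and x - \<rho> strictly inside the interval of
    known integrability.\<close>
  define \<rho> where "\<rho> = min (e/2) R"
  have \<rho>: "\<rho> > 0" "\<rho> < e" "\<rho> \<le> R" using e R by (auto simp: \<rho>_def min_def)
  have i1: "integrable M (\<lambda>y. exp ((Re c + \<rho>) * Y y))" "integrable M (\<lambda>y. exp ((Re c - \<rho>) * Y y))"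
    using int[of "x + \<rho>"] int[of "x - \<rho>"] \<rho> by (auto simp: c_def)
  define m where "m k = (LINT y|M. exp (c * of_real (Y y)) * of_real (Y y) ^ k)" for k
  define a where "a k = (deriv ^^ k) F c / fact k" for k
  have holE: "laplace M Y holomorphic_on ball c \<rho>"
    by (rule laplace_holomorphic_on_ball) (use i1 \<rho> in auto)
  have holF: "F holomorphic_on ball c \<rho>"
    using F \<rho>(3) unfolding c_def by (meson holomorphic_on_subset subset_ball)
  have EF: "laplace M Y w - F w = 0" if "w \<in> ball c \<rho>" for w
  proof (rule analytic_continuation[where f = "\<lambda>w. laplace M Y w - F w" and U = "complex_of_real ` {x - \<rho><..<x + \<rho>}" and \<xi> = c and S = "ball c \<rho>"])
    show "(\<lambda>w. laplace M Y w - F w) holomorphic_on ball c \<rho>" by (intro holomorphic_intros holE holF)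
    show "complex_of_real ` {x - \<rho><..<x + \<rho>} \<subseteq> ball c \<rho>"
      by (auto simp: c_def dist_norm abs_less_iff simp flip: of_real_diff)
    show "c islimpt complex_of_real ` {x - \<rho><..<x + \<rho>}" unfolding c_def by (rule islimpt_real_segment[OF \<rho>(1)])
    fix w assume "w \<in> complex_of_real ` {x - \<rho><..<x + \<rho>}"
    then show "laplace M Y w - F w = 0" using eq \<rho>(2) by (auto simp: abs_less_iff)
  qed (use \<rho> that in auto)
  have sF: "(\<lambda>k. a k * w ^ k) sums F (c + w)" if "norm w < R" for w
    using holomorphic_power_series[OF F, of "c + w"] that by (simp add: a_def c_def dist_norm)
  \<comment> \<open>Both power series represent F near c. So the moments of Y under the weight exp
    (x Y) are given by Taylor coefficients of F, whose series converges on the larger disc.\<close>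
  have "m k / fact k = a k" for k
  proof -
    have ev: "eventually (\<lambda>w. w \<in> ball 0 \<rho>) (nhds (0::complex))" using \<rho> by (intro eventually_nhds_in_open) auto
    have "(\<lambda>w. F (c + w)) has_fps_expansion Abs_fps a"
      by (rule has_fps_expansionI, rule eventually_mono[OF ev]) (use sF \<rho> in auto)
    moreover have "(\<lambda>w. F (c + w)) has_fps_expansion Abs_fps (\<lambda>k. m k / fact k)"
    proof (rule has_fps_expansionI, rule eventually_mono[OF ev])
      fix w :: complex assume w: "w \<in> ball 0 \<rho>"
      then have "laplace M Y (c + w) = F (c + w)" using EF[of "c + w"] by (simp add: dist_norm)
      moreover have "(\<lambda>k. m k / fact k * w ^ k) sums laplace M Y (c + w)"
        unfolding m_def by (rule laplace_power_series(3)[OF _ \<rho>(1) i1]) (use w in auto)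
      ultimately show "(\<lambda>n. fps_nth (Abs_fps (\<lambda>k. m k / fact k)) n * w ^ n) sums F (c + w)" by simp
    qed
    ultimately have "Abs_fps a = Abs_fps (\<lambda>k. m k / fact k)" by (rule fps_expansion_unique_complex)
    then show ?thesis by (metis fps_nth_Abs_fps)
  qed
  then have ma: "\<And>k. m k / fact k = a k" by blast
  \<comment> \<open>cosh keeps exactly the terms of even order. They are nonnegative, so summability
    of their integrals gives integrability of the sum, which in turn dominates the exponentials at x
    + r and x - r.\<close>
  have cosh_int: "integrable M (\<lambda>y. exp (x * Y y) * cosh (r * Y y))" if r: "0 < r" "r < R" for r
  proof -
    define f where "f k y = (if even k then exp (x * Y y) * ((r * Y y) ^ k / fact k) else 0)" for k y
    have fs: "(\<lambda>k. f k y) sums (exp (x * Y y) * cosh (r * Y y))" for y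
    proof -
      have "(\<lambda>k. exp (x * Y y) * (if even k then (r * Y y) ^ k /\<^sub>R fact k else 0)) sums (exp (x * Y y) * cosh (r * Y y))"
        by (intro sums_mult cosh_converges)
      moreover have "(\<lambda>k. exp (x * Y y) * (if even k then (r * Y y) ^ k /\<^sub>R fact k else 0)) = (\<lambda>k. f k y)"
        by (auto simp: f_def divide_inverse mult_ac)
      ultimately show ?thesis by simp
    qed
    have f0: "f k y \<ge> 0" for k y
      by (auto simp: f_def zero_le_even_power intro!: mult_nonneg_nonneg divide_nonneg_nonneg)
    have reint: "integrable M (\<lambda>y. exp (x * Y y) * Y y ^ k)"
      and rem: "m k = of_real (LINT y|M. exp (x * Y y) * Y y ^ k)" for k
    proof -
      have E: "exp (c * of_real (Y y)) * of_real (Y y) ^ k = complex_of_real (exp (x * Y y) * Y y ^ k)" for y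
        by (simp add: c_def exp_of_real[symmetric])
      have "integrable M (\<lambda>y. complex_of_real (exp (x * Y y) * Y y ^ k))"
        using laplace_power_series(1)[OF _ \<rho>(1) i1, of k] unfolding E by simp
      then show "integrable M (\<lambda>y. exp (x * Y y) * Y y ^ k)" by (simp only: complex_of_real_integrable_eq)
      show "m k = of_real (LINT y|M. exp (x * Y y) * Y y ^ k)"
        unfolding m_def E by (rule integral_complex_of_real)
    qed
    have f_alt: "f k = (\<lambda>y. (if even k then r ^ k / fact k else 0) * (exp (x * Y y) * Y y ^ k))" for k
      by (auto simp: f_def power_mult_distrib)
    have fi: "integrable M (f k)" for k unfolding f_alt by (intro integrable_mult_right reint)
    have fint: "(LINT y|M. norm (f k y)) \<le> norm (a k * of_real r ^ k)" for k
    proof -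
      have "(LINT y|M. norm (f k y)) = integral\<^sup>L M (f k)" using f0[of k] by simp
      also have "\<dots> \<le> norm (complex_of_real (integral\<^sup>L M (f k)))" by simp
      also have "\<dots> \<le> norm (a k * of_real r ^ k)"
      proof -
        have "integral\<^sup>L M (f k) = (if even k then r ^ k / fact k else 0) * (LINT y|M. exp (x * Y y) * Y y ^ k)"
          unfolding f_alt by (rule integral_mult_right_zero)
        then have "complex_of_real (integral\<^sup>L M (f k)) = (if even k then a k * of_real r ^ k else 0)"
          unfolding ma[symmetric] rem by simp
        then show ?thesis by simp
      qed
      finally show ?thesis .
    qed
    \<comment> \<open>Convergence at a radius strictly beyond r gives absolute convergence at
      r.\<close>
    obtain r' where r': "r < r'" "r' < R" using dense r(2) by blast
    have "summable (\<lambda>k. a k * of_real r' ^ k)" using sF[of "of_real r'"] r r' by (auto intro: sums_summable)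
    then have "summable (\<lambda>k. norm (a k * of_real r ^ k))"
      by (rule powser_insidea) (use r r' in auto)
    then have "summable (\<lambda>k. LINT y|M. norm (f k y))"
      by (rule summable_comparison_test'[where N = 0]) (use fint in auto)
    then have "integrable M (\<lambda>y. \<Sum>k. f k y)"
      using fs f0 by (intro integrable_suminf fi AE_I2) (auto intro: sums_summable)
    then show ?thesis using sums_unique[OF fs] by simp
  qed
  obtain r where r: "norm z < r" "r < R" using dense z by blast
  have r0: "r > 0" using r(1) norm_ge_zero[of z] by linarith
  have "integrable M (\<lambda>y. exp ((x + t) * Y y))" if t: "t = r \<or> t = -r" for t
  proof (rule Bochner_Integration.integrable_bound)
    show "integrable M (\<lambda>y. 2 * (exp (x * Y y) * cosh (r * Y y)))"
      using cosh_int[OF r0 r(2)] by simp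
    have "exp ((x + t) * Y y) \<le> 2 * (exp (x * Y y) * cosh (r * Y y))" for y
    proof -
      have "exp ((x + t) * Y y) = exp (x * Y y) * exp (t * Y y)" by (simp add: exp_add[symmetric] algebra_simps)
      also have "\<dots> \<le> exp (x * Y y) * (exp (r * Y y) + exp (- (r * Y y)))"
        using t by (intro mult_left_mono) auto
      finally show ?thesis by (simp add: cosh_def)
    qed
    then show "AE y in M. norm (exp ((x + t) * Y y)) \<le> norm (2 * (exp (x * Y y) * cosh (r * Y y)))"
      by (intro AE_I2) (metis abs_exp_cancel abs_ge_self order_trans real_norm_def)
  qed simp
  from this[of r] this[of "-r"] have i2: "integrable M (\<lambda>y. exp ((Re c + r) * Y y))" "integrable M (\<lambda>y. exp ((Re c - r) * Y y))"
    by (auto simp: c_def)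
  have nz: "norm z \<le> r" using r by simp
  show "integrable M (\<lambda>y. exp ((of_real x + z) * of_real (Y y)))"
    using laplace_power_series(2)[OF _ r0 i2 nz] by (simp add: c_def)
  have "(\<lambda>k. a k * z ^ k) sums laplace M Y (c + z)"
    using laplace_power_series(3)[OF _ r0 i2 nz] unfolding m_def[symmetric] ma by simp
  with sF[OF z] show "laplace M Y (of_real x + z) = F (of_real x + z)"
    using sums_unique2 by (auto simp: c_def)
qed

lemma integrable_exp_complex_iff:
  "integrable M (\<lambda>y. exp (complex_of_real s * of_real (Y y))) \<longleftrightarrow> integrable M (\<lambda>y. exp (s * Y y))"
proof -
  have "(\<lambda>y. exp (complex_of_real s * of_real (Y y))) = (\<lambda>y. complex_of_real (exp (s * Y y)))"
    by (simp add: exp_of_real[symmetric])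
  then show ?thesis by (simp only: complex_of_real_integrable_eq)
qed

text \<open>The disc of radius x - L about a known real point x reaches up to 2 x - L, so each step
  prolongs the known real interval by at least a fixed d. Discs about points far to the right
  exhaust the half-plane, which yields the complex arguments.\<close>

lemma laplace_extend_halfplane:
  fixes Y :: "'w \<Rightarrow> real" and L u v :: real
  assumes Y: "Y \<in> borel_measurable M" and uv: "L < u" "u < v"
    and F: "F holomorphic_on {s. Re s > L}"
    and int: "\<And>s. u < s \<Longrightarrow> s < v \<Longrightarrow> integrable M (\<lambda>y. exp (s * Y y))"
    and eq: "\<And>s. u < s \<Longrightarrow> s < v \<Longrightarrow> laplace M Y (of_real s) = F (of_real s)"
    and s: "Re s > L"
  shows "integrable M (\<lambda>y. exp (s * of_real (Y y)))" and "laplace M Y s = F s"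
proof -
  \<comment> \<open>A quarter of the length: the interval of radius e about v - e then starts at the
    midpoint \<open>(u + v) / 2\<close>, and its distance d from L is a lower bound for the gain in
    each step.\<close>
  define e d where "e = (v - u) / 4" and "d = (u + v) / 2 - L"
  have ed: "e > 0" "d > 0" using uv by (auto simp: e_def d_def)
  have ballF: "F holomorphic_on ball (of_real x) (x - L)" for x
  proof (rule holomorphic_on_subset[OF F], clarify)
    fix w assume "w \<in> ball (complex_of_real x) (x - L)"
    then have "\<bar>Re (of_real x - w)\<bar> < x - L" using abs_Re_le_cmod[of "of_real x - w"] by (simp add: dist_norm)
    then show "L < Re w" by auto
  qed
  have P: "\<forall>t. u < t \<and> t < v + real n * d \<longrightarrow> integrable M (\<lambda>y. exp (t * Y y)) \<and> laplace M Y (of_real t) = F (of_real t)" for n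
  proof (induction n)
    case 0
    then show ?case using int eq by simp
  next
    case (Suc n)
    define x where "x = v + real n * d - e"
    have nd: "real n * d \<ge> 0" using ed by simp
    have xe: "u < x - e" "x + e = v + real n * d"
  proof -
    have "v - (e + e) > u" using uv by (simp add: e_def field_simps)
    then show "u < x - e" "x + e = v + real n * d" using nd by (auto simp: x_def)
  qed
    show ?case
    proof (intro allI impI)
      fix t assume t: "u < t \<and> t < v + real (Suc n) * d"
      show "integrable M (\<lambda>y. exp (t * Y y)) \<and> laplace M Y (of_real t) = F (of_real t)"
      proof (cases "t < v + real n * d")
        case True
        then show ?thesis using Suc t by blast
      next
        case False
        have "t - x < x - L"
        proof -
          have "t < v + real n * d + d" using t by (simp add: algebra_simps)
          moreover have "d \<le> x - e - L"
          proof -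
            have "v - e - e = (u + v) / 2" by (simp add: e_def field_simps)
            then show ?thesis using nd by (simp add: x_def d_def)
          qed
          ultimately show ?thesis unfolding x_def by linarith
        qed
        moreover have "t - x > 0" using False xe(2) ed by linarith
        ultimately have z: "norm (complex_of_real (t - x)) < x - L" by (simp only: norm_of_real)
        have *: "integrable M (\<lambda>y. exp (s * Y y))" "laplace M Y (of_real s) = F (of_real s)" if "\<bar>s - x\<bar> < e" for s
          using Suc that xe by (auto simp: abs_less_iff)
        have "complex_of_real x + complex_of_real (t - x) = of_real t" by simp
        with laplace_extend_ball[OF Y ed(1) ballF * z] show ?thesis
          by (simp only: integrable_exp_complex_iff)
      qed
    qed
  qed
  \<comment> \<open>After expansion of the squares, \<open>norm (s - of_real x) < x - L\<close> says
    that x - L exceeds this quotient.\<close>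
  define X where "X = ((Re s - L)\<^sup>2 + (Im s)\<^sup>2) / (2 * (Re s - L)) + 1"
  obtain n where n: "real n * d > X + L - v + e" using ed reals_Archimedean3 by blast
  define x where "x = v + real n * d - e"
  have nd: "real n * d \<ge> 0" using ed by simp
  have xe: "u < x - e" "x + e = v + real n * d"
  proof -
    have "v - (e + e) > u" using uv by (simp add: e_def field_simps)
    then show "u < x - e" "x + e = v + real n * d" using nd by (auto simp: x_def)
  qed
  have xX: "x - L > X" using n by (simp add: x_def)
  have X0: "X > 0" unfolding X_def using s by (intro add_nonneg_pos divide_nonneg_pos) auto
  have z: "norm (s - of_real x) < x - L"
  proof (rule power2_less_imp_less)
    have "(Re s - L)\<^sup>2 + (Im s)\<^sup>2 < 2 * (Re s - L) * (x - L)"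
    proof -
      have "((Re s - L)\<^sup>2 + (Im s)\<^sup>2) / (2 * (Re s - L)) < x - L" using xX unfolding X_def by linarith
      then show ?thesis using s by (simp add: divide_less_eq mult.commute)
    qed
    moreover have "(norm (s - of_real x))\<^sup>2 = (Re s - x)\<^sup>2 + (Im s)\<^sup>2" by (simp add: cmod_power2)
    ultimately show "(norm (s - of_real x))\<^sup>2 < (x - L)\<^sup>2" by (simp add: power2_eq_square algebra_simps)
    show "0 \<le> x - L" using xX X0 by linarith
  qed
  have *: "integrable M (\<lambda>y. exp (s * Y y))" "laplace M Y (of_real s) = F (of_real s)" if "\<bar>s - x\<bar> < e" for s
    using P[of n] that xe by (auto simp: abs_less_iff)
  show "integrable M (\<lambda>y. exp (s * of_real (Y y)))" "laplace M Y s = F s"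
    using laplace_extend_ball[OF Y ed(1) ballF * z] by simp_all
qed

section \<open>Continuation past a possible pole at the origin\<close>

lemma (in finite_measure) integrable_exp_between:
  fixes Y :: "'a \<Rightarrow> real" and p q t :: real
  assumes [measurable]: "Y \<in> borel_measurable M"
    and "integrable M (\<lambda>y. exp (p * Y y))" "integrable M (\<lambda>y. exp (q * Y y))" "p \<le> t" "t \<le> q"
  shows "integrable M (\<lambda>y. exp (t * Y y))"
    and "(LINT y|M. exp (t * Y y)) \<le> (LINT y|M. exp (p * Y y)) + (LINT y|M. exp (q * Y y))"
proof -
  have le: "exp (t * Y y) \<le> exp (p * Y y) + exp (q * Y y)" for y
  proof (cases "Y y \<ge> 0")
    case True
    then have "exp (t * Y y) \<le> exp (q * Y y)" using mult_right_mono[OF \<open>t \<le> q\<close>, of "Y y"] by simp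
    then show ?thesis using exp_ge_zero[of "p * Y y"] by linarith
  next
    case False
    then have "exp (t * Y y) \<le> exp (p * Y y)" using mult_right_mono_neg[OF \<open>p \<le> t\<close>, of "Y y"] by simp
    then show ?thesis using exp_ge_zero[of "q * Y y"] by linarith
  qed
  have i: "integrable M (\<lambda>y. exp (p * Y y) + exp (q * Y y))" using assms by simp
  show t: "integrable M (\<lambda>y. exp (t * Y y))"
  proof (rule Bochner_Integration.integrable_bound[OF i])
    show "AE y in M. norm (exp (t * Y y)) \<le> norm (exp (p * Y y) + exp (q * Y y))"
    proof (rule AE_I2)
      fix y
      show "norm (exp (t * Y y)) \<le> norm (exp (p * Y y) + exp (q * Y y))"
        using le[of y] abs_ge_self[of "exp (p * Y y) + exp (q * Y y)"] unfolding real_norm_def abs_exp_cancel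
        by (rule order_trans)
    qed
  qed simp
  have "(LINT y|M. exp (t * Y y)) \<le> (LINT y|M. exp (p * Y y) + exp (q * Y y))"
    by (intro integral_mono t i le)
  then show "(LINT y|M. exp (t * Y y)) \<le> (LINT y|M. exp (p * Y y)) + (LINT y|M. exp (q * Y y))"
    using assms by simp
qed

text \<open>The moments may be known only at negative exponents. A pole at \<open>0\<close> is then excluded because the
  transform stays bounded as its argument increases to \<open>0\<close>.\<close>

lemma (in finite_measure) laplace_meromorphic_no_pole_strip:
  fixes Y :: "'a \<Rightarrow> real" and u v :: real
  assumes Y: "Y \<in> borel_measurable M" and uv: "u < v" "v \<le> 0"
    and F: "F nicely_meromorphic_on UNIV"
    and int: "\<And>s. u < s \<Longrightarrow> s < v \<Longrightarrow> integrable M (\<lambda>y. exp (s * Y y))"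
    and eq: "\<And>s. u < s \<Longrightarrow> s < v \<Longrightarrow> laplace M Y (of_real s) = F (of_real s)"
    and z: "u < Re z" "Re z < 0 \<or> z = 0"
  shows "\<not> is_pole F z"
proof -
  \<comment> \<open>At the exponent 0 the integrand is 1, integrable for a finite measure; the
    exponents between a known negative one and 0 follow.\<close>
  have int0: "integrable M (\<lambda>y. exp (t * Y y))" if "u < t" "t \<le> 0" for t
  proof -
    obtain p where p: "u < p" "p < t" "p < v"
    proof (rule that)
      show "u < (u + min t v) / 2" "(u + min t v) / 2 < t" "(u + min t v) / 2 < v"
        using \<open>u < t\<close> uv by (auto simp: min_def)
    qed
    show ?thesis
      by (rule integrable_exp_between(1)[OF Y, of p 0]) (use int[of p] p that in auto)
  qed
  define S where "S = {s. u < Re s \<and> Re s < 0}"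
  have oS: "open S" "connected S"
  proof -
    have S: "S = {s. u < Re s} \<inter> {s. Re s < 0}" by (auto simp: S_def)
    show "open S" unfolding S by (intro open_Int open_halfspace_Re_gt open_halfspace_Re_lt)
    show "connected S" unfolding S
      by (intro convex_connected convex_Int convex_halfspace_Re_gt convex_halfspace_Re_lt)
  qed
  have holE: "laplace M Y analytic_on S"
    unfolding analytic_on_def
  proof
    fix c assume c: "c \<in> S"
    define r where "r = min (Re c - u) (- Re c) / 2"
    have r: "r > 0" using c by (auto simp: S_def r_def)
    have u1: "u < Re c - r" "Re c + r \<le> 0" using c by (auto simp: S_def r_def min_def field_simps)
    have u2: "u < Re c + r" "Re c - r \<le> 0" using u1 r by linarith+
    have "laplace M Y holomorphic_on ball c r"
      by (rule laplace_holomorphic_on_ball[OF Y r int0[OF u2(1) u1(2)] int0[OF u1(1) u2(2)]])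
    then show "\<exists>e>0. laplace M Y holomorphic_on ball c e" using r by blast
  qed
  define m where "m = (u + v) / 2"
  have m: "complex_of_real m \<in> S" using uv by (simp add: S_def m_def)
  \<comment> \<open>F and the transform are known to agree only on a real segment. There g vanishes
    arbitrarily close to the point m, hence on the whole connected strip once its removable
    singularities are filled in.\<close>
  define g where "g s = F s - laplace M Y s" for s
  have "F meromorphic_on UNIV" using F by (simp add: nicely_meromorphic_on_def)
  then have "F meromorphic_on S" by (rule meromorphic_on_subset) simp
  then have gm: "g meromorphic_on S" unfolding g_def
    by (intro meromorphic_on_diff analytic_on_imp_meromorphic_on[OF holE])
  have gev: "\<forall>\<^sub>F w in at c. remove_sings g w = g w" if "c \<in> S" for c
    by (rule eventually_remove_sings_eq_at[OF meromorphic_on_isolated_singularity[OF meromorphic_on_subset[OF gm]]])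
       (use that in auto)
  have "\<exists>\<^sub>F w in at (of_real m). g w = 0"
  proof -
    have "complex_of_real m islimpt complex_of_real ` {m - (v-u)/2<..<m + (v-u)/2}"
      using uv by (intro islimpt_real_segment) auto
    then have "\<exists>\<^sub>F w in at (of_real m). w \<in> complex_of_real ` {m - (v-u)/2<..<m + (v-u)/2}"
      by (simp add: islimpt_iff_eventually frequently_def)
    then show ?thesis
    proof (rule frequently_elim1)
      fix w assume "w \<in> complex_of_real ` {m - (v-u)/2<..<m + (v-u)/2}"
      then obtain s where "w = of_real s" "u < s" "s < v" by (auto simp: m_def field_simps)
      then show "g w = 0" using eq by (simp add: g_def)
    qed
  qed
  then have "\<exists>\<^sub>F w in at (of_real m). g w = 0 \<and> remove_sings g w = g w"
    by (rule frequently_eventually_frequently[OF _ gev[OF m]])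
  then have "\<exists>\<^sub>F w in at (of_real m). remove_sings g w = 0"
    by (rule frequently_elim1) simp
  then have g0: "remove_sings g w = 0" if "w \<in> S" for w
    by (rule frequently_eq_meromorphic_imp_constant[OF _ remove_sings_nicely_meromorphic[OF gm]])
       (use oS m that in auto)
  have FE: "\<forall>\<^sub>F w in at c. F w = laplace M Y w" if c: "c \<in> S" for c
  proof -
    have "\<forall>\<^sub>F w in at c. w \<in> S" using c oS(1) by (intro eventually_at_in_open') auto
    with gev[OF c] show ?thesis by eventually_elim (use g0 in \<open>simp add: g_def\<close>)
  qed
  have npS: "\<not> is_pole F c" if c: "c \<in> S" for c
  proof
    assume "is_pole F c"
    then have "is_pole (laplace M Y) c" unfolding is_pole_cong[OF FE[OF c] refl] .
    moreover have "laplace M Y analytic_on {c}" by (rule analytic_on_subset[OF holE]) (use c in auto)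
    ultimately show False using analytic_at_imp_no_pole by blast
  qed
  have FES: "F c = laplace M Y c" if c: "c \<in> S" for c
  proof -
    have "F analytic_on {c}" using nicely_meromorphic_on_imp_analytic_at[OF F _ npS[OF c]] by simp
    then have "F \<midarrow>c\<rightarrow> F c" by (intro isContD analytic_at_imp_isCont)
    moreover have "laplace M Y analytic_on {c}" by (rule analytic_on_subset[OF holE]) (use c in auto)
    then have "laplace M Y \<midarrow>c\<rightarrow> laplace M Y c" by (intro isContD analytic_at_imp_isCont)
    moreover have "\<forall>\<^sub>F w in at c. laplace M Y w = F w" using FE[OF c] by (rule eventually_mono) simp
    ultimately have "F \<midarrow>c\<rightarrow> F c" "F \<midarrow>c\<rightarrow> laplace M Y c" by (auto intro: Lim_transform_eventually)
    then show ?thesis by (rule LIM_unique)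
  qed
  show ?thesis
  proof (cases "z = 0")
    case False
    then show ?thesis using z npS by (auto simp: S_def)
  next
    case True
    obtain p where p: "u < p" "p < 0" using dense[of u 0] uv by auto
    define B where "B = (LINT y|M. exp (p * Y y)) + (LINT y|M. exp (0 * Y y))"
    \<comment> \<open>The bound does not depend on t, so F stays bounded as t increases to
      0.\<close>
    have bd: "norm (F (of_real t)) \<le> B" if t: "p \<le> t" "t < 0" for t
    proof -
      have "F (of_real t) = laplace M Y (of_real t)" using t p by (intro FES) (auto simp: S_def)
      also have "\<dots> = of_real (LINT y|M. exp (t * Y y))"
        unfolding laplace_def integral_complex_of_real[symmetric] by (simp add: exp_of_real[symmetric])
      finally have "norm (F (of_real t)) = (LINT y|M. exp (t * Y y))" by simp
      also have "\<dots> \<le> B" unfolding B_def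
        by (rule integrable_exp_between(2)[OF Y]) (use int0 p t in auto)
      finally show ?thesis .
    qed
    show ?thesis
    proof
      assume "is_pole F z"
      then have "\<forall>\<^sub>F w in at 0. norm (F w) \<ge> B + 1"
        unfolding is_pole_def True filterlim_at_infinity_conv_norm_at_top filterlim_at_top by blast
      moreover have "filterlim complex_of_real (at 0) (at_left 0)"
      proof (rule filterlim_atI)
        have "(complex_of_real \<longlongrightarrow> of_real 0) (at_left 0)" by (intro tendsto_intros)
        then show "(complex_of_real \<longlongrightarrow> 0) (at_left 0)" by simp
        show "\<forall>\<^sub>F x in at_left 0. complex_of_real x \<noteq> 0" by (simp add: eventually_at_filter)
      qed
      ultimately have "\<forall>\<^sub>F t in at_left 0. norm (F (of_real t)) \<ge> B + 1"
        by (rule eventually_compose_filterlim)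
      moreover have "\<forall>\<^sub>F t in at_left 0. t \<in> {p<..<0}" using p by (intro eventually_at_left_real)
      ultimately have "\<forall>\<^sub>F t in at_left (0::real). False"
      proof eventually_elim
        case (elim t)
        then show ?case using bd[of t] by auto
      qed
      then show False by simp
    qed
  qed
qed

text \<open>If the known interval reaches positive exponents, the extension takes place to the right
  of 0, where F has no poles by hypothesis. Otherwise it starts from u: a pole to the right of u
  would be negative or 0, and the strip lemma excludes both.\<close>

theorem (in finite_measure) laplace_eq_meromorphic_continuation:
  fixes Y :: "'a \<Rightarrow> real" and u v :: real
  assumes Y: "Y \<in> borel_measurable M" and uv: "u < v"
    and F: "F nicely_meromorphic_on UNIV"
    and poles: "\<And>z. is_pole F z \<Longrightarrow> z \<in> \<real> \<and> Re z \<le> 0"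
    and int: "\<And>s. u < s \<Longrightarrow> s < v \<Longrightarrow> integrable M (\<lambda>y. exp (s * Y y))"
    and eq: "\<And>s. u < s \<Longrightarrow> s < v \<Longrightarrow> laplace M Y (of_real s) = F (of_real s)"
    and s: "Re s > 0"
  shows "integrable M (\<lambda>y. exp (s * of_real (Y y)))" and "laplace M Y s = F s"
proof -
  have hol: "F holomorphic_on {s. Re s > L}" if "\<And>z. Re z > L \<Longrightarrow> \<not> is_pole F z" for L
  proof (rule analytic_imp_holomorphic)
    show "F analytic_on {s. Re s > L}"
      using nicely_meromorphic_on_imp_analytic_at[OF F] that analytic_on_analytic_at by blast
  qed
  have "integrable M (\<lambda>y. exp (s * of_real (Y y))) \<and> laplace M Y s = F s"
  proof (cases "v > 0")
    case True
    define p where "p = (max u 0 + v) / 2"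
    have p: "0 < p" "u < p" "p < v" using True uv by (auto simp: p_def max_def)
    have h: "F holomorphic_on {s. Re s > 0}" using poles by (intro hol) force
    show ?thesis
      using laplace_extend_halfplane[OF Y p(1) p(3) h _ _ s] int eq p by force
  next
    case False
    then have v0: "v \<le> 0" by simp
    have h: "F holomorphic_on {s. Re s > u}"
    proof (rule hol)
      fix z assume z: "u < Re z"
      show "\<not> is_pole F z"
      proof
        assume pz: "is_pole F z"
        then have "z \<in> \<real>" "Re z \<le> 0" using poles by auto
        then have "Re z < 0 \<or> z = 0" by (auto simp: complex_is_Real_iff complex_eq_iff)
        with laplace_meromorphic_no_pole_strip[OF Y uv v0 F int eq z] pz show False by blast
      qed
    qed
    define p where "p = (u + v) / 2"
    have p: "u < p" "p < v" using uv by (auto simp: p_def)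
    have s': "Re s > u" using s v0 uv by linarith
    show ?thesis
      using laplace_extend_halfplane[OF Y p h _ _ s'] int eq p by force
  qed
  then show "integrable M (\<lambda>y. exp (s * of_real (Y y)))" and "laplace M Y s = F s" by auto
qed

section \<open>Asymptotics of Gamma quotients\<close>

lemma Ln_affine:
  assumes "a > 0" "Re s > 0" "norm (of_real b / (of_real a * s)) < 1/2"
  shows "Ln (of_real a * s + of_real b) = of_real (ln a) + Ln s + Ln (1 + of_real b / (of_real a * s))"
proof -
  define q where "q = of_real b / (of_real a * s)"
  have s0: "s \<noteq> 0" "of_real a * s \<noteq> 0" using assms by auto
  have "\<bar>Re q\<bar> < 1/2" using assms(3) abs_Re_le_cmod[of q] by (simp add: q_def)
  then have Rq: "Re (1 + q) > 0" by auto
  then have q0: "1 + q \<noteq> 0" by (metis less_irrefl zero_complex.simps(1))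
  have L: "Ln (of_real a * s) = of_real (ln a) + Ln s"
    by (subst Ln_times_of_real) (use assms s0 in \<open>auto simp: Ln_of_real\<close>)
  have "\<bar>Im (Ln s)\<bar> < pi/2" using Re_Ln_pos_lt[OF s0(1)] assms by blast
  moreover have "\<bar>Im (Ln (1 + q))\<bar> < pi/2" using Re_Ln_pos_lt[OF q0] Rq by blast
  moreover have "Im (Ln (of_real a * s)) = Im (Ln s)" unfolding L by simp
  ultimately have "Ln (of_real a * s * (1 + q)) = Ln (of_real a * s) + Ln (1 + q)"
    using s0 q0 by (intro Ln_times_simple) linarith+
  moreover have "of_real a * s * (1 + q) = of_real a * s + of_real b" using s0 by (simp add: q_def distrib_left)
  ultimately show ?thesis using L by (simp add: q_def)
qed

text \<open>The absolute value in the logarithm makes the expression change sign when (a, b) is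
  replaced by (-a, 1 - b), which is what the reflection of Gamma requires.\<close>

definition gamma_exponent :: "real \<Rightarrow> real \<Rightarrow> complex \<Rightarrow> complex" where
  "gamma_exponent a b s = of_real a * s * Ln s + of_real (b - 1/2) * Ln s + of_real (a * ln \<bar>a\<bar>) * s - of_real a * s"

lemma Gamma_affine_asymptotics:
  assumes a: "a > 0"
  obtains r K s1 where "s1 > 0" "\<And>s. Re s \<ge> s1 \<Longrightarrow> Gamma (of_real a * s + of_real b) =
      of_real (sqrt (2 * pi) * a powr (b - 1/2)) * exp (gamma_exponent a b s + r s)"
    "\<And>s. Re s \<ge> s1 \<Longrightarrow> norm (r s) \<le> K / Re s"
proof -
  define q where "q s = of_real b / (of_real a * s)" for s :: complex
  \<comment> \<open>The first summand is \<open>a s Ln (1 + q s) - b\<close>, because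
    \<open>a s q s = b\<close>; the b comes from the term -z of Stirling's formula.\<close>
  define r where "r s = of_real a * s * (Ln (1 + q s) - q s) + of_real (b - 1/2) * Ln (1 + q s) +
    stirling_rest (of_real a * s + of_real b)" for s
  \<comment> \<open>Beyond this threshold the real part of a s + b is at least 2, as Stirling's
    formula requires, and at least a Re s / 2, and |q s| is below 1/2.\<close>
  define s1 where "s1 = (2 + 2 * \<bar>b\<bar>) / a"
  define K where "K = 2 * b\<^sup>2 / a + 2 * \<bar>b - 1/2\<bar> * \<bar>b\<bar> / a + 16 / a"
  have s1: "s1 > 0" using a by (simp add: s1_def add_pos_nonneg)
  have *: "Gamma (of_real a * s + of_real b) =
      of_real (sqrt (2 * pi) * a powr (b - 1/2)) * exp (gamma_exponent a b s + r s) \<and> norm (r s) \<le> K / Re s"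
    if s: "Re s \<ge> s1" for s
  proof -
    have Rs: "Re s > 0" using s s1 by linarith
    have s0: "s \<noteq> 0" using Rs by auto
    have aR: "a * Re s \<ge> 2 + 2 * \<bar>b\<bar>" using s a by (simp add: s1_def divide_le_eq mult.commute)
    define z where "z = of_real a * s + of_real b"
    have Rz: "Re z = a * Re s + b" by (simp add: z_def)
    have Rz2: "Re z \<ge> 2" "Re z \<ge> a * Re s / 2" using aR unfolding Rz by (auto simp: abs_if split: if_splits)
    have nq: "norm (q s) = \<bar>b\<bar> / (a * norm s)" using a by (simp add: q_def norm_divide norm_mult)
    have ns: "norm s \<ge> Re s" by (rule complex_Re_le_cmod)
    have ans: "a * norm s \<ge> 2 + 2 * \<bar>b\<bar>" using aR mult_left_mono[OF ns, of a] a by linarith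
    have nq2: "norm (q s) < 1/2" unfolding nq using ans by (subst divide_less_eq) auto
    have Lz: "Ln z = of_real (ln a) + Ln s + Ln (1 + q s)"
      unfolding z_def q_def by (rule Ln_affine[OF a Rs]) (use nq2 in \<open>simp add: q_def\<close>)
    have asq: "of_real a * s * q s = of_real b" using a s0 by (simp add: q_def)
    have E: "(z - 1/2) * Ln z - z + stirling_rest z = of_real ((b - 1/2) * ln a) + (gamma_exponent a b s + r s)"
    proof -
      have "(z - 1/2) * Ln z - z + stirling_rest z = (of_real a * s + of_real (b - 1/2)) * (of_real (ln a) + Ln s + Ln (1 + q s))
         - of_real a * s - of_real a * s * q s + stirling_rest z"
        unfolding Lz asq by (simp add: z_def algebra_simps)
      then show ?thesis using a by (simp add: gamma_exponent_def r_def z_def algebra_simps)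
    qed
    have "Gamma z = of_real (sqrt (2 * pi)) * exp ((z - 1/2) * Ln z - z + stirling_rest z)"
      by (rule Gamma_stirling_complex[OF Rz2(1)])
    also have "\<dots> = of_real (sqrt (2 * pi)) * of_real (exp ((b - 1/2) * ln a)) * exp (gamma_exponent a b s + r s)"
      unfolding E by (simp only: exp_add[of "of_real ((b - 1/2) * ln a)"] exp_of_real mult.assoc)
    also have "exp ((b - 1/2) * ln a) = a powr (b - 1/2)" using a by (simp add: powr_def)
    finally have G: "Gamma z = of_real (sqrt (2 * pi) * a powr (b - 1/2)) * exp (gamma_exponent a b s + r s)"
      by (simp only: of_real_mult)
    have n1: "norm (of_real a * s * (Ln (1 + q s) - q s)) \<le> 2 * b\<^sup>2 / a / Re s"
    proof -
      have "norm (Ln (1 + q s) - q s) \<le> norm (q s) ^ 2 / (1 - norm (q s))"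
        using nq2 by (intro Ln_approx_linear) auto
      also have "\<dots> \<le> norm (q s) ^ 2 / (1/2)" using nq2 by (intro divide_left_mono) auto
      finally have "norm (of_real a * s * (Ln (1 + q s) - q s)) \<le> (a * norm s) * (2 * norm (q s) ^ 2)"
        using a by (simp add: norm_mult mult_left_mono)
      also have "\<dots> = 2 * b\<^sup>2 / a / norm s" using a s0 by (simp add: nq power2_eq_square)
      also have "\<dots> \<le> 2 * b\<^sup>2 / a / Re s" using a ns Rs s0 by (intro divide_left_mono mult_pos_pos) auto
      finally show ?thesis .
    qed
    have n2: "norm (of_real (b - 1/2) * Ln (1 + q s)) \<le> 2 * \<bar>b - 1/2\<bar> * \<bar>b\<bar> / a / Re s"
    proof -
      have "norm (of_real (b - 1/2) * Ln (1 + q s)) = \<bar>b - 1/2\<bar> * norm (Ln (1 + q s))"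
        by (simp only: norm_mult norm_of_real)
      also have "\<dots> \<le> \<bar>b - 1/2\<bar> * (2 * norm (q s))"
        by (intro mult_left_mono norm_Ln_le nq2) auto
      also have "\<dots> = 2 * \<bar>b - 1/2\<bar> * \<bar>b\<bar> / a / norm s" by (simp add: nq)
      also have "\<dots> \<le> 2 * \<bar>b - 1/2\<bar> * \<bar>b\<bar> / a / Re s" using a ns Rs s0 by (intro divide_left_mono mult_pos_pos) auto
      finally show ?thesis .
    qed
    have n3: "norm (stirling_rest z) \<le> 16 / a / Re s"
    proof -
      have "norm (stirling_rest z) \<le> 8 / Re z" by (rule norm_stirling_rest_le[OF Rz2(1)])
      also have "\<dots> \<le> 8 / (a * Re s / 2)" using Rz2 a Rs by (intro divide_left_mono mult_pos_pos) auto
      also have "\<dots> = 16 / a / Re s" by simp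
      finally show ?thesis .
    qed
    have "norm (r s) \<le> 2 * b\<^sup>2 / a / Re s + 2 * \<bar>b - 1/2\<bar> * \<bar>b\<bar> / a / Re s + 16 / a / Re s"
      unfolding r_def z_def[symmetric] by (intro norm_triangle_le add_mono n1 n2 n3)
    also have "\<dots> = K / Re s" by (simp add: K_def add_divide_distrib)
    finally show ?thesis using G by (simp add: z_def)
  qed
  show ?thesis by (rule that[of s1 r K]) (use s1 * in auto)
qed

text \<open>By reflection, \<open>gamma_factor a b s\<close> is \<open>Gamma (a s + b)\<close> up to the factor \<open>pi / sin (pi (a s + b))\<close>
  when \<open>a < 0\<close>; it is holomorphic and zero-free in a right half-plane for either sign of \<open>a\<close>.\<close>

definition gamma_factor :: "real \<Rightarrow> real \<Rightarrow> complex \<Rightarrow> complex" where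
  "gamma_factor a b s = (if a > 0 then Gamma (of_real a * s + of_real b) else rGamma (1 - (of_real a * s + of_real b)))"

text \<open>For a < 0 the factor is a reciprocal Gamma, and 1 / sqrt (2 pi) is sqrt (2 pi) / (2 pi).
  These powers of 2 pi later cancel against the modulus of the sine constant and the powers of pi
  from the reflection formula.\<close>

definition gamma_prefactor :: "real \<Rightarrow> real \<Rightarrow> real" where
  "gamma_prefactor a b = sqrt (2 * pi) * \<bar>a\<bar> powr (b - 1/2) * (if a < 0 then 1 / (2 * pi) else 1)"

lemma gamma_prefactor_pos: "a \<noteq> 0 \<Longrightarrow> gamma_prefactor a b > 0"
  by (simp add: gamma_prefactor_def)

lemma gamma_factor_asymptotics:
  assumes "a \<noteq> 0"
  obtains r K s1 where "s1 > 0" "\<And>s. Re s \<ge> s1 \<Longrightarrow> gamma_factor a b s =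
      of_real (gamma_prefactor a b) * exp (gamma_exponent a b s + r s)"
    "\<And>s. Re s \<ge> s1 \<Longrightarrow> norm (r s) \<le> K / Re s"
proof (cases "a > 0")
  case True
  show ?thesis
    by (rule Gamma_affine_asymptotics[OF True, of b], rule that)
       (use True in \<open>auto simp: gamma_factor_def gamma_prefactor_def\<close>)
next
  case False
  then have a: "- a > 0" using assms by simp
  obtain r K s1 where s1: "s1 > 0" and G: "\<And>s. Re s \<ge> s1 \<Longrightarrow> Gamma (of_real (-a) * s + of_real (1 - b)) =
      of_real (sqrt (2 * pi) * (-a) powr ((1 - b) - 1/2)) * exp (gamma_exponent (-a) (1 - b) s + r s)"
    and rb: "\<And>s. Re s \<ge> s1 \<Longrightarrow> norm (r s) \<le> K / Re s"
    by (rule Gamma_affine_asymptotics[OF a, of "1 - b"]) blast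
  show ?thesis
  proof (rule that[of s1 "\<lambda>s. - r s" K])
    fix s assume s: "Re s \<ge> s1"
    have "gamma_factor a b s = inverse (Gamma (of_real (-a) * s + of_real (1 - b)))"
      using False by (simp add: gamma_factor_def rGamma_inverse_Gamma algebra_simps)
    also have "\<dots> = of_real (inverse (sqrt (2 * pi) * (-a) powr ((1 - b) - 1/2))) * exp (- (gamma_exponent (-a) (1 - b) s + r s))"
      unfolding G[OF s] exp_minus of_real_inverse by (rule inverse_mult_distrib)
    also have "- (gamma_exponent (-a) (1 - b) s + r s) = gamma_exponent a b s + - r s"
      by (simp add: gamma_exponent_def algebra_simps)
    also have "inverse (sqrt (2 * pi) * (-a) powr ((1 - b) - 1/2)) = gamma_prefactor a b"
    proof -
      have "inverse ((-a) powr ((1 - b) - 1/2)) = \<bar>a\<bar> powr (b - 1/2)"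
        using a by (simp add: powr_minus[symmetric])
      moreover have "inverse (sqrt (2 * pi)) = sqrt (2 * pi) * (1 / (2 * pi))"
        by (simp add: field_simps flip: real_sqrt_mult)
      ultimately show ?thesis using a by (simp add: gamma_prefactor_def mult_ac)
    qed
    finally show "gamma_factor a b s = of_real (gamma_prefactor a b) * exp (gamma_exponent a b s + - r s)" .
  qed (use s1 rb in auto)
qed

lemma gamma_factor_prod_asymptotics:
  assumes "finite I" "\<And>i. i \<in> I \<Longrightarrow> a i \<noteq> 0"
  obtains r K s1 where "s1 > 0" "\<And>s. Re s \<ge> s1 \<Longrightarrow> (\<Prod>i\<in>I. gamma_factor (a i) (b i) s) =
      of_real (\<Prod>i\<in>I. gamma_prefactor (a i) (b i)) * exp ((\<Sum>i\<in>I. gamma_exponent (a i) (b i) s) + r s)"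
    "\<And>s. Re s \<ge> s1 \<Longrightarrow> norm (r s) \<le> K / Re s"
proof -
  have "\<exists>r K s1. s1 > 0 \<and> (\<forall>s. Re s \<ge> s1 \<longrightarrow> (\<Prod>i\<in>I. gamma_factor (a i) (b i) s) =
      of_real (\<Prod>i\<in>I. gamma_prefactor (a i) (b i)) * exp ((\<Sum>i\<in>I. gamma_exponent (a i) (b i) s) + r s) \<and>
      norm (r s) \<le> K / Re s)"
    using assms
  proof (induction I rule: finite_induct)
    case empty
    show ?case by (rule exI[of _ "\<lambda>_. 0"], rule exI[of _ 0], rule exI[of _ 1]) auto
  next
    case (insert i I)
    from insert.IH[OF insert.prems[OF insertI2]] obtain r K s1 where IH: "s1 > 0" "\<And>s. Re s \<ge> s1 \<Longrightarrow> (\<Prod>i\<in>I. gamma_factor (a i) (b i) s) =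
      of_real (\<Prod>i\<in>I. gamma_prefactor (a i) (b i)) * exp ((\<Sum>i\<in>I. gamma_exponent (a i) (b i) s) + r s)"
      "\<And>s. Re s \<ge> s1 \<Longrightarrow> norm (r s) \<le> K / Re s" by blast
    obtain r' K' s1' where N: "s1' > 0" "\<And>s. Re s \<ge> s1' \<Longrightarrow> gamma_factor (a i) (b i) s =
      of_real (gamma_prefactor (a i) (b i)) * exp (gamma_exponent (a i) (b i) s + r' s)"
      "\<And>s. Re s \<ge> s1' \<Longrightarrow> norm (r' s) \<le> K' / Re s"
      using gamma_factor_asymptotics[of "a i" "b i"] insert.prems[OF insertI1] by metis
    show ?case
    proof (rule exI[of _ "\<lambda>s. r' s + r s"], rule exI[of _ "K' + K"], rule exI[of _ "max s1 s1'"], intro conjI allI impI)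
      fix s assume s: "max s1 s1' \<le> Re s"
      have s2: "Re s \<ge> s1" "Re s \<ge> s1'" using s by auto
      show "(\<Prod>i\<in>insert i I. gamma_factor (a i) (b i) s) =
        of_real (\<Prod>i\<in>insert i I. gamma_prefactor (a i) (b i)) * exp ((\<Sum>i\<in>insert i I. gamma_exponent (a i) (b i) s) + (r' s + r s))"
        unfolding prod.insert[OF insert.hyps] sum.insert[OF insert.hyps] IH(2)[OF s2(1)] N(2)[OF s2(2)] exp_add of_real_mult
        by (simp only: mult_ac)
      show "norm (r' s + r s) \<le> (K' + K) / Re s"
        unfolding add_divide_distrib by (intro norm_triangle_le add_mono IH(3) N(3) s2)
    qed (use IH(1) in auto)
  qed
  then show ?thesis using that by blast
qed

definition gamma_zero_part :: "real \<Rightarrow> real \<Rightarrow> complex \<Rightarrow> complex" where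
  "gamma_zero_part a b s = (if a < 0 then sin (of_real pi * (of_real a * s + of_real b)) / of_real pi else 1)"

lemma gamma_factor_nonzero_aux:
  assumes "a \<noteq> 0" "\<bar>a\<bar> * Re s > \<bar>b\<bar> + 1"
  shows "a > 0 \<Longrightarrow> of_real a * s + of_real b \<notin> \<int>\<^sub>\<le>\<^sub>0"
    and "a < 0 \<Longrightarrow> 1 - (of_real a * s + of_real b) \<notin> \<int>\<^sub>\<le>\<^sub>0"
proof -
  assume "a > 0"
  then have "a * Re s > \<bar>b\<bar> + 1" using assms by simp
  then have "Re (of_real a * s + of_real b) > 0" by simp
  then show "of_real a * s + of_real b \<notin> \<int>\<^sub>\<le>\<^sub>0" by (rule Re_pos_not_nonpos_Int)
next
  assume "a < 0"
  then have "- (a * Re s) > \<bar>b\<bar> + 1" using assms by simp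
  then have "Re (1 - (of_real a * s + of_real b)) > 0" by simp
  then show "1 - (of_real a * s + of_real b) \<notin> \<int>\<^sub>\<le>\<^sub>0" by (rule Re_pos_not_nonpos_Int)
qed

text \<open>For positive a the two factors are reciprocals of each other; for negative a this is
  Euler's reflection formula. The growth condition keeps the Gamma arguments in the right
  half-plane.\<close>

lemma rGamma_gamma_factor:
  assumes "a \<noteq> 0" "\<bar>a\<bar> * Re s > \<bar>b\<bar> + 1"
  shows "rGamma (of_real a * s + of_real b) * gamma_factor a b s = gamma_zero_part a b s"
    and "gamma_factor a b s \<noteq> 0"
proof -
  show "gamma_factor a b s \<noteq> 0"
    using gamma_factor_nonzero_aux[OF assms] assms(1) by (auto simp: gamma_factor_def Gamma_eq_zero_iff rGamma_eq_zero_iff)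
  show "rGamma (of_real a * s + of_real b) * gamma_factor a b s = gamma_zero_part a b s"
  proof (cases "a > 0")
    case True
    then show ?thesis using gamma_factor_nonzero_aux(1)[OF assms True]
      by (simp add: gamma_factor_def gamma_zero_part_def rGamma_inverse_Gamma Gamma_eq_zero_iff)
  next
    case False
    then show ?thesis using assms(1)
      by (simp add: gamma_factor_def gamma_zero_part_def rGamma_reflection_complex)
  qed
qed

lemma holomorphic_gamma_factor:
  assumes "a \<noteq> 0" "\<And>s. s \<in> A \<Longrightarrow> \<bar>a\<bar> * Re s > \<bar>b\<bar> + 1"
  shows "gamma_factor a b holomorphic_on A"
proof (cases "a > 0")
  case True
  have "(\<lambda>s. Gamma (of_real a * s + of_real b)) holomorphic_on A"
    by (intro holomorphic_intros) (use gamma_factor_nonzero_aux(1)[OF assms(1)] assms(2) True in auto)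
  then show ?thesis using True unfolding gamma_factor_def[abs_def] by simp
next
  case False
  have "(\<lambda>s. rGamma (1 - (of_real a * s + of_real b))) holomorphic_on A"
    by (intro holomorphic_intros)
  then show ?thesis using False unfolding gamma_factor_def[abs_def] by simp
qed

lemma prod_gamma_zero_part:
  assumes "finite I"
  shows "(\<Prod>i\<in>I. gamma_zero_part (a i) (b i) s) = sin_prod {i\<in>I. a i < 0} a b s / of_real pi ^ card {i\<in>I. a i < 0}"
proof -
  have "(\<Prod>i\<in>I. gamma_zero_part (a i) (b i) s) = (\<Prod>i\<in>{i\<in>I. a i < 0}. gamma_zero_part (a i) (b i) s)"
    using assms by (intro prod.mono_neutral_right) (auto simp: gamma_zero_part_def)
  also have "\<dots> = (\<Prod>i\<in>{i\<in>I. a i < 0}. sin (of_real pi * (of_real (a i) * s + of_real (b i))) / of_real pi)"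
    by (intro prod.cong) (auto simp: gamma_zero_part_def)
  finally show ?thesis by (simp add: sin_prod_def prod_dividef)
qed

lemma prod_gamma_prefactor:
  assumes "finite I"
  shows "(\<Prod>i\<in>I. gamma_prefactor (a i) (b i)) =
    sqrt (2 * pi) ^ card I * (\<Prod>i\<in>I. \<bar>a i\<bar> powr (b i - 1/2)) / (2 * pi) ^ card {i\<in>I. a i < 0}"
proof -
  have "(\<Prod>i\<in>I. if a i < 0 then 1 / (2 * pi) else 1) = (\<Prod>i\<in>{i\<in>I. a i < 0}. 1 / (2 * pi))"
    by (rule prod.inter_filter[OF assms, symmetric])
  then show ?thesis unfolding gamma_prefactor_def prod.distrib
    by (simp only: prod_constant power_one_over mult_1_right times_divide_eq_right)
qed

lemma sum_gamma_exponent: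
  "(\<Sum>i\<in>I. gamma_exponent (a i) (b i) s) = of_real (\<Sum>i\<in>I. a i) * (s * Ln s - s) +
     of_real ((\<Sum>i\<in>I. b i) - real (card I) / 2) * Ln s + of_real (\<Sum>i\<in>I. a i * ln \<bar>a i\<bar>) * s"
proof -
  have "(\<Sum>i\<in>I. gamma_exponent (a i) (b i) s) = (\<Sum>i\<in>I. of_real (a i) * (s * Ln s - s) +
     of_real (b i) * Ln s - Ln s / 2 + of_real (a i * ln \<bar>a i\<bar>) * s)"
    by (intro sum.cong) (auto simp: gamma_exponent_def algebra_simps)
  also have "\<dots> = (\<Sum>i\<in>I. of_real (a i)) * (s * Ln s - s) + (\<Sum>i\<in>I. of_real (b i)) * Ln s - of_nat (card I) * (Ln s / 2)
     + (\<Sum>i\<in>I. of_real (a i * ln \<bar>a i\<bar>)) * s"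
    by (simp only: sum.distrib sum_subtractf sum_distrib_right sum_constant)
  finally show ?thesis by (simp add: left_diff_distrib)
qed

text \<open>Stirling's formula yields signed sums, \<open>gamma_param\<close> uses absolute values;
  the difference comes from the negative coefficients alone.\<close>

lemma sum_abs_neg:
  assumes "finite I"
  shows "(\<Sum>i\<in>I. a i) = (\<Sum>i\<in>I. \<bar>a i\<bar>) - 2 * (\<Sum>i\<in>{i\<in>I. a i < (0::real)}. \<bar>a i\<bar>)"
proof -
  have "(\<Sum>i\<in>I. \<bar>a i\<bar> - a i) = (\<Sum>i\<in>{i\<in>I. a i < 0}. \<bar>a i\<bar> - a i)"
    using assms by (intro sum.mono_neutral_right) auto
  also have "\<dots> = (\<Sum>i\<in>{i\<in>I. a i < 0}. 2 * \<bar>a i\<bar>)" by (intro sum.cong) auto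
  finally show ?thesis by (simp add: sum_subtractf sum_distrib_left)
qed

lemma sqrt_power_quotient:
  assumes "x > (0::real)"
  shows "sqrt x ^ m / sqrt x ^ n = x powr ((real m - real n) / 2)"
proof -
  have "sqrt x ^ k = x powr (real k / 2)" for k
    using assms by (simp add: powr_half_sqrt[symmetric] powr_power)
  then show ?thesis using assms by (simp add: powr_diff[symmetric] diff_divide_distrib)
qed

text \<open>The zeros of B are isolated, so B can be cancelled near every point, and continuity
  settles the point itself.\<close>

lemma holomorphic_eq_of_mult_eq:
  assumes "open S" "s \<in> S" "f holomorphic_on S" "g holomorphic_on S" "B holomorphic_on UNIV" "B v \<noteq> 0"
    and eq: "\<And>w. w \<in> S \<Longrightarrow> f w * B w = g w * B w"
  shows "f s = (g s :: complex)"
proof -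
  have "\<forall>\<^sub>F w in at s. B w \<noteq> 0"
    using non_zero_neighbour_alt[OF assms(5), of s v] assms(6) by (auto elim: eventually_mono)
  moreover have "\<forall>\<^sub>F w in at s. w \<in> S" using assms(1,2) by (rule eventually_at_in_open')
  ultimately have ev: "\<forall>\<^sub>F w in at s. f w = g w" by eventually_elim (use eq in auto)
  have fc: "f \<midarrow>s\<rightarrow> f s" and gc: "g \<midarrow>s\<rightarrow> g s"
    using assms(1-4) by (meson holomorphic_on_imp_continuous_on continuous_on_eq_continuous_at isCont_def)+
  have "f \<midarrow>s\<rightarrow> g s" by (rule Lim_transform_eventually[OF gc]) (use ev in \<open>auto elim: eventually_mono\<close>)
  then show ?thesis using fc LIM_unique by blast
qed

section \<open>The moment function as a quotient of entire functions\<close>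

locale gamma_type_parameters =
  fixes J K :: nat and C D :: real and a b a' b' :: "nat \<Rightarrow> real"
  assumes D_pos: "D > 0"
    and a_nz: "\<And>j. j \<in> {1..J} \<Longrightarrow> a j \<noteq> 0"
    and a'_nz: "\<And>k. k \<in> {1..K} \<Longrightarrow> a' k \<noteq> 0"
begin

abbreviation F :: "complex \<Rightarrow> complex" where "F \<equiv> gamma_type_fun J K C D a b a' b'"

text \<open>Reciprocal Gamma is entire, so the denominator Gammas of F appear here and the numerator
  Gammas in \<open>den\<close>; poles of F can only sit at zeros of \<open>den\<close>.\<close>

definition num :: "complex \<Rightarrow> complex" where
  "num s = of_real C * exp (s * of_real (ln D)) * (\<Prod>k\<in>{1..K}. rGamma (of_real (a' k) * s + of_real (b' k)))"

definition den :: "complex \<Rightarrow> complex" where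
  "den s = (\<Prod>j\<in>{1..J}. rGamma (of_real (a j) * s + of_real (b j)))"

text \<open>The quotients agree at every point, not only off a discrete set: the value 0 of Gamma at
  a pole is \<open>inverse 0\<close>, in accordance with the convention for division.\<close>

lemma F_eq_remove_sings: "F = remove_sings (\<lambda>s. num s / den s)"
proof -
  have "of_real C * of_real D powr s *
       ((\<Prod>j\<in>{1..J}. Gamma (of_real (a j) * s + of_real (b j))) /
        (\<Prod>k\<in>{1..K}. Gamma (of_real (a' k) * s + of_real (b' k)))) = num s / den s" for s
    using D_pos
    by (simp add: num_def den_def Gamma_def prod_inversef[unfolded o_def] powr_def Ln_of_real divide_inverse mult_ac)
  then show ?thesis unfolding gamma_type_fun_def by simp
qed

lemma num_holomorphic: "num holomorphic_on A"
  unfolding num_def by (intro holomorphic_intros)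

lemma den_holomorphic: "den holomorphic_on A"
  unfolding den_def by (intro holomorphic_intros)

lemma rGamma_affine_nonreal:
  assumes "x \<noteq> 0" "Im s \<noteq> 0"
  shows "rGamma (complex_of_real x * s + complex_of_real y) \<noteq> 0"
proof
  assume "rGamma (complex_of_real x * s + complex_of_real y) = 0"
  then have "complex_of_real x * s + complex_of_real y \<in> \<int>\<^sub>\<le>\<^sub>0" by (simp add: rGamma_eq_zero_iff)
  then obtain n where n: "complex_of_real x * s + complex_of_real y = of_int n" by (auto elim: nonpos_Ints_cases)
  have "Im (complex_of_real x * s + complex_of_real y) = 0" unfolding n by simp
  then show False using assms by simp
qed

lemma den_nonreal: "Im s \<noteq> 0 \<Longrightarrow> den s \<noteq> 0"
  unfolding den_def using rGamma_affine_nonreal a_nz by auto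

lemma num_nonreal: "Im s \<noteq> 0 \<Longrightarrow> C \<noteq> 0 \<Longrightarrow> num s \<noteq> 0"
  unfolding num_def using rGamma_affine_nonreal a'_nz by auto

lemma meromorphic_quotient: "(\<lambda>s. num s / den s) meromorphic_on UNIV"
  by (intro meromorphic_on_divide analytic_on_imp_meromorphic_on)
     (auto simp: analytic_on_open num_holomorphic den_holomorphic)

lemma F_nicely_meromorphic: "F nicely_meromorphic_on UNIV"
  unfolding F_eq_remove_sings by (rule remove_sings_nicely_meromorphic[OF meromorphic_quotient])

lemma quotient_analytic: "den s \<noteq> 0 \<Longrightarrow> (\<lambda>s. num s / den s) analytic_on {s}"
  by (intro analytic_on_divide) (auto intro: analytic_on_subset[of _ UNIV] simp: analytic_on_open num_holomorphic den_holomorphic)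

lemma F_eq: "den s \<noteq> 0 \<Longrightarrow> F s = num s / den s"
  unfolding F_eq_remove_sings by (rule remove_sings_at_analytic[OF quotient_analytic])

lemma pole_F_imp_real:
  assumes "is_pole F z" shows "Im z = 0"
proof (rule ccontr)
  assume "Im z \<noteq> 0"
  then have an: "(\<lambda>s. num s / den s) analytic_on {z}" by (intro quotient_analytic den_nonreal)
  have "isolated_singularity_at (\<lambda>s. num s / den s) z"
    by (rule meromorphic_on_isolated_singularity[OF meromorphic_on_subset[OF meromorphic_quotient]]) auto
  then have "is_pole (\<lambda>s. num s / den s) z" using assms unfolding F_eq_remove_sings by (simp only: is_pole_remove_sings_iff)
  with an show False using analytic_at_imp_no_pole by blast
qed

lemma pole_F_imp_nonpos:
  assumes "rho_plus F = \<infinity>" "is_pole F z"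
  shows "z \<in> \<real>" "Re z \<le> 0"
proof -
  have im: "Im z = 0" by (rule pole_F_imp_real[OF assms(2)])
  then show "z \<in> \<real>" by (simp add: complex_is_Real_iff)
  have z: "z = of_real (Re z)" using im by (simp add: complex_eq_iff)
  show "Re z \<le> 0"
  proof (rule ccontr)
    assume "\<not> Re z \<le> 0"
    then have "ereal (Re z) \<in> ereal ` {x. 0 < x \<and> is_pole F (of_real x)}" using assms(2) z by auto
    then have "rho_plus F \<le> ereal (Re z)" unfolding rho_plus_def by (rule Inf_lower)
    then show False using assms(1) by simp
  qed
qed

lemma F_holomorphic:
  assumes "rho_plus F = \<infinity>" shows "F holomorphic_on {s. Re s > 0}"
proof (rule analytic_imp_holomorphic)
  have "F analytic_on {z}" if "Re z > 0" for z
    using nicely_meromorphic_on_imp_analytic_at[OF F_nicely_meromorphic] pole_F_imp_nonpos(2)[OF assms, of z] that by force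
  then show "F analytic_on {s. Re s > 0}" using analytic_on_analytic_at by blast
qed

text \<open>Multiplied once more by \<open>den\<close>, the identity also holds trivially at the
  zeros of \<open>den\<close>, so the cancellation lemma yields it on the whole half-plane.\<close>

lemma F_den_eq_num:
  assumes "rho_plus F = \<infinity>" "Re s > 0"
  shows "F s * den s = num s"
proof (rule holomorphic_eq_of_mult_eq[where S = "{s. Re s > 0}" and f = "\<lambda>s. F s * den s" and g = num and B = den and v = \<i>])
  show "(\<lambda>s. F s * den s) holomorphic_on {s. Re s > 0}"
    by (intro holomorphic_on_mult F_holomorphic assms den_holomorphic)
  show "den \<i> \<noteq> 0" by (rule den_nonreal) simp
  fix w show "F w * den w * den w = num w * den w"
    using F_eq[of w] by (cases "den w = 0") auto
qed (use assms num_holomorphic den_holomorphic in \<open>auto simp: open_halfspace_Re_gt\<close>)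

lemma F_nonzero:
  assumes "rho_plus F = \<infinity>" "C \<noteq> 0" "\<And>x. x > 0 \<Longrightarrow> F (of_real x) \<noteq> 0" "Re s > 0"
  shows "F s \<noteq> 0"
proof (cases "Im s = 0")
  case True
  then have "s = of_real (Re s)" by (simp add: complex_eq_iff)
  then show ?thesis using assms(3)[of "Re s"] assms(4) by simp
next
  case False
  then show ?thesis using F_den_eq_num[OF assms(1,4)] num_nonreal[OF False assms(2)] by auto
qed

lemma exists_affine_threshold:
  assumes "finite I" "\<And>i. i \<in> I \<Longrightarrow> \<alpha> i \<noteq> (0::real)"
  obtains t where "t \<ge> 0" "\<And>i x. i \<in> I \<Longrightarrow> x > t \<Longrightarrow> \<bar>\<alpha> i\<bar> * x > \<bar>\<beta> i\<bar> + (1::real)"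
proof
  define t where "t = (\<Sum>i\<in>I. (\<bar>\<beta> i\<bar> + 1) / \<bar>\<alpha> i\<bar>)"
  show "t \<ge> 0" unfolding t_def by (intro sum_nonneg) auto
  fix i x assume i: "i \<in> I" and x: "x > t"
  have "(\<bar>\<beta> i\<bar> + 1) / \<bar>\<alpha> i\<bar> \<le> t" unfolding t_def using assms(1) i by (intro member_le_sum) auto
  then have "(\<bar>\<beta> i\<bar> + 1) / \<bar>\<alpha> i\<bar> < x" using x by linarith
  then show "\<bar>\<alpha> i\<bar> * x > \<bar>\<beta> i\<bar> + 1" using assms(2)[OF i] by (simp add: divide_less_eq mult.commute)
qed

abbreviation "negA \<equiv> {j\<in>{1..J}. a j < 0}"
abbreviation "negB \<equiv> {k\<in>{1..K}. a' k < 0}"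

text \<open>The quotient of the two sine products produced by reflection is holomorphic and zero-free in a
  half-plane, hence constant.\<close>

lemma F_gamma_factor_quotient:
  assumes rho: "rho_plus F = \<infinity>" and C: "C \<noteq> 0" and nz: "\<And>x. x > 0 \<Longrightarrow> F (of_real x) \<noteq> 0"
  obtains c t where "t \<ge> 0" "norm c * 2 ^ card negB = 2 ^ card negA" "(\<Sum>k\<in>negB. \<bar>a' k\<bar>) = (\<Sum>j\<in>negA. \<bar>a j\<bar>)"
    "\<And>s. Re s > t \<Longrightarrow> F s = c * of_real (C * pi ^ card negA / pi ^ card negB) * exp (s * of_real (ln D)) *
      (\<Prod>j\<in>{1..J}. gamma_factor (a j) (b j) s) / (\<Prod>k\<in>{1..K}. gamma_factor (a' k) (b' k) s)"
proof -
  obtain t1 where t1: "t1 \<ge> 0" "\<And>i x. i \<in> {1..J} \<Longrightarrow> x > t1 \<Longrightarrow> \<bar>a i\<bar> * x > \<bar>b i\<bar> + 1"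
    by (rule exists_affine_threshold[of "{1..J}" a b]) (use a_nz in auto)
  obtain t2 where t2: "t2 \<ge> 0" "\<And>i x. i \<in> {1..K} \<Longrightarrow> x > t2 \<Longrightarrow> \<bar>a' i\<bar> * x > \<bar>b' i\<bar> + 1"
    by (rule exists_affine_threshold[of "{1..K}" a' b']) (use a'_nz in auto)
  define t where "t = max t1 t2"
  have t0: "t \<ge> 0" using t1 by (simp add: t_def)
  define S where "S = {s. Re s > t}"
  have oS: "open S" by (simp add: S_def open_halfspace_Re_gt)
  define H where "H s = (\<Prod>j\<in>{1..J}. gamma_factor (a j) (b j) s)" for s
  define H' where "H' s = (\<Prod>k\<in>{1..K}. gamma_factor (a' k) (b' k) s)" for s
  have Hnz: "H s \<noteq> 0" if "Re s > t" for s
    unfolding H_def using rGamma_gamma_factor(2)[OF a_nz t1(2)] that by (auto simp: t_def)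
  have H'nz: "H' s \<noteq> 0" if "Re s > t" for s
    unfolding H'_def using rGamma_gamma_factor(2)[OF a'_nz t2(2)] that by (auto simp: t_def)
  have Hhol: "H holomorphic_on S" unfolding H_def[abs_def]
    by (intro holomorphic_on_prod holomorphic_gamma_factor a_nz t1(2)) (auto simp: S_def t_def)
  have H'hol: "H' holomorphic_on S" unfolding H'_def[abs_def]
    by (intro holomorphic_on_prod holomorphic_gamma_factor a'_nz t2(2)) (auto simp: S_def t_def)
  have denH: "den s * H s = sin_prod negA a b s / of_real pi ^ card negA" if s: "Re s > t" for s
  proof -
    have "den s * H s = (\<Prod>j\<in>{1..J}. gamma_zero_part (a j) (b j) s)"
      unfolding den_def H_def prod.distrib[symmetric]
      by (intro prod.cong refl rGamma_gamma_factor(1) a_nz t1(2)) (use s in \<open>auto simp: t_def\<close>)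
    then show ?thesis by (simp only: prod_gamma_zero_part[OF finite_atLeastAtMost])
  qed
  have numH: "num s * H' s = of_real C * exp (s * of_real (ln D)) * (sin_prod negB a' b' s / of_real pi ^ card negB)"
    if s: "Re s > t" for s
  proof -
    have "(\<Prod>k\<in>{1..K}. rGamma (of_real (a' k) * s + of_real (b' k))) * H' s = (\<Prod>k\<in>{1..K}. gamma_zero_part (a' k) (b' k) s)"
      unfolding H'_def prod.distrib[symmetric]
      by (intro prod.cong refl rGamma_gamma_factor(1) a'_nz t2(2)) (use s in \<open>auto simp: t_def\<close>)
    then have "num s * H' s = of_real C * exp (s * of_real (ln D)) * (\<Prod>k\<in>{1..K}. gamma_zero_part (a' k) (b' k) s)"
      unfolding num_def by (simp only: mult.assoc)
    then show ?thesis by (simp only: prod_gamma_zero_part[OF finite_atLeastAtMost])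
  qed
  \<comment> \<open>W is the quotient of the two sine products, rewritten by means of
    \<open>F s * den s = num s\<close>. In this form it is visibly holomorphic and
    zero-free.\<close>
  define W where "W s = F s * H' s * (of_real pi ^ card negB) / (H s * of_real pi ^ card negA * (of_real C * exp (s * of_real (ln D))))" for s
  have Whol: "W holomorphic_on {s. Re s > t}" unfolding W_def[abs_def] S_def[symmetric]
    by (intro holomorphic_intros Hhol H'hol holomorphic_on_subset[OF F_holomorphic[OF rho]])
       (use C Hnz t0 in \<open>auto simp: S_def\<close>)
  have Wnz: "W s \<noteq> 0" if "Re s > t" for s
    unfolding W_def using Hnz[OF that] H'nz[OF that] C F_nonzero[OF rho C nz, of s] that t0 by auto
  have AWB: "sin_prod negB a' b' s = W s * sin_prod negA a b s" if s: "Re s > t" for s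
  proof -
    define E where "E = of_real C * exp (s * of_real (ln D))"
    have E0: "E \<noteq> 0" using C by (simp add: E_def)
    define P P' where "P = complex_of_real pi ^ card negA" and "P' = complex_of_real pi ^ card negB"
    have PP: "P \<noteq> 0" "P' \<noteq> 0" by (auto simp: P_def P'_def)
    have 1: "F s * den s = num s" by (rule F_den_eq_num[OF rho]) (use s t0 in auto)
    have 2: "sin_prod negA a b s = P * (den s * H s)" using denH[OF s] PP by (simp add: P_def)
    have "E * sin_prod negB a' b' s = P' * (num s * H' s)" using numH[OF s] PP by (simp add: P'_def E_def)
    then have 3: "sin_prod negB a' b' s = P' * (F s * den s * H' s) / E" using E0 1 by (simp add: field_simps)
    show ?thesis unfolding 2 3 W_def E_def[symmetric] P_def[symmetric] P'_def[symmetric]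
      using E0 PP Hnz[OF s] by (simp add: field_simps)
  qed
  obtain c where c: "\<And>s. sin_prod negB a' b' s = c * sin_prod negA a b s"
    "(\<Sum>k\<in>negB. \<bar>a' k\<bar>) = (\<Sum>j\<in>negA. \<bar>a j\<bar>)" "norm c * 2 ^ card negB = 2 ^ card negA"
    by (rule sin_prod_quotient_const[OF _ _ _ _ Whol Wnz AWB]) (use a_nz a'_nz in auto)
  have Bi: "\<exists>z0. sin_prod negA a b z0 \<noteq> 0"
  proof -
    have "sin_prod negA a b (of_real (t + 1) + \<i>) \<noteq> 0"
      using denH[of "of_real (t + 1) + \<i>"] den_nonreal[of "of_real (t + 1) + \<i>"] Hnz[of "of_real (t + 1) + \<i>"] by auto
    then show ?thesis by blast
  qed
  then obtain z0 where z0: "sin_prod negA a b z0 \<noteq> 0" by blast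
  have Wc: "W s = c" if s: "Re s > t" for s
    by (rule holomorphic_eq_of_mult_eq[where S = "{s. Re s > t}" and g = "\<lambda>_. c" and B = "sin_prod negA a b", OF _ _ Whol _ holomorphic_sin_prod z0])
       (use s c(1) AWB in \<open>auto simp: open_halfspace_Re_gt\<close>)
  have FF: "F s = c * of_real (C * pi ^ card negA / pi ^ card negB) * exp (s * of_real (ln D)) * H s / H' s" if s: "Re s > t" for s
  proof -
    define E where "E = exp (s * complex_of_real (ln D))"
    have E0: "E \<noteq> 0" by (simp add: E_def)
    define P P' where "P = complex_of_real pi ^ card negA" and "P' = complex_of_real pi ^ card negB"
    have PP: "P \<noteq> 0" "P' \<noteq> 0" by (auto simp: P_def P'_def)
    have "F s * H' s * P' / (H s * P * (of_real C * E)) = c" using Wc[OF s] unfolding W_def P_def P'_def E_def .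
    then have "F s = c * (of_real C * P / P') * E * H s / H' s"
      using E0 PP Hnz[OF s] H'nz[OF s] C by (simp add: field_simps)
    then show ?thesis by (simp add: P_def P'_def E_def)
  qed
  show ?thesis
    by (rule that[OF t0 c(3) c(2)]) (use FF in \<open>auto simp: H_def H'_def\<close>)
qed

section \<open>Asymptotics of the moment function\<close>

definition asymptotic_exponent :: "complex \<Rightarrow> complex" where
  "asymptotic_exponent s = of_real (gamma_param J K a a') * (s * Ln s - s) + of_real (delta_param J K b b') * Ln s
     + of_real (kappa_param J K D a a') * s"

lemma asymptotic_exponent_real:
  assumes "x > 0" shows "asymptotic_exponent (of_real x) \<in> \<real>"
  unfolding asymptotic_exponent_def Ln_of_real[OF assms] by (auto intro!: Reals_add Reals_mult Reals_diff)

text \<open>The sine constant c is known only in modulus, so Stirling's formula gives the constant z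
  up to a phase. On the real axis F is positive, the exponent is real and the error tends to 0;
  hence z is its own modulus, whatever the sign of C.\<close>

theorem F_asymptotics:
  assumes rho: "rho_plus F = \<infinity>" and C: "C \<noteq> 0" and pos: "\<And>x. x > 0 \<Longrightarrow> \<exists>y>0. F (of_real x) = of_real y"
  obtains r B s1 where "s1 > 0" "\<And>s. Re s \<ge> s1 \<Longrightarrow> F s = of_real (C1_param J K C a b a' b') * exp (asymptotic_exponent s + r s)"
    "\<And>s. Re s \<ge> s1 \<Longrightarrow> norm (r s) \<le> B / Re s"
proof -
  have nz: "\<And>x. x > 0 \<Longrightarrow> F (of_real x) \<noteq> 0" using pos by force
  obtain c t where ct: "t \<ge> 0" "norm c * 2 ^ card negB = 2 ^ card negA" "(\<Sum>k\<in>negB. \<bar>a' k\<bar>) = (\<Sum>j\<in>negA. \<bar>a j\<bar>)"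
    "\<And>s. Re s > t \<Longrightarrow> F s = c * of_real (C * pi ^ card negA / pi ^ card negB) * exp (s * of_real (ln D)) *
      (\<Prod>j\<in>{1..J}. gamma_factor (a j) (b j) s) / (\<Prod>k\<in>{1..K}. gamma_factor (a' k) (b' k) s)"
  proof (rule F_gamma_factor_quotient[OF rho C])
    show "F (of_real x) \<noteq> 0" if "x > 0" for x using that by (rule nz)
  qed (rule that)
  obtain r1 K1 t1 where h1: "t1 > 0" "\<And>s. Re s \<ge> t1 \<Longrightarrow> (\<Prod>j\<in>{1..J}. gamma_factor (a j) (b j) s) =
      of_real (\<Prod>j\<in>{1..J}. gamma_prefactor (a j) (b j)) * exp ((\<Sum>j\<in>{1..J}. gamma_exponent (a j) (b j) s) + r1 s)"
    "\<And>s. Re s \<ge> t1 \<Longrightarrow> norm (r1 s) \<le> K1 / Re s"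
  proof (rule gamma_factor_prod_asymptotics[OF finite_atLeastAtMost, of 1 J a b])
    show "a j \<noteq> 0" if "j \<in> {1..J}" for j using that by (rule a_nz)
  qed (rule that)
  obtain r2 K2 t2 where h2: "t2 > 0" "\<And>s. Re s \<ge> t2 \<Longrightarrow> (\<Prod>k\<in>{1..K}. gamma_factor (a' k) (b' k) s) =
      of_real (\<Prod>k\<in>{1..K}. gamma_prefactor (a' k) (b' k)) * exp ((\<Sum>k\<in>{1..K}. gamma_exponent (a' k) (b' k) s) + r2 s)"
    "\<And>s. Re s \<ge> t2 \<Longrightarrow> norm (r2 s) \<le> K2 / Re s"
  proof (rule gamma_factor_prod_asymptotics[OF finite_atLeastAtMost, of 1 K a' b'])
    show "a' k \<noteq> 0" if "k \<in> {1..K}" for k using that by (rule a'_nz)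
  qed (rule that)
  define r where "r s = r1 s - r2 s" for s
  define B where "B = K1 + K2"
  define s1 where "s1 = max (t + 1) (max t1 t2)"
  define p p' where "p = (\<Prod>j\<in>{1..J}. gamma_prefactor (a j) (b j))" and "p' = (\<Prod>k\<in>{1..K}. gamma_prefactor (a' k) (b' k))"
  have pp: "p > 0" "p' > 0" unfolding p_def p'_def using gamma_prefactor_pos a_nz a'_nz by (auto intro!: prod_pos)
  define z where "z = c * of_real (C * pi ^ card negA / pi ^ card negB * p / p')"
  have s1: "s1 > 0" using ct(1) by (simp add: s1_def less_max_iff_disj)
  have rB: "norm (r s) \<le> B / Re s" if "Re s \<ge> s1" for s
  proof -
    have "norm (r s) \<le> norm (r1 s) + norm (r2 s)" unfolding r_def by (rule norm_triangle_ineq4)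
    also have "\<dots> \<le> K1 / Re s + K2 / Re s" using that by (intro add_mono h1(3) h2(3)) (auto simp: s1_def)
    finally show ?thesis by (simp add: B_def add_divide_distrib)
  qed
  \<comment> \<open>By \<open>ct(3)\<close> the contributions of the negative coefficients cancel
    between numerator and denominator.\<close>
  have gam: "(\<Sum>j\<in>{1..J}. a j) - (\<Sum>k\<in>{1..K}. a' k) = gamma_param J K a a'"
    unfolding gamma_param_def sum_abs_neg[OF finite_atLeastAtMost, of a] sum_abs_neg[OF finite_atLeastAtMost, of a'] ct(3)
    by simp
  have expo: "s * of_real (ln D) + (\<Sum>j\<in>{1..J}. gamma_exponent (a j) (b j) s) - (\<Sum>k\<in>{1..K}. gamma_exponent (a' k) (b' k) s)
     = asymptotic_exponent s" for s
    unfolding sum_gamma_exponent asymptotic_exponent_def gam[symmetric] delta_param_def kappa_param_def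
    by (simp add: algebra_simps diff_divide_distrib)
  have Fz: "F s = z * exp (asymptotic_exponent s + r s)" if s: "Re s \<ge> s1" for s
  proof -
    have s': "Re s > t" "Re s \<ge> t1" "Re s \<ge> t2" using s by (auto simp: s1_def)
    define E1 E2 where "E1 = (\<Sum>j\<in>{1..J}. gamma_exponent (a j) (b j) s) + r1 s"
      and "E2 = (\<Sum>k\<in>{1..K}. gamma_exponent (a' k) (b' k) s) + r2 s"
    have "F s = c * of_real (C * pi ^ card negA / pi ^ card negB) * exp (s * of_real (ln D)) * (of_real p * exp E1) / (of_real p' * exp E2)"
      unfolding ct(4)[OF s'(1)] h1(2)[OF s'(2)] h2(2)[OF s'(3)] p_def p'_def E1_def E2_def ..
    also have "\<dots> = z * (exp (s * of_real (ln D)) * exp E1 / exp E2)"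
      by (simp add: z_def mult_ac)
    also have "exp (s * of_real (ln D)) * exp E1 / exp E2 = exp (s * of_real (ln D) + E1 - E2)"
      by (simp only: exp_add exp_diff)
    also have "s * of_real (ln D) + E1 - E2 = asymptotic_exponent s + r s"
      unfolding expo[symmetric] E1_def E2_def r_def by simp
    finally show ?thesis .
  qed
  have normz: "norm z = C1_param J K C a b a' b'"
  proof -
    define m n where "m = card negA" and "n = card negB"
    define x y where "x = (\<Prod>j\<in>{1..J}. \<bar>a j\<bar> powr (b j - 1/2))" and "y = (\<Prod>k\<in>{1..K}. \<bar>a' k\<bar> powr (b' k - 1/2))"
    have "norm z = norm c * (\<bar>C\<bar> * pi ^ m / pi ^ n * p / p')"
    proof -
      have "norm z = norm c * \<bar>C * pi ^ m / pi ^ n * p / p'\<bar>"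
        unfolding z_def norm_mult norm_of_real m_def n_def ..
      also have "\<bar>C * pi ^ m / pi ^ n * p / p'\<bar> = \<bar>C\<bar> * pi ^ m / pi ^ n * p / p'"
        using pp by (simp add: abs_mult)
      finally show ?thesis .
    qed
    also have "norm c = 2 ^ m / 2 ^ n" using ct(2) by (simp add: m_def n_def eq_divide_eq)
    also have "p = sqrt (2 * pi) ^ J * x / (2 * pi) ^ m"
      unfolding p_def prod_gamma_prefactor[OF finite_atLeastAtMost] by (simp add: x_def m_def)
    also have "p' = sqrt (2 * pi) ^ K * y / (2 * pi) ^ n"
      unfolding p'_def prod_gamma_prefactor[OF finite_atLeastAtMost] by (simp add: y_def n_def)
    also have "2 ^ m / 2 ^ n * (\<bar>C\<bar> * pi ^ m / pi ^ n * (sqrt (2 * pi) ^ J * x / (2 * pi) ^ m) / (sqrt (2 * pi) ^ K * y / (2 * pi) ^ n))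
       = \<bar>C\<bar> * (sqrt (2 * pi) ^ J / sqrt (2 * pi) ^ K) * (x / y)"
      unfolding power_mult_distrib[of 2 pi] by simp
    also have "\<dots> = C1_param J K C a b a' b'"
      using sqrt_power_quotient[of "2 * pi" J K] unfolding C1_param_def x_def y_def by simp
    finally show ?thesis .
  qed
  have "z = of_real (norm z)"
  proof -
    define f where "f n = z * exp (r (of_real (s1 + real n)))" for n :: nat
    have rl: "(\<lambda>n. r (of_real (s1 + real n))) \<longlonglongrightarrow> 0"
    proof (rule Lim_null_comparison)
      show "(\<lambda>n. B / (s1 + real n)) \<longlonglongrightarrow> 0" by real_asymp
      have "norm (r (of_real (s1 + real n))) \<le> B / (s1 + real n)" for n
        using rB[of "of_real (s1 + real n)"] by simp
      then show "\<forall>\<^sub>F n in sequentially. norm (r (of_real (s1 + real n))) \<le> B / (s1 + real n)"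
        by (intro always_eventually allI)
    qed
    have "f \<longlonglongrightarrow> z * exp 0" unfolding f_def by (intro tendsto_intros rl)
    then have fl: "f \<longlonglongrightarrow> z" by simp
    have fr: "Im (f n) = 0 \<and> Re (f n) \<ge> 0" for n
    proof -
      define x where "x = s1 + real n"
      have x: "x > 0" "x \<ge> s1" using s1 by (auto simp: x_def)
      obtain y where y: "y > 0" "F (of_real x) = of_real y" using pos[OF x(1)] by blast
      obtain e where e: "asymptotic_exponent (of_real x) = of_real e" using asymptotic_exponent_real[OF x(1)] by (auto elim: Reals_cases)
      have "of_real y = z * (exp (of_real e) * exp (r (of_real x)))"
        using Fz[of "of_real x"] x unfolding y(2) e by (simp add: exp_add)
      then have "of_real y = exp (of_real e) * f n" by (simp add: f_def x_def mult_ac)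
      then have "f n = of_real (y / exp e)" by (simp add: exp_of_real field_simps)
      then show ?thesis using y(1) by simp
    qed
    have "Im z = 0" using tendsto_Im[OF fl] fr by (simp add: LIMSEQ_const_iff)
    moreover have "Re z \<ge> 0" by (rule LIMSEQ_le_const[OF tendsto_Re[OF fl]]) (use fr in auto)
    ultimately show ?thesis by (simp add: complex_eq_iff cmod_eq_Re)
  qed
  then have "z = of_real (C1_param J K C a b a' b')" by (simp only: normz)
  then show ?thesis using Fz rB s1 by (intro that[of s1 r B]) auto
qed

end

section \<open>Fourier inversion of continuous densities\<close>

lemma lower_integral_split:
  fixes g :: "real \<Rightarrow> real"
  assumes gi: "integrable lborel g" and le: "p \<le> t"
  shows "(LINT y|lborel. indicator {..t} y * g y) = (LINT y|lborel. indicator {..p} y * g y) + (LINT y|lborel. indicator {p<..t} y * g y)"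
proof -
  have i: "integrable lborel (\<lambda>y. indicator A y * g y)" if "A \<in> sets borel" for A
    using integrable_mult_indicator[OF _ gi, of A] that by simp
  have "(LINT y|lborel. indicator {..p} y * g y) + (LINT y|lborel. indicator {p<..t} y * g y) =
     (LINT y|lborel. indicator {..p} y * g y + indicator {p<..t} y * g y)"
    by (intro Bochner_Integration.integral_add[symmetric] i) auto
  also have "\<dots> = (LINT y|lborel. indicator {..t} y * g y)"
    using le by (intro Bochner_Integration.integral_cong) (auto simp: indicator_def)
  finally show ?thesis by simp
qed

text \<open>Continuity is asked on an open interval only, so that the statement serves a density on
  the whole axis as well as one continuous on the positive half.\<close>

lemma density_cdf_derivative:
  fixes g :: "real \<Rightarrow> real"
  assumes gi: "integrable lborel g" and cont: "continuous_on {l<..<u} g" and x: "l < x" "x < u"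
  shows "((\<lambda>t. LINT y|lborel. indicator {..t} y * g y) has_real_derivative g x) (at x)"
proof -
  obtain p where p: "l < p" "p < x" using dense x(1) by blast
  obtain q where q: "x < q" "q < u" using dense x(2) by blast
  have c: "continuous_on {p..q} g" by (rule continuous_on_subset[OF cont]) (use p q in auto)
  let ?c = "\<lambda>t. LINT y|lborel. indicator {..t} y * g y"
  have eq: "?c p + integral {p..t} g = ?c t" if t: "t \<in> {p<..<q}" for t
  proof -
    have "set_integrable lborel {p..t} g"
      unfolding set_integrable_def by (rule integrable_mult_indicator[OF _ gi]) simp
    then have "integral {p..t} g = (LINT y|lborel. indicator {p..t} y * g y)"
      using set_borel_integral_eq_integral(2)[of "{p..t}" g] by (simp add: set_lebesgue_integral_def)
    also have "\<dots> = (LINT y|lborel. indicator {p<..t} y * g y)"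
    proof (rule integral_cong_AE)
      show "AE y in lborel. indicator {p..t} y * g y = indicator {p<..t} y * g y"
        using AE_lborel_singleton[of p] by eventually_elim (auto simp: indicator_def)
    qed (use borel_measurable_integrable[OF gi] in auto)
    finally show ?thesis using lower_integral_split[OF gi, of p t] t by simp
  qed
  have "((\<lambda>t. integral {p..t} g) has_real_derivative g x) (at x within {p..q})"
    by (rule integral_has_real_derivative[OF c]) (use p q in auto)
  then have "((\<lambda>t. integral {p..t} g) has_real_derivative g x) (at x)"
    using at_within_Icc_at[of p x q] p q by simp
  then have "((\<lambda>t. ?c p + integral {p..t} g) has_real_derivative g x) (at x)"
    by (auto intro!: derivative_eq_intros)
  then show ?thesis
    by (rule has_field_derivative_transform_within_open[where S = "{p<..<q}"]) (use p q eq in auto)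
qed

lemma fourier_kernel_bound:
  assumes "a \<le> b"
  shows "norm ((iexp (-(t * a)) - iexp (-(t * b))) / (\<i> * complex_of_real t)) \<le> b - a"
proof (cases "t = 0")
  \<comment> \<open>At t = 0 the quotient is 0 by convention.\<close>
  case True
  then show ?thesis using assms by simp
next
  case False
  then show ?thesis using Levy_Inversion_aux2[of "-b" "-a" t] assms by simp
qed

lemma fourier_kernel_lim:
  assumes "t \<noteq> 0" "h \<longlonglongrightarrow> 0" "\<And>n. h n \<noteq> 0"
  shows "(\<lambda>n. (iexp (-(t * x)) - iexp (-(t * (x + h n)))) / (\<i> * complex_of_real t) / complex_of_real (h n)) \<longlonglongrightarrow> iexp (-(t * x))"
proof -
  define w where "w n = - (\<i> * complex_of_real t * complex_of_real (h n))" for n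
  have w0: "w n \<noteq> 0" for n using assms by (simp add: w_def)
  have "w \<longlonglongrightarrow> - (\<i> * complex_of_real t * of_real 0)"
    unfolding w_def by (intro tendsto_intros assms)
  then have "filterlim w (at 0) sequentially" using w0 by (intro filterlim_atI) auto
  from filterlim_compose[OF lim_exp_minus_1 this] have "(\<lambda>n. (exp (w n) - 1) / w n) \<longlonglongrightarrow> 1" .
  then have "(\<lambda>n. iexp (-(t * x)) * ((exp (w n) - 1) / w n)) \<longlonglongrightarrow> iexp (-(t * x)) * 1"
    by (intro tendsto_intros)
  moreover have "iexp (-(t * x)) * ((exp (w n) - 1) / w n) =
     (iexp (-(t * x)) - iexp (-(t * (x + h n)))) / (\<i> * complex_of_real t) / complex_of_real (h n)" for n
  proof -
    have e: "iexp (-(t * (x + h n))) = iexp (-(t * x)) * exp (w n)"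
      unfolding w_def exp_add[symmetric] by (simp add: algebra_simps)
    define E where "E = iexp (-(t * x))"
    have "w n = - (\<i> * complex_of_real t * complex_of_real (h n))" by (simp add: w_def)
    then have "E * ((exp (w n) - 1) / w n) = (E - E * exp (w n)) / (\<i> * complex_of_real t * complex_of_real (h n))"
      by (simp add: algebra_simps diff_divide_distrib)
    then show ?thesis unfolding e E_def by (simp only: divide_divide_eq_left)
  qed
  ultimately show ?thesis by simp
qed

text \<open>Levy's inversion theorem recovers the mass of an interval from x to x + h. After
  division by h the mass tends to g x at every x by continuity, and the kernel is bounded by 1, so
  that integrability of \<phi> provides the dominating function.\<close>

theorem fourier_inversion:
  fixes g :: "real \<Rightarrow> real" and \<phi> :: "real \<Rightarrow> complex"
  assumes g0: "\<And>y. g y \<ge> 0" and gi: "integrable lborel g" and gc: "continuous_on UNIV g"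
    and pos: "integral\<^sup>L lborel g > 0"
    and \<phi>: "\<And>t. \<phi> t = (CLINT y|lborel. complex_of_real (g y) * iexp (t * y))"
    and \<phi>i: "integrable lborel \<phi>"
  shows "complex_of_real (g x) = 1 / (2 * pi) * (CLINT t|lborel. iexp (-(t * x)) * \<phi> t)"
proof -
  define m where "m = integral\<^sup>L lborel g"
  have m: "m > 0" using pos by (simp add: m_def)
  have gm[measurable]: "g \<in> borel_measurable borel" using borel_measurable_integrable[OF gi] by simp
  \<comment> \<open>Levy's theorem concerns probability measures, hence the normalisation by the
    total mass m.\<close>
  define N where "N = density lborel (\<lambda>y. ennreal (g y / m))"
  have nn: "(\<integral>\<^sup>+ y. ennreal (g y / m) \<partial>lborel) = 1"
  proof -
    have "(\<integral>\<^sup>+ y. ennreal (g y / m) \<partial>lborel) = ennreal (LINT y|lborel. g y / m)"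
      using g0 m gi by (intro nn_integral_eq_integral) auto
    then show ?thesis using m by (simp add: m_def)
  qed
  interpret N: real_distribution N
  proof (intro real_distribution.intro real_distribution_axioms.intro prob_spaceI)
    show "emeasure N (space N) = 1" unfolding N_def using nn by (simp add: emeasure_density)
    show "sets N = sets borel" by (simp add: N_def)
  qed
  have Nint: "integral\<^sup>L N f = (CLINT y|lborel. complex_of_real (g y) * f y) / of_real m" if [measurable]: "f \<in> borel_measurable borel" for f
  proof -
    have "integral\<^sup>L N f = (CLINT y|lborel. (g y / m) *\<^sub>R f y)"
      unfolding N_def using g0 m by (intro integral_density) auto
    also have "\<dots> = (CLINT y|lborel. complex_of_real (g y) * f y / of_real m)"
      by (simp add: scaleR_conv_of_real)
    finally show ?thesis by simp
  qed
  have char: "char N t = \<phi> t / of_real m" for t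
    unfolding char_def \<phi> by (rule Nint) measurable
  have Nmeas: "measure N A = (LINT y|lborel. indicator A y * g y) / m" if [measurable]: "A \<in> sets borel" for A
  proof -
    have "measure N A = (LINT y|N. indicator A y)" using that by simp
    then have "complex_of_real (measure N A) = (CLINT y|N. complex_of_real (indicator A y))"
      by (simp only: integral_complex_of_real)
    also have "\<dots> = (CLINT y|lborel. complex_of_real (indicator A y * g y)) / of_real m"
      by (subst Nint) (auto intro!: arg_cong2[where f = "(/)"] Bochner_Integration.integral_cong simp: indicator_def)
    also have "\<dots> = complex_of_real ((LINT y|lborel. indicator A y * g y) / m)"
      by (simp only: integral_complex_of_real of_real_divide)
    finally show ?thesis by (simp only: of_real_eq_iff)
  qed
  have sing: "measure N {a} = 0" for a
  proof -
    have "(LINT y|lborel. indicator {a} y * g y) = 0"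
    proof (rule integral_eq_zero_AE)
      show "AE y in lborel. indicator {a} y * g y = 0"
        using AE_lborel_singleton[of a] by eventually_elim (auto simp: indicator_def)
    qed
    then show ?thesis by (simp add: Nmeas)
  qed
  have \<phi>m[measurable]: "\<phi> \<in> borel_measurable borel" using borel_measurable_integrable[OF \<phi>i] by simp
  define k where "k a b t = (iexp (-(t * a)) - iexp (-(t * b))) / (\<i> * complex_of_real t)" for a b t :: real
  have km[measurable]: "k a b \<in> borel_measurable borel" for a b unfolding k_def by measurable
  have kb: "norm (k a b t) \<le> b - a" if "a \<le> b" for a b t
    unfolding k_def by (rule fourier_kernel_bound[OF that])
  have inv: "complex_of_real (LINT y|lborel. indicator {a<..b} y * g y) = 1 / (2 * pi) * (CLINT t|lborel. k a b t * \<phi> t)"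
    if ab: "a \<le> b" for a b
  proof -
    have L: "(\<lambda>T. 1 / (2 * pi) * (CLBINT t=-real T..real T. k a b t * char N t)) \<longlonglongrightarrow> of_real (measure N {a<..b})"
      unfolding k_def using N.Levy_Inversion[OF ab sing sing] by (simp only: of_int_minus of_int_of_nat_eq)
    \<comment> \<open>The truncated integrals converge to the integral over the whole axis: the
      kernel is bounded by b - a, and \<phi> is integrable.\<close>
    have "(\<lambda>T. CLBINT t=-real T..real T. k a b t * char N t) \<longlonglongrightarrow> (CLINT t|lborel. k a b t * char N t)"
    proof -
      have "(\<lambda>T. CLINT t|lborel. indicator {-real T<..<real T} t *\<^sub>R (k a b t * char N t)) \<longlonglongrightarrow> (CLINT t|lborel. k a b t * char N t)"
      proof (rule integral_dominated_convergence[where w = "\<lambda>t. (b - a) * (norm (\<phi> t) / m)"])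
        show "integrable lborel (\<lambda>t. (b - a) * (norm (\<phi> t) / m))" using \<phi>i by simp
        show "AE t in lborel. (\<lambda>T. indicator {-real T<..<real T} t *\<^sub>R (k a b t * char N t)) \<longlonglongrightarrow> k a b t * char N t"
        proof (rule AE_I2)
          fix t :: real
          have "\<forall>\<^sub>F T in sequentially. real T > \<bar>t\<bar>"
            by (intro eventually_compose_filterlim[OF eventually_gt_at_top filterlim_real_sequentially])
          then have "\<forall>\<^sub>F T in sequentially. indicator {-real T<..<real T} t *\<^sub>R (k a b t * char N t) = k a b t * char N t"
            by eventually_elim (auto simp: indicator_def abs_less_iff)
          then show "(\<lambda>T. indicator {-real T<..<real T} t *\<^sub>R (k a b t * char N t)) \<longlonglongrightarrow> k a b t * char N t"
            by (rule tendsto_eventually)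
        qed
        show "AE t in lborel. norm (indicator {-real T<..<real T} t *\<^sub>R (k a b t * char N t)) \<le> (b - a) * (norm (\<phi> t) / m)" for T
        proof (rule AE_I2)
          fix t
          have "norm (k a b t * char N t) \<le> (b - a) * (norm (\<phi> t) / m)"
            unfolding norm_mult char norm_divide using kb[OF ab, of t] m ab by (intro mult_mono) auto
          moreover have "norm (indicator {-real T<..<real T} t *\<^sub>R (k a b t * char N t)) \<le> norm (k a b t * char N t)"
            by (auto simp: indicator_def)
          ultimately show "norm (indicator {-real T<..<real T} t *\<^sub>R (k a b t * char N t)) \<le> (b - a) * (norm (\<phi> t) / m)"
            by linarith
        qed
      qed (simp_all add: char)
      moreover have "(CLBINT t=-real T..real T. k a b t * char N t) =
         (CLINT t|lborel. indicator {-real T<..<real T} t *\<^sub>R (k a b t * char N t))" for T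
        by (simp add: interval_lebesgue_integral_def set_lebesgue_integral_def)
      ultimately show ?thesis by simp
    qed
    then have "(\<lambda>T. 1 / (2 * pi) * (CLBINT t=-real T..real T. k a b t * char N t)) \<longlonglongrightarrow> 1 / (2 * pi) * (CLINT t|lborel. k a b t * char N t)"
      by (intro tendsto_intros)
    from LIMSEQ_unique[OF L this]
    have "of_real ((LINT y|lborel. indicator {a<..b} y * g y) / m) = 1 / (2 * pi) * (CLINT t|lborel. k a b t * \<phi> t / of_real m)"
      by (simp add: Nmeas char)
    then show ?thesis using m by (simp add: field_simps)
  qed
  define h where "h n = 1 / real (Suc n)" for n
  have h: "h \<longlonglongrightarrow> 0" "\<And>n. h n > 0"
    unfolding h_def using LIMSEQ_inverse_real_of_nat by (auto simp: inverse_eq_divide)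
  have h0: "\<And>n. h n \<noteq> 0" using h(2) by (metis less_irrefl)
  let ?c = "\<lambda>t. LINT y|lborel. indicator {..t} y * g y"
  have "(?c has_real_derivative g x) (at x)"
    by (rule density_cdf_derivative[OF gi continuous_on_subset[OF gc], of "x - 1" "x + 1"]) auto
  then have "((\<lambda>d. (?c (x + d) - ?c x) / d) \<longlongrightarrow> g x) (at 0)" by (simp add: DERIV_def)
  moreover have "filterlim h (at 0) sequentially" using h h0 by (intro filterlim_atI) auto
  ultimately have "(\<lambda>n. (?c (x + h n) - ?c x) / h n) \<longlonglongrightarrow> g x" by (rule filterlim_compose)
  then have "(\<lambda>n. complex_of_real ((?c (x + h n) - ?c x) / h n)) \<longlonglongrightarrow> of_real (g x)" by (rule tendsto_of_real)
  moreover have "complex_of_real ((?c (x + h n) - ?c x) / h n) = 1 / (2 * pi) * (CLINT t|lborel. k x (x + h n) t / of_real (h n) * \<phi> t)" for n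
  proof -
    have "?c (x + h n) - ?c x = (LINT y|lborel. indicator {x<..x + h n} y * g y)"
      using lower_integral_split[OF gi, of x "x + h n"] h(2)[of n] by simp
    then have "complex_of_real ((?c (x + h n) - ?c x) / h n) = 1 / (2 * pi) * ((CLINT t|lborel. k x (x + h n) t * \<phi> t) / of_real (h n))"
      using inv[of x "x + h n"] h(2)[of n] by simp
    also have "(CLINT t|lborel. k x (x + h n) t * \<phi> t) / of_real (h n) = (CLINT t|lborel. k x (x + h n) t / of_real (h n) * \<phi> t)"
      by (simp flip: integral_divide_zero)
    finally show ?thesis .
  qed
  moreover have "(\<lambda>n. 1 / (2 * pi) * (CLINT t|lborel. k x (x + h n) t / of_real (h n) * \<phi> t)) \<longlonglongrightarrow>
      1 / (2 * pi) * (CLINT t|lborel. iexp (-(t * x)) * \<phi> t)"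
  proof (intro tendsto_mult tendsto_const, rule integral_dominated_convergence[where w = "\<lambda>t. norm (\<phi> t)"])
    show "AE t in lborel. (\<lambda>n. k x (x + h n) t / of_real (h n) * \<phi> t) \<longlonglongrightarrow> iexp (-(t * x)) * \<phi> t"
      using AE_lborel_singleton[of 0]
    proof eventually_elim
      case (elim t)
      then show ?case unfolding k_def by (intro tendsto_mult tendsto_const fourier_kernel_lim h h0)
    qed
    show "AE t in lborel. norm (k x (x + h n) t / of_real (h n) * \<phi> t) \<le> norm (\<phi> t)" for n
    proof (rule AE_I2)
      fix t
      have "norm (k x (x + h n) t) \<le> h n" using kb[of x "x + h n" t] h(2)[of n] by simp
      then have "norm (k x (x + h n) t / of_real (h n)) \<le> 1" using h(2)[of n] by (simp add: norm_divide)
      then show "norm (k x (x + h n) t / of_real (h n) * \<phi> t) \<le> norm (\<phi> t)"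
        unfolding norm_mult by (rule mult_left_le_one_le[OF norm_ge_zero norm_ge_zero])
    qed
  qed (use \<phi>i in auto)
  ultimately show ?thesis using LIMSEQ_unique by simp
qed

section \<open>The saddle point\<close>

text \<open>With w = 1 + i \<tau> this is w Ln w - w + 1, that is, the function z log z - z on the
  vertical line through 1, normalised to vanish at \<tau> = 0.\<close>

definition saddle_phase :: "real \<Rightarrow> complex" where
  "saddle_phase \<tau> = (1 + \<i> * of_real \<tau>) * Ln (1 + \<i> * of_real \<tau>) - \<i> * of_real \<tau>"

lemma norm_one_plus_ii: "norm (1 + \<i> * complex_of_real \<tau>) = sqrt (1 + \<tau>\<^sup>2)"
  by (simp add: cmod_def)

lemma one_plus_ii_nonzero: "1 + \<i> * complex_of_real \<tau> \<noteq> 0"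
  by (simp add: complex_eq_iff)

lemma Re_Ln_one_plus_ii: "Re (Ln (1 + \<i> * complex_of_real \<tau>)) = ln (1 + \<tau>\<^sup>2) / 2"
  using Re_Ln[OF one_plus_ii_nonzero, of \<tau>] unfolding norm_one_plus_ii
  by (simp add: ln_sqrt add_pos_nonneg)

lemma Im_Ln_one_plus_ii: "Im (Ln (1 + \<i> * complex_of_real \<tau>)) = arctan \<tau>"
  using arg_conv_arctan[of "1 + \<i> * complex_of_real \<tau>"] Arg_eq_Im_Ln[OF one_plus_ii_nonzero, of \<tau>] by simp

lemma Re_saddle_phase: "Re (saddle_phase \<tau>) = - (\<tau> * arctan \<tau> - ln (1 + \<tau>\<^sup>2) / 2)"
  unfolding saddle_phase_def
  by (simp add: Re_Ln_one_plus_ii Im_Ln_one_plus_ii)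

text \<open>With \<open>\<theta> = arctan x\<close>, the derivative of the difference of the two sides is \<open>\<theta> - sin \<theta> \<ge> 0\<close>.\<close>

lemma saddle_phase_lower_bound_nonneg:
  assumes "(x::real) \<ge> 0"
  shows "sqrt (1 + x\<^sup>2) - 1 \<le> x * arctan x - ln (1 + x\<^sup>2) / 2"
proof -
  let ?k = "\<lambda>x. x * arctan x - ln (1 + x\<^sup>2) / 2 - sqrt (1 + x\<^sup>2)"
  have "?k 0 \<le> ?k x"
  proof (rule DERIV_nonneg_imp_nondecreasing[OF assms])
    fix t :: real assume t: "0 \<le> t" "t \<le> x"
    have p: "1 + t\<^sup>2 > 0" by (simp add: add_pos_nonneg)
    have q: "((\<lambda>x. 1 + x\<^sup>2) has_real_derivative 2 * t) (at t)"
      by (auto intro!: derivative_eq_intros)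
    have d1: "((\<lambda>x. x * arctan x) has_real_derivative 1 * arctan t + inverse (1 + t\<^sup>2) * t) (at t)"
      by (intro DERIV_mult DERIV_ident DERIV_arctan)
    have d2: "((\<lambda>x. ln (1 + x\<^sup>2)) has_real_derivative 1 / (1 + t\<^sup>2) * (2 * t)) (at t)"
      by (rule DERIV_chain2[OF DERIV_ln_divide[OF p] q])
    have d3: "((\<lambda>x. sqrt (1 + x\<^sup>2)) has_real_derivative inverse (sqrt (1 + t\<^sup>2)) / 2 * (2 * t)) (at t)"
      by (rule DERIV_chain2[OF DERIV_real_sqrt[OF p] q])
    have "(?k has_real_derivative ((1 * arctan t + inverse (1 + t\<^sup>2) * t) - (1 / (1 + t\<^sup>2) * (2 * t)) / 2 - inverse (sqrt (1 + t\<^sup>2)) / 2 * (2 * t))) (at t)"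
      by (intro DERIV_diff DERIV_cdivide d1 d2 d3)
    moreover have "(1 * arctan t + inverse (1 + t\<^sup>2) * t) - (1 / (1 + t\<^sup>2) * (2 * t)) / 2 - inverse (sqrt (1 + t\<^sup>2)) / 2 * (2 * t)
       = arctan t - sin (arctan t)"
      unfolding sin_arctan divide_inverse by (simp only: mult_ac) simp
    moreover have "arctan t - sin (arctan t) \<ge> 0" using t(1) sin_x_le_x[of "arctan t"] by simp
    ultimately have "(?k has_real_derivative (arctan t - sin (arctan t))) (at t)" "arctan t - sin (arctan t) \<ge> 0"
      by (simp_all only:)
    then show "\<exists>y. (?k has_real_derivative y) (at t) \<and> 0 \<le> y" by blast
  qed
  then show ?thesis by simp
qed

lemma saddle_phase_lower_bound: "sqrt (1 + x\<^sup>2) - 1 \<le> (x::real) * arctan x - ln (1 + x\<^sup>2) / 2"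
  using saddle_phase_lower_bound_nonneg[of "\<bar>x\<bar>"] by (cases "x \<ge> 0") (auto simp: arctan_minus)

text \<open>With q = sqrt (1 + u^2/s) and p = sqrt (1 + u^2), both s (q - 1) (q + 1) and (p - 1) (p
  + 1) equal u^2, and q is at most p. So s (q - 1) is at least p - 1, hence at least |u| - 1: a
  bound free of s, as dominated convergence needs.\<close>

lemma scaled_saddle_phase_bound:
  assumes s: "s \<ge> 1"
  shows "s * Re (saddle_phase (u / sqrt s)) \<le> 1 - \<bar>u\<bar>"
proof -
  define q where "q = sqrt (1 + (u / sqrt s)\<^sup>2)"
  have q1: "q \<ge> 1" by (simp add: q_def)
  have q2: "q\<^sup>2 = 1 + u\<^sup>2 / s" using s by (simp add: q_def power_divide)
  define p where "p = sqrt (1 + u\<^sup>2)"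
  have p1: "p \<ge> 1" by (simp add: p_def)
  have p2: "p\<^sup>2 = 1 + u\<^sup>2" by (simp add: p_def)
  have "u\<^sup>2 / s \<le> u\<^sup>2 / 1" using s by (intro divide_left_mono) auto
  then have "q\<^sup>2 \<le> p\<^sup>2" unfolding q2 p2 by simp
  then have qp: "q \<le> p" by (rule power2_le_imp_le) (use p1 in simp)
  have "s * (q - 1) * (q + 1) = s * (q\<^sup>2 - 1)" by (simp add: power2_eq_square algebra_simps)
  then have u1: "s * (q - 1) * (q + 1) = u\<^sup>2" using s unfolding q2 by simp
  have "(p - 1) * (p + 1) = p\<^sup>2 - 1" by (simp add: power2_eq_square algebra_simps)
  then have u2: "(p - 1) * (p + 1) = u\<^sup>2" unfolding p2 by simp
  have "(p - 1) * (q + 1) \<le> (p - 1) * (p + 1)" using p1 qp by (intro mult_left_mono) auto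
  also have "\<dots> = s * (q - 1) * (q + 1)" using u1 u2 by simp
  finally have "p - 1 \<le> s * (q - 1)" using q1 by (rule_tac mult_right_le_imp_le[of _ "q + 1"]) auto
  moreover have "\<bar>u\<bar> \<le> p" unfolding p_def by (rule real_le_rsqrt) simp
  moreover have "s * (q - 1) \<le> s * (- Re (saddle_phase (u / sqrt s)))"
  proof (rule mult_left_mono)
    show "q - 1 \<le> - Re (saddle_phase (u / sqrt s))"
      unfolding Re_saddle_phase q_def minus_minus by (rule saddle_phase_lower_bound)
  qed (use s in simp)
  ultimately show ?thesis unfolding mult_minus_right by linarith
qed

lemma ln_le_linear:
  assumes "c > 0" "d \<ge> (0::real)"
  obtains k where "\<And>x. x \<ge> 0 \<Longrightarrow> d * ln (1 + x) \<le> c * x + k"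
proof
  fix x :: real assume x: "x \<ge> 0"
  \<comment> \<open>The 1 added to d covers d = 0 and still gives \<open>d * e \<le> c\<close>; the
    logarithm is rescaled by e and then bounded by its tangent at 1.\<close>
  define e where "e = c / (d + 1)"
  have e: "e > 0" using assms by (simp add: e_def)
  have de: "d * e \<le> c" using assms by (simp add: e_def field_simps)
  have "ln (1 + x) = ln (e * (1 + x)) - ln e" using e x by (simp add: ln_mult)
  also have "\<dots> \<le> e * (1 + x) - 1 - ln e" using e x by (intro diff_right_mono ln_le_minus_one) auto
  finally have "d * ln (1 + x) \<le> d * (e * (1 + x) - 1 - ln e)" using assms by (intro mult_left_mono) auto
  also have "\<dots> = (d * e) * x + d * (e - 1 - ln e)" by (simp add: algebra_simps)
  also have "\<dots> \<le> c * x + d * (e - 1 - ln e)" using mult_right_mono[OF de x] by simp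
  finally show "d * ln (1 + x) \<le> c * x + d * (c / (d + 1) - 1 - ln (c / (d + 1)))" by (simp add: e_def)
qed

lemma integrable_exp_neg_abs:
  assumes "c > (0::real)"
  shows "integrable lborel (\<lambda>u. exp (- (c * \<bar>u\<bar>)))"
proof (rule Bochner_Integration.integrable_bound)
  have "set_integrable lborel (einterval (-\<infinity>) \<infinity>) (\<lambda>x::real. inverse (1 + x^2))"
    by (rule integrable_inverse_1_plus_square)
  then have "integrable lborel (\<lambda>x::real. inverse (1 + x^2))"
    by (simp add: set_integrable_def)
  then show "integrable lborel (\<lambda>x::real. (1 + 2 / c\<^sup>2) * inverse (1 + x^2))" by simp
  show "AE u in lborel. norm (exp (- (c * \<bar>u\<bar>))) \<le> norm ((1 + 2 / c\<^sup>2) * inverse (1 + u^2))"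
  proof (rule AE_I2)
    fix u :: real
    define v where "v = c * \<bar>u\<bar>"
    have v: "v \<ge> 0" using assms by (simp add: v_def)
    have u2: "u\<^sup>2 = v\<^sup>2 / c\<^sup>2" using assms by (simp add: v_def power_mult_distrib)
    have e: "1 + v + v\<^sup>2 / 2 \<le> exp v" using v by (rule exp_lower_Taylor_quadratic)
    have "1 + u\<^sup>2 \<le> (1 + 2 / c\<^sup>2) * exp v"
    proof -
      have "1 \<le> exp v" using v by simp
      moreover have "u\<^sup>2 \<le> 2 / c\<^sup>2 * exp v"
      proof -
        have "v\<^sup>2 / 2 \<le> exp v" using e v by linarith
        then have "2 / c\<^sup>2 * (v\<^sup>2 / 2) \<le> 2 / c\<^sup>2 * exp v" by (intro mult_left_mono) auto
        then show ?thesis by (simp add: u2)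
      qed
      ultimately show ?thesis unfolding distrib_right by linarith
    qed
    then have "exp (- v) \<le> (1 + 2 / c\<^sup>2) * inverse (1 + u^2)"
      by (simp add: exp_minus field_simps add_pos_nonneg)
    then show "norm (exp (- (c * \<bar>u\<bar>))) \<le> norm ((1 + 2 / c\<^sup>2) * inverse (1 + u^2))"
      unfolding v_def[symmetric] real_norm_def abs_exp_cancel by (rule order_trans[OF _ abs_ge_self])
  qed
qed simp

lemma LINT_gaussian:
  assumes "c > (0::real)"
  shows "(LINT u|lborel. exp (- (c * u\<^sup>2 / 2))) = sqrt (2 * pi / c)"
proof -
  have "(LINT u|lborel. normal_density 0 (1 / sqrt c) u) = 1"
    using assms by (intro integral_normal_density) auto
  moreover have "normal_density 0 (1 / sqrt c) u = 1 / sqrt (2 * pi / c) * exp (- (c * u\<^sup>2 / 2))" for u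
    using assms by (simp add: normal_density_def power_divide)
  ultimately have "1 / sqrt (2 * pi / c) * (LINT u|lborel. exp (- (c * u\<^sup>2 / 2))) = 1"
    by (simp only: integral_mult_right_zero)
  moreover have "sqrt (2 * pi / c) \<noteq> 0" using assms by simp
  ultimately show ?thesis by (simp only: times_divide_eq_left mult_1 divide_eq_1_iff)
qed

text \<open>For w = i \<tau>, (1 + w) (w - w^2/2) - w is w^2/2 - w^3/2: the linear term drops out,
  and w^2 = -\<tau>^2 produces the Gaussian.\<close>

lemma saddle_phase_cubic:
  assumes "\<bar>\<tau>\<bar> \<le> 1/2"
  shows "norm (saddle_phase \<tau> + of_real (\<tau>\<^sup>2 / 2)) \<le> 5 * \<bar>\<tau>\<bar> ^ 3"
proof -
  define w where "w = \<i> * complex_of_real \<tau>"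
  have nw: "norm w = \<bar>\<tau>\<bar>" by (simp add: w_def norm_mult)
  have w2: "w^2 = - of_real (\<tau>\<^sup>2)" by (simp add: w_def power_mult_distrib)
  define \<rho> where "\<rho> = Ln (1 + w) - (w - w^2/2)"
  have \<rho>: "norm \<rho> \<le> 2 * \<bar>\<tau>\<bar> ^ 3" unfolding \<rho>_def using norm_Ln_one_plus_cubic[of w] assms nw by simp
  have "saddle_phase \<tau> = (1 + w) * (\<rho> + (w - w^2/2)) - w"
    by (simp add: saddle_phase_def w_def \<rho>_def)
  also have "\<dots> = w^2 / 2 - w^3 / 2 + (1 + w) * \<rho>"
    by (simp add: algebra_simps power2_eq_square power3_eq_cube add_divide_distrib)
  finally have "saddle_phase \<tau> + of_real (\<tau>\<^sup>2 / 2) = (1 + w) * \<rho> - w^3 / 2"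
    unfolding w2 by simp
  also have "norm \<dots> \<le> norm ((1 + w) * \<rho>) + norm (w^3 / 2)" by (rule norm_triangle_ineq4)
  also have "\<dots> = norm (1 + w) * norm \<rho> + \<bar>\<tau>\<bar> ^ 3 / 2" by (simp add: norm_mult norm_divide norm_power nw)
  also have "norm (1 + w) * norm \<rho> \<le> 2 * (2 * \<bar>\<tau>\<bar> ^ 3)"
  proof (intro mult_mono \<rho>)
    have "norm (1 + w) \<le> norm (1::complex) + norm w" by (rule norm_triangle_ineq)
    then show "norm (1 + w) \<le> 2" using nw assms by simp
  qed auto
  also have "2 * (2 * \<bar>\<tau>\<bar> ^ 3) + \<bar>\<tau>\<bar> ^ 3 / 2 \<le> 5 * \<bar>\<tau>\<bar> ^ 3"
    using zero_le_power[of "\<bar>\<tau>\<bar>" 3] by simp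
  finally show ?thesis by simp
qed

lemma scaled_saddle_phase_lim:
  "((\<lambda>s. of_real s * saddle_phase (u / sqrt s)) \<longlongrightarrow> - of_real (u\<^sup>2 / 2)) at_top"
proof -
  have "((\<lambda>s. of_real s * saddle_phase (u / sqrt s) + of_real (u\<^sup>2 / 2)) \<longlongrightarrow> 0) at_top"
  proof (rule Lim_null_comparison)
    show "((\<lambda>s. 5 * \<bar>u\<bar> ^ 3 / sqrt s) \<longlongrightarrow> 0) at_top" by real_asymp
    show "\<forall>\<^sub>F s in at_top. norm (of_real s * saddle_phase (u / sqrt s) + of_real (u\<^sup>2 / 2)) \<le> 5 * \<bar>u\<bar> ^ 3 / sqrt s"
      using eventually_ge_at_top[of "max 1 (4 * u\<^sup>2)"]
    proof eventually_elim
      case (elim s)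
      then have s: "s \<ge> 1" "4 * u\<^sup>2 \<le> s" by auto
      have "2 * \<bar>u\<bar> \<le> sqrt s" using s by (intro real_le_rsqrt) (simp add: power_mult_distrib)
      then have "\<bar>u / sqrt s\<bar> \<le> 1/2" using s by (simp add: abs_mult field_simps)
      from saddle_phase_cubic[OF this]
      have "s * norm (saddle_phase (u / sqrt s) + of_real ((u / sqrt s)\<^sup>2 / 2)) \<le> s * (5 * \<bar>u / sqrt s\<bar> ^ 3)"
        using s by (intro mult_left_mono) auto
      moreover have "of_real s * saddle_phase (u / sqrt s) + of_real (u\<^sup>2 / 2) =
          of_real s * (saddle_phase (u / sqrt s) + of_real ((u / sqrt s)\<^sup>2 / 2))"
      proof -
        have "s * ((u / sqrt s)\<^sup>2 / 2) = u\<^sup>2 / 2" using s by (simp add: power_divide)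
        then have "complex_of_real s * of_real ((u / sqrt s)\<^sup>2 / 2) = of_real (u\<^sup>2 / 2)"
          by (simp only: of_real_mult[symmetric])
        then show ?thesis by (simp only: distrib_left)
      qed
      moreover have "s * (5 * \<bar>u / sqrt s\<bar> ^ 3) = 5 * \<bar>u\<bar> ^ 3 / sqrt s"
      proof -
        have "sqrt s ^ 3 = s * sqrt s" using s by (simp add: power3_eq_cube)
        then show ?thesis using s by (simp add: power_divide)
      qed
      moreover have "\<bar>s\<bar> = s" using s by simp
      ultimately show ?case by (simp only: norm_mult norm_of_real)
    qed
  qed
  then have "((\<lambda>s. (of_real s * saddle_phase (u / sqrt s) + of_real (u\<^sup>2 / 2)) - of_real (u\<^sup>2 / 2)) \<longlongrightarrow> 0 - of_real (u\<^sup>2 / 2)) at_top"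
    by (intro tendsto_diff tendsto_const)
  then show ?thesis by simp
qed

text \<open>The subtracted term comes from Fourier inversion at the height \<kappa> + \<gamma> ln s.
  It cancels the imaginary terms carrying \<kappa> and ln s, and \<open>saddle_phase\<close> has no
  linear part, so s is the saddle point for this height.\<close>

lemma saddle_exponent_eq:
  fixes s \<tau> \<gamma> \<delta> \<kappa> :: real
  assumes s: "s > 0"
  defines "z \<equiv> of_real s * (1 + \<i> * of_real \<tau>)"
  shows "of_real \<gamma> * (z * Ln z - z) + of_real \<delta> * Ln z + of_real \<kappa> * z - \<i> * of_real (s * \<tau> * (\<kappa> + \<gamma> * ln s))
    = of_real (s * (\<kappa> + \<gamma> * ln s) + \<delta> * ln s - \<gamma> * s) + (of_real (\<gamma> * s) * saddle_phase \<tau> + of_real \<delta> * Ln (1 + \<i> * of_real \<tau>))"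
proof -
  have L: "Ln z = of_real (ln s) + Ln (1 + \<i> * of_real \<tau>)"
    unfolding z_def using s by (subst Ln_times_of_real) (auto simp: Ln_of_real one_plus_ii_nonzero)
  show ?thesis unfolding L unfolding saddle_phase_def z_def by (simp add: algebra_simps)
qed

section \<open>The Fourier integral through the saddle point\<close>

locale saddle_point =
  fixes f :: "real \<Rightarrow> real" and G r :: "complex \<Rightarrow> complex" and \<gamma> \<delta> \<kappa> A B s1 :: real
  assumes \<gamma>: "\<gamma> > 0" and A: "A > 0" and s1: "s1 > 0"
    and f0: "\<And>y. f y \<ge> 0" and fc: "continuous_on UNIV f"
    and fint: "\<And>s. s > 0 \<Longrightarrow> integrable lborel (\<lambda>y. exp (s * y) * f y)"
    and G: "\<And>z. Re z > 0 \<Longrightarrow> G z = (CLINT y|lborel. of_real (f y) * exp (z * of_real y))"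
    and Ghol: "G holomorphic_on {z. Re z > 0}"
    and asy: "\<And>z. Re z \<ge> s1 \<Longrightarrow> G z = of_real A * exp (of_real \<gamma> * (z * Ln z - z) + of_real \<delta> * Ln z + of_real \<kappa> * z + r z)"
    and rb: "\<And>z. Re z \<ge> s1 \<Longrightarrow> norm (r z) \<le> B / Re z"
begin

text \<open>The inverse of the map taking y to exp ((y - \<kappa>) / \<gamma>): the y whose saddle
  point is s.\<close>

definition height :: "real \<Rightarrow> real" where "height s = \<kappa> + \<gamma> * ln s"

text \<open>The leading size of G at the real point s, up to the constant A.\<close>

definition peak :: "real \<Rightarrow> real" where "peak s = exp (s * height s + \<delta> * ln s - \<gamma> * s)"

text \<open>The inversion integrand in the variable u = Im z / sqrt s, divided by its leading size
  at the saddle. The value 0 for nonpositive s makes it measurable in u for every s, as dominated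
  convergence asks.\<close>

definition I :: "real \<Rightarrow> real \<Rightarrow> complex" where
  "I s u = (if s > 0 then G (Complex s (sqrt s * u)) * iexp (- (sqrt s * u * height s)) / of_real (A * peak s) else 0)"

lemma peak_pos: "peak s > 0"
  by (simp add: peak_def)

lemma G_line_continuous: "s > 0 \<Longrightarrow> continuous_on UNIV (\<lambda>t. G (Complex s t))"
  by (rule continuous_on_compose2[OF holomorphic_on_imp_continuous_on[OF Ghol]])
     (auto intro!: continuous_intros simp: Complex_eq)

lemma G_line_measurable: "s > 0 \<Longrightarrow> (\<lambda>t. G (Complex s t)) \<in> borel_measurable borel"
  by (rule borel_measurable_continuous_onI[OF G_line_continuous])

lemma I_measurable: "I s \<in> borel_measurable borel"
proof (cases "s > 0")
  case True
  have [measurable]: "(\<lambda>u. G (Complex s (sqrt s * u))) \<in> borel_measurable borel"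
    by (rule measurable_compose[OF _ G_line_measurable[OF True]]) measurable
  show ?thesis unfolding I_def[abs_def] using True by simp
next
  case False
  then show ?thesis unfolding I_def[abs_def] by simp
qed

lemma I_eq:
  assumes s: "s \<ge> s1"
  shows "I s u = exp (of_real (\<gamma> * s) * saddle_phase (u / sqrt s) + of_real \<delta> * Ln (1 + \<i> * of_real (u / sqrt s)) + r (Complex s (sqrt s * u)))"
proof -
  have s0: "s > 0" using s s1 by linarith
  define \<tau> where "\<tau> = u / sqrt s"
  have st: "s * \<tau> = sqrt s * u" using s0 by (simp add: \<tau>_def field_simps)
  define z where "z = of_real s * (1 + \<i> * of_real \<tau>)"
  have z: "Complex s (sqrt s * u) = z" unfolding st[symmetric] z_def by (simp add: Complex_eq algebra_simps)
  define E where "E = of_real (\<gamma> * s) * saddle_phase \<tau> + of_real \<delta> * Ln (1 + \<i> * of_real \<tau>)"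
  have "G z * iexp (- (sqrt s * u * height s)) = of_real A *
     (exp (of_real \<gamma> * (z * Ln z - z) + of_real \<delta> * Ln z + of_real \<kappa> * z + r z) * exp (- (\<i> * of_real (s * \<tau> * height s))))"
    using asy[of z] s unfolding st z_def by simp
  also have "exp (of_real \<gamma> * (z * Ln z - z) + of_real \<delta> * Ln z + of_real \<kappa> * z + r z) * exp (- (\<i> * of_real (s * \<tau> * height s)))
     = exp ((of_real \<gamma> * (z * Ln z - z) + of_real \<delta> * Ln z + of_real \<kappa> * z - \<i> * of_real (s * \<tau> * height s)) + r z)"
    unfolding exp_add[symmetric] by (rule arg_cong[of _ _ exp]) simp
  also have "of_real \<gamma> * (z * Ln z - z) + of_real \<delta> * Ln z + of_real \<kappa> * z - \<i> * of_real (s * \<tau> * height s)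
     = of_real (s * height s + \<delta> * ln s - \<gamma> * s) + E"
    unfolding E_def z_def height_def by (rule saddle_exponent_eq[OF s0])
  also have "exp (of_real (s * height s + \<delta> * ln s - \<gamma> * s) + E + r z) = of_real (peak s) * exp (E + r z)"
    unfolding peak_def by (simp only: add.assoc exp_add exp_of_real)
  finally have "G z * iexp (- (sqrt s * u * height s)) = of_real (A * peak s) * exp (E + r z)" by (simp add: mult_ac)
  moreover have "of_real (A * peak s) \<noteq> (0::complex)" using A peak_pos[of s] by simp
  ultimately show ?thesis using s0 unfolding I_def z E_def \<tau>_def by (simp del: of_real_mult)
qed

lemma r_line_bound: "s \<ge> s1 \<Longrightarrow> norm (r (Complex s t)) \<le> B / s"
  using rb[of "Complex s t"] by simp

lemma I_lim: "((\<lambda>s. I s u) \<longlongrightarrow> of_real (exp (- (\<gamma> * u\<^sup>2 / 2)))) at_top"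
proof -
  have L1: "((\<lambda>s. of_real \<gamma> * (of_real s * saddle_phase (u / sqrt s))) \<longlongrightarrow> of_real \<gamma> * (- of_real (u\<^sup>2 / 2))) at_top"
    by (intro tendsto_intros scaled_saddle_phase_lim)
  have ut: "((\<lambda>s. u / sqrt s) \<longlongrightarrow> 0) at_top" by real_asymp
  have "((\<lambda>s. Ln (1 + \<i> * of_real (u / sqrt s))) \<longlongrightarrow> Ln (1 + \<i> * of_real 0)) at_top"
    by (intro tendsto_intros ut) (auto simp: complex_nonpos_Reals_iff)
  then have L2: "((\<lambda>s. Ln (1 + \<i> * of_real (u / sqrt s))) \<longlongrightarrow> 0) at_top" by simp
  have L3: "((\<lambda>s. r (Complex s (sqrt s * u))) \<longlongrightarrow> 0) at_top"
  proof (rule Lim_null_comparison)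
    show "((\<lambda>s. B / s) \<longlongrightarrow> 0) at_top" by real_asymp
    show "\<forall>\<^sub>F s in at_top. norm (r (Complex s (sqrt s * u))) \<le> B / s"
      using eventually_ge_at_top[of s1] by eventually_elim (rule r_line_bound)
  qed
  have "((\<lambda>s. exp (of_real \<gamma> * (of_real s * saddle_phase (u / sqrt s)) + of_real \<delta> * Ln (1 + \<i> * of_real (u / sqrt s)) + r (Complex s (sqrt s * u))))
     \<longlongrightarrow> exp (of_real \<gamma> * (- of_real (u\<^sup>2 / 2)) + of_real \<delta> * 0 + 0)) at_top"
    by (intro tendsto_exp tendsto_add tendsto_mult tendsto_const L2 L3 scaled_saddle_phase_lim)
  moreover have "exp (of_real \<gamma> * (- of_real (u\<^sup>2 / 2)) + of_real \<delta> * 0 + 0) = complex_of_real (exp (- (\<gamma> * u\<^sup>2 / 2)))"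
    by (simp add: exp_of_real[symmetric])
  moreover have "\<forall>\<^sub>F s in at_top. exp (of_real \<gamma> * (of_real s * saddle_phase (u / sqrt s)) + of_real \<delta> * Ln (1 + \<i> * of_real (u / sqrt s)) + r (Complex s (sqrt s * u))) = I s u"
    using eventually_ge_at_top[of s1] by eventually_elim (simp add: I_eq mult.assoc)
  ultimately show ?thesis by (simp add: Lim_transform_eventually)
qed

text \<open>The phase supplies the decay exp (\<gamma> (1 - |u|)). The factor |1 + i
  \<tau>|^\<delta> is at most polynomial in |u|, uniformly in s, so half of the decay absorbs it;
  the remainder r is bounded by |B|.\<close>

lemma I_bound:
  obtains w where "integrable lborel w" "\<And>s u. s \<ge> max 1 s1 \<Longrightarrow> norm (I s u) \<le> w u"
proof -
  obtain k where k: "\<And>x. x \<ge> 0 \<Longrightarrow> \<bar>\<delta>\<bar> * ln (1 + x) \<le> \<gamma> / 2 * x + k"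
    using ln_le_linear[of "\<gamma>/2" "\<bar>\<delta>\<bar>"] \<gamma> by auto
  define w where "w u = exp (\<gamma> + k + \<bar>B\<bar>) * exp (- (\<gamma> / 2 * \<bar>u\<bar>))" for u
  have "integrable lborel w" unfolding w_def
    using \<gamma> by (intro integrable_mult_right integrable_exp_neg_abs) simp
  moreover have "norm (I s u) \<le> w u" if s: "s \<ge> max 1 s1" for s u
  proof -
    define \<tau> where "\<tau> = u / sqrt s"
    have s': "s \<ge> 1" "s \<ge> s1" using s by auto
    have "norm (I s u) = exp (\<gamma> * (s * Re (saddle_phase \<tau>)) + \<delta> * Re (Ln (1 + \<i> * of_real \<tau>)) + Re (r (Complex s (sqrt s * u))))"
      unfolding I_eq[OF s'(2)] \<tau>_def[symmetric] norm_exp_eq_Re by simp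
    also have "\<dots> \<le> exp (\<gamma> * (1 - \<bar>u\<bar>) + (\<gamma> / 2 * \<bar>u\<bar> + k) + \<bar>B\<bar>)"
    proof -
      have 1: "\<gamma> * (s * Re (saddle_phase \<tau>)) \<le> \<gamma> * (1 - \<bar>u\<bar>)"
        unfolding \<tau>_def using \<gamma> scaled_saddle_phase_bound[OF s'(1)] by (intro mult_left_mono) auto
      have \<tau>u: "\<bar>\<tau>\<bar> \<le> \<bar>u\<bar>"
      proof -
        have "\<bar>u\<bar> / sqrt s \<le> \<bar>u\<bar> / 1" using s'(1) by (intro divide_left_mono) auto
        then show ?thesis using s'(1) by (simp add: \<tau>_def abs_divide)
      qed
      have l: "0 \<le> ln (1 + \<tau>\<^sup>2) / 2" "ln (1 + \<tau>\<^sup>2) / 2 \<le> ln (1 + \<bar>u\<bar>)"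
      proof -
        show "0 \<le> ln (1 + \<tau>\<^sup>2) / 2" by simp
        have "1 + \<tau>\<^sup>2 \<le> (1 + \<bar>\<tau>\<bar>)\<^sup>2" by (simp add: power2_eq_square algebra_simps)
        also have "\<dots> \<le> (1 + \<bar>u\<bar>)\<^sup>2" using \<tau>u by (intro power_mono) auto
        finally have "ln (1 + \<tau>\<^sup>2) \<le> ln ((1 + \<bar>u\<bar>)\<^sup>2)" by (intro ln_mono) (auto simp: add_pos_nonneg)
        also have "\<dots> = 2 * ln (1 + \<bar>u\<bar>)" by (simp add: ln_realpow)
        finally show "ln (1 + \<tau>\<^sup>2) / 2 \<le> ln (1 + \<bar>u\<bar>)" by simp
      qed
      have "\<delta> * (ln (1 + \<tau>\<^sup>2) / 2) \<le> \<bar>\<delta>\<bar> * (ln (1 + \<tau>\<^sup>2) / 2)" by (intro mult_right_mono l) auto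
      also have "\<dots> \<le> \<bar>\<delta>\<bar> * ln (1 + \<bar>u\<bar>)" by (intro mult_left_mono l) auto
      also have "\<dots> \<le> \<gamma> / 2 * \<bar>u\<bar> + k" by (rule k) simp
      finally have 2: "\<delta> * Re (Ln (1 + \<i> * of_real \<tau>)) \<le> \<gamma> / 2 * \<bar>u\<bar> + k" unfolding Re_Ln_one_plus_ii .
      have "B / s \<le> \<bar>B\<bar>"
      proof -
        have "B / s \<le> \<bar>B\<bar> / s" using s'(1) by (intro divide_right_mono) auto
        also have "\<dots> \<le> \<bar>B\<bar> / 1" using s'(1) by (intro divide_left_mono) auto
        finally show ?thesis by simp
      qed
      then have 3: "Re (r (Complex s (sqrt s * u))) \<le> \<bar>B\<bar>"
        using complex_Re_le_cmod[of "r (Complex s (sqrt s * u))"] r_line_bound[OF s'(2), of "sqrt s * u"] by linarith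
      have "\<gamma> * (s * Re (saddle_phase \<tau>)) + \<delta> * Re (Ln (1 + \<i> * of_real \<tau>)) + Re (r (Complex s (sqrt s * u)))
         \<le> \<gamma> * (1 - \<bar>u\<bar>) + (\<gamma> / 2 * \<bar>u\<bar> + k) + \<bar>B\<bar>" by (intro add_mono 1 2 3)
      then show ?thesis by (simp only: exp_le_cancel_iff)
    qed
    also have "\<gamma> * (1 - \<bar>u\<bar>) + (\<gamma> / 2 * \<bar>u\<bar> + k) + \<bar>B\<bar> = (\<gamma> + k + \<bar>B\<bar>) + - (\<gamma> / 2 * \<bar>u\<bar>)"
      by (simp add: algebra_simps)
    finally show ?thesis unfolding w_def exp_add[symmetric] .
  qed
  ultimately show ?thesis by (rule that)
qed

lemma I_integral_lim: "((\<lambda>s. CLINT u|lborel. I s u) \<longlongrightarrow> of_real (sqrt (2 * pi / \<gamma>))) at_top"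
proof -
  obtain w where w: "integrable lborel w" "\<And>s u. s \<ge> max 1 s1 \<Longrightarrow> norm (I s u) \<le> w u" using I_bound by blast
  have "((\<lambda>s. CLINT u|lborel. I s u) \<longlongrightarrow> (CLINT u|lborel. of_real (exp (- (\<gamma> * u\<^sup>2 / 2))))) at_top"
  proof (rule integral_dominated_convergence_at_top)
    show "integrable lborel w" by (rule w)
    show "AE u in lborel. ((\<lambda>s. I s u) \<longlongrightarrow> of_real (exp (- (\<gamma> * u\<^sup>2 / 2)))) at_top"
      by (intro AE_I2 I_lim)
    show "\<forall>\<^sub>F s in at_top. AE u in lborel. norm (I s u) \<le> w u"
      using eventually_ge_at_top[of "max 1 s1"] by eventually_elim (intro AE_I2 w(2))
    show "(\<lambda>u. complex_of_real (exp (- (\<gamma> * u\<^sup>2 / 2)))) \<in> borel_measurable lborel" by measurable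
    show "I s \<in> borel_measurable lborel" for s using I_measurable by simp
  qed
  then show ?thesis unfolding integral_complex_of_real LINT_gaussian[OF \<gamma>] .
qed

lemma I_integrable: "s \<ge> max 1 s1 \<Longrightarrow> integrable lborel (I s)"
proof -
  assume s: "s \<ge> max 1 s1"
  obtain w where w: "integrable lborel w" "\<And>s u. s \<ge> max 1 s1 \<Longrightarrow> norm (I s u) \<le> w u" using I_bound by blast
  show ?thesis
  proof (rule Bochner_Integration.integrable_bound[OF w(1)])
    show "I s \<in> borel_measurable lborel" using I_measurable by simp
    show "AE u in lborel. norm (I s u) \<le> norm (w u)"
      unfolding real_norm_def by (intro AE_I2 order_trans[OF w(2)[OF s] abs_ge_self])
  qed
qed

text \<open>Inversion is applied to the tilted density exp (s x) f x, whose Fourier transform is G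
  on the line Re z = s. The substitution t = sqrt s * u contributes the 1/2 added to \<delta>, and
  the factor \<open>exp (s * height s)\<close> in \<open>peak\<close> cancels the tilt.\<close>

lemma density_at_height:
  assumes s: "s \<ge> max 1 s1"
  shows "complex_of_real (f (height s)) = of_real (A / (2 * pi) * exp ((\<delta> + 1/2) * ln s - \<gamma> * s)) * (CLINT u|lborel. I s u)"
proof -
  have s': "s \<ge> 1" "s \<ge> s1" "s > 0" using s by auto
  define y where "y = height s"
  define P where "P = complex_of_real (A * peak s)"
  have P0: "P \<noteq> 0" unfolding P_def using A peak_pos[of s] by simp
  define g where "g x = exp (s * x) * f x" for x
  define \<phi> where "\<phi> t = G (Complex s t)" for t
  have \<phi>I: "iexp (- (sqrt s * u * y)) * \<phi> (sqrt s * u) = P * I s u" for u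
    using s'(3) P0 by (simp add: I_def \<phi>_def P_def y_def)
  \<comment> \<open>Integrability passes from \<open>I s\<close> to \<phi> through the modulus, as
    the oscillating factor has norm 1.\<close>
  have \<phi>i: "integrable lborel \<phi>"
  proof -
    have "integrable lborel (\<lambda>u. P * I s u)" using I_integrable[OF s] by simp
    then have "integrable lborel (\<lambda>u. iexp (- (sqrt s * u * y)) * \<phi> (sqrt s * u))" unfolding \<phi>I .
    then have "integrable lborel (\<lambda>u. norm (iexp (- (sqrt s * u * y)) * \<phi> (sqrt s * u)))" by (rule integrable_norm)
    then have n: "integrable lborel (\<lambda>u. norm (\<phi> (0 + sqrt s * u)))" by (simp add: norm_mult)
    have "integrable lborel (\<lambda>u. \<phi> (0 + sqrt s * u))"
    proof (rule Bochner_Integration.integrable_bound[OF n])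
      have [measurable]: "\<phi> \<in> borel_measurable borel" unfolding \<phi>_def[abs_def] by (rule G_line_measurable[OF s'(3)])
      show "(\<lambda>u. \<phi> (0 + sqrt s * u)) \<in> borel_measurable lborel" by measurable
    qed auto
    then show ?thesis using lborel_integrable_real_affine_iff[of "sqrt s" \<phi> 0] s'(3) by simp
  qed
  have \<phi>: "\<phi> t = (CLINT x|lborel. complex_of_real (g x) * iexp (t * x))" for t
  proof -
    have "\<phi> t = (CLINT x|lborel. of_real (f x) * exp (Complex s t * of_real x))"
      unfolding \<phi>_def by (rule G) (use s'(3) in simp)
    moreover have "of_real (f x) * exp (Complex s t * of_real x) = complex_of_real (g x) * iexp (t * x)" for x
    proof -
      have "exp (Complex s t * of_real x) = exp (of_real (s * x)) * iexp (t * x)"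
        unfolding exp_add[symmetric] by (rule arg_cong[of _ _ exp]) (simp add: Complex_eq algebra_simps)
      moreover have "exp (complex_of_real (s * x)) = of_real (exp (s * x))" by (rule exp_of_real)
      ultimately show ?thesis unfolding g_def of_real_mult by (simp only: mult_ac)
    qed
    ultimately show ?thesis by simp
  qed
  have g0: "g x \<ge> 0" for x unfolding g_def using f0 by simp
  have gi: "integrable lborel g" unfolding g_def using fint[OF s'(3)] .
  have gc: "continuous_on UNIV g" unfolding g_def by (intro continuous_intros fc)
  have pos: "integral\<^sup>L lborel g > 0"
  proof -
    have "complex_of_real (integral\<^sup>L lborel g) = \<phi> 0" unfolding \<phi> by simp
    also have "\<phi> 0 \<noteq> 0" unfolding \<phi>_def using asy[of "Complex s 0"] s' A by simp
    finally have "integral\<^sup>L lborel g \<noteq> 0" by simp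
    moreover have "integral\<^sup>L lborel g \<ge> 0" by (intro integral_nonneg_AE AE_I2 g0)
    ultimately show ?thesis by simp
  qed
  have "complex_of_real (g y) = 1 / (2 * pi) * (CLINT t|lborel. iexp (-(t * y)) * \<phi> t)"
    by (rule fourier_inversion[OF g0 gi gc pos \<phi> \<phi>i])
  also have "(CLINT t|lborel. iexp (-(t * y)) * \<phi> t) = sqrt s *\<^sub>R (CLINT u|lborel. iexp (-(sqrt s * u * y)) * \<phi> (sqrt s * u))"
    using lborel_integral_real_affine[of "sqrt s" "\<lambda>t. iexp (-(t * y)) * \<phi> t" 0] s'(3) by simp
  also have "\<dots> = of_real (sqrt s) * (P * (CLINT u|lborel. I s u))"
    unfolding \<phi>I by (simp only: scaleR_conv_of_real integral_mult_right_zero)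
  finally have gy: "complex_of_real (g y) = of_real (1 / (2 * pi)) * (of_real (sqrt s) * (P * (CLINT u|lborel. I s u)))"
    by simp
  have "sqrt s = exp (ln s / 2)" using s'(3) by (simp add: ln_sqrt[symmetric])
  then have "1 / (2 * pi) * sqrt s * (A * peak s) = exp (s * y) * (A / (2 * pi) * exp ((\<delta> + 1/2) * ln s - \<gamma> * s))"
    by (simp add: peak_def y_def exp_add[symmetric] exp_diff[symmetric] algebra_simps)
  then have "complex_of_real (1 / (2 * pi)) * (of_real (sqrt s) * P) = of_real (exp (s * y)) * of_real (A / (2 * pi) * exp ((\<delta> + 1/2) * ln s - \<gamma> * s))"
    unfolding P_def by (simp only: of_real_mult[symmetric] mult.assoc)
  then have "of_real (exp (s * y)) * complex_of_real (f y) = of_real (exp (s * y)) * (of_real (A / (2 * pi) * exp ((\<delta> + 1/2) * ln s - \<gamma> * s)) * (CLINT u|lborel. I s u))"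
    using gy unfolding g_def of_real_mult[of "exp (s * y)" "f y"] by (simp only: mult.assoc[symmetric])
  moreover have "complex_of_real (exp (s * y)) \<noteq> 0" by simp
  ultimately show ?thesis unfolding y_def by (simp only: mult_cancel_left) simp
qed

theorem density_asymptotics:
  "f \<sim>[at_top] (\<lambda>y. A / sqrt (2 * pi * \<gamma>) * exp ((\<delta> + 1/2) / \<gamma> * (y - \<kappa>) - \<gamma> * exp ((y - \<kappa>) / \<gamma>)))"
proof (rule asymp_equivI')
  let ?h = "\<lambda>y. A / sqrt (2 * pi * \<gamma>) * exp ((\<delta> + 1/2) / \<gamma> * (y - \<kappa>) - \<gamma> * exp ((y - \<kappa>) / \<gamma>))"
  define \<sigma> where "\<sigma> y = exp ((y - \<kappa>) / \<gamma>)" for y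
  have \<sigma>: "filterlim \<sigma> at_top at_top" unfolding \<sigma>_def using \<gamma> by real_asymp
  have L: "((\<lambda>y. Re (CLINT u|lborel. I (\<sigma> y) u) * (sqrt (2 * pi * \<gamma>) / (2 * pi))) \<longlongrightarrow> Re (of_real (sqrt (2 * pi / \<gamma>))) * (sqrt (2 * pi * \<gamma>) / (2 * pi))) at_top"
    by (intro tendsto_mult tendsto_const tendsto_Re filterlim_compose[OF I_integral_lim \<sigma>])
  \<comment> \<open>The Gaussian integral sqrt (2 pi / \<gamma>) divided by 2 pi is 1 / sqrt (2 pi
    \<gamma>), the constant in the asymptotics.\<close>
  have one: "Re (of_real (sqrt (2 * pi / \<gamma>))) * (sqrt (2 * pi * \<gamma>) / (2 * pi)) = 1"
  proof -
    have "sqrt (2 * pi / \<gamma>) * sqrt (2 * pi * \<gamma>) = sqrt ((2 * pi)\<^sup>2)"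
      unfolding real_sqrt_mult[symmetric] using \<gamma> by (simp add: power2_eq_square)
    also have "\<dots> = 2 * pi" by (rule real_sqrt_abs[THEN trans]) simp
    finally show ?thesis by simp
  qed
  have "\<forall>\<^sub>F y in at_top. Re (CLINT u|lborel. I (\<sigma> y) u) * (sqrt (2 * pi * \<gamma>) / (2 * pi)) = f y / ?h y"
  proof -
    have "\<forall>\<^sub>F y in at_top. \<sigma> y \<ge> max 1 s1"
      by (rule eventually_compose_filterlim[OF eventually_ge_at_top \<sigma>])
    then show ?thesis
    proof eventually_elim
      case (elim y)
      have ls: "ln (\<sigma> y) = (y - \<kappa>) / \<gamma>" by (simp add: \<sigma>_def)
      have hy: "height (\<sigma> y) = y" using \<gamma> by (simp add: height_def ls)
      define e where "e = exp ((\<delta> + 1/2) * ln (\<sigma> y) - \<gamma> * \<sigma> y)"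
      have e0: "e > 0" by (simp add: e_def)
      have "f y = Re (of_real (A / (2 * pi) * e) * (CLINT u|lborel. I (\<sigma> y) u))"
        using density_at_height[OF elim] unfolding hy e_def[symmetric] by (metis Re_complex_of_real)
      then have fy: "f y = A / (2 * pi) * e * Re (CLINT u|lborel. I (\<sigma> y) u)" by simp
      have "(\<delta> + 1/2) / \<gamma> * (y - \<kappa>) - \<gamma> * exp ((y - \<kappa>) / \<gamma>) = (\<delta> + 1/2) * ln (\<sigma> y) - \<gamma> * \<sigma> y"
        by (simp add: ls) (simp add: \<sigma>_def)
      then have h: "?h y = A / sqrt (2 * pi * \<gamma>) * e" by (simp only: e_def)
      show ?case unfolding h fy using A e0 \<gamma> by (simp add: field_simps)
    qed
  qed
  then show "((\<lambda>y. f y / ?h y) \<longlongrightarrow> 1) at_top"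
    by (rule Lim_transform_eventually[OF L[unfolded one]])
qed

end

section \<open>Densities with moments of Gamma type\<close>

lemma laplace_of_real: "laplace M Y (of_real s) = of_real (LINT \<omega>|M. exp (s * Y \<omega>))"
  unfolding laplace_def integral_complex_of_real[symmetric] by (simp add: exp_of_real[symmetric])

lemma (in prob_space) integral_exp_pos:
  fixes Y :: "'a \<Rightarrow> real"
  assumes "integrable M (\<lambda>\<omega>. exp (s * Y \<omega>))"
  shows "(LINT \<omega>|M. exp (s * Y \<omega>)) > 0"
proof -
  have "(LINT \<omega>|M. exp (s * Y \<omega>)) \<noteq> 0"
  proof
    assume "(LINT \<omega>|M. exp (s * Y \<omega>)) = 0"
    then have "AE \<omega> in M. exp (s * Y \<omega>) = 0"
      using integral_nonneg_eq_0_iff_AE[OF assms] by simp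
    then have "AE \<omega> in M. False" by eventually_elim simp
    then show False by (simp add: AE_False)
  qed
  moreover have "(LINT \<omega>|M. exp (s * Y \<omega>)) \<ge> 0" by (intro integral_nonneg_AE) simp
  ultimately show ?thesis by linarith
qed

lemma (in prob_space) distributed_cdf:
  fixes Z :: "'a \<Rightarrow> real"
  assumes d: "distributed M lborel Z (\<lambda>x. ennreal (f x))" and f0: "\<And>x. f x \<ge> 0"
  shows "integrable lborel f"
    and "(LINT y|lborel. indicator {..t} y * f y) = (LINT \<omega>|M. indicator {..t} (Z \<omega>))"
proof -
  have "integrable lborel (\<lambda>x. f x * 1) \<longleftrightarrow> integrable M (\<lambda>x. 1::real)"
    by (rule distributed_integrable[OF d]) (use f0 in auto)
  then show "integrable lborel f" by simp
  have "(LINT y|lborel. f y * indicator {..t} y) = (LINT \<omega>|M. indicator {..t} (Z \<omega>))"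
    by (rule distributed_integral[OF d]) (use f0 in auto)
  then show "(LINT y|lborel. indicator {..t} y * f y) = (LINT \<omega>|M. indicator {..t} (Z \<omega>))"
    by (simp add: mult.commute)
qed

text \<open>Uniqueness of densities would give the identity only almost everywhere. Differentiating
  the two distribution functions, with the continuity of both densities, gives it at every positive
  x.\<close>

lemma (in prob_space) density_of_ln:
  fixes X :: "'a \<Rightarrow> real"
  assumes Xm: "X \<in> borel_measurable M" and pos: "AE \<omega> in M. X \<omega> > 0"
    and dX: "distributed M lborel X (\<lambda>x. ennreal (fX x))" "\<And>x. fX x \<ge> 0" "continuous_on {0<..} fX"
    and dY: "distributed M lborel (\<lambda>\<omega>. ln (X \<omega>)) (\<lambda>y. ennreal (fY y))" "\<And>y. fY y \<ge> 0" "continuous_on UNIV fY"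
    and x: "x > 0"
  shows "fX x = fY (ln x) / x"
proof -
  let ?cX = "\<lambda>t. LINT y|lborel. indicator {..t} y * fX y" and ?cY = "\<lambda>t. LINT y|lborel. indicator {..t} y * fY y"
  have eq: "?cX t = ?cY (ln t)" if t: "t > 0" for t
    unfolding distributed_cdf(2)[OF dX(1,2)] distributed_cdf(2)[OF dY(1,2)]
  proof (rule integral_cong_AE)
    show "AE \<omega> in M. indicator {..t} (X \<omega>) = (indicator {..ln t} (ln (X \<omega>)) :: real)"
      using pos by eventually_elim (use t in \<open>simp add: indicator_def\<close>)
  qed (use Xm in measurable)
  have "(?cX has_real_derivative fX x) (at x)"
  proof (rule density_cdf_derivative[OF distributed_cdf(1)[OF dX(1,2)]])
    show "continuous_on {0<..<x + 1} fX" by (rule continuous_on_subset[OF dX(3)]) auto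
  qed (use x in auto)
  moreover have "(?cX has_real_derivative fY (ln x) * (1 / x)) (at x)"
  proof (rule has_field_derivative_transform_within_open)
    have "(?cY has_real_derivative fY (ln x)) (at (ln x))"
      by (rule density_cdf_derivative[OF distributed_cdf(1)[OF dY(1,2)] continuous_on_subset[OF dY(3)], of "ln x - 1" "ln x + 1"]) auto
    then show "((\<lambda>t. ?cY (ln t)) has_real_derivative fY (ln x) * (1 / x)) (at x)"
      by (rule DERIV_chain2) (rule DERIV_ln_divide[OF x])
  qed (use x eq in \<open>auto simp: greaterThan_def[symmetric] intro: open_greaterThan\<close>)
  ultimately show ?thesis using DERIV_unique by fastforce
qed

context gamma_type_parameters
begin

lemma C_nonzero:
  assumes "F z \<noteq> 0" shows "C \<noteq> 0"
proof
  assume "C = 0"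
  then have n: "num s = 0" for s unfolding num_def by simp
  have "F z = remove_sings (\<lambda>s. num s / den s) z" by (simp only: F_eq_remove_sings)
  also have "\<dots> = 0" unfolding n by simp
  finally show False using assms by simp
qed

lemma C1_param_pos: "C \<noteq> 0 \<Longrightarrow> C1_param J K C a b a' b' > 0"
  unfolding C1_param_def using a_nz a'_nz by (auto intro!: mult_pos_pos divide_pos_pos prod_pos)

theorem log_density_asymptotics:
  fixes M :: "'w measure" and X :: "'w \<Rightarrow> real"
  assumes M: "prob_space M" and Xm: "X \<in> borel_measurable M" and pos: "AE \<omega> in M. X \<omega> > 0"
    and uv: "u < v"
    and mom: "\<And>s. u < s \<Longrightarrow> s < v \<Longrightarrow> integrable M (\<lambda>\<omega>. X \<omega> powr s)"
      "\<And>s. u < s \<Longrightarrow> s < v \<Longrightarrow> of_real (integral\<^sup>L M (\<lambda>\<omega>. X \<omega> powr s)) = F (of_real s)"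
    and rho: "rho_plus F = \<infinity>" and \<gamma>: "gamma_param J K a a' > 0"
    and d: "distributed M lborel (\<lambda>\<omega>. ln (X \<omega>)) (\<lambda>y. ennreal (f y))" and f0: "\<And>y. f y \<ge> 0" and fc: "continuous_on UNIV f"
  shows "f \<sim>[at_top] (\<lambda>y. C1_param J K C a b a' b' / sqrt (2 * pi * gamma_param J K a a') *
    exp ((delta_param J K b b' + 1/2) / gamma_param J K a a' * (y - kappa_param J K D a a')
      - gamma_param J K a a' * exp ((y - kappa_param J K D a a') / gamma_param J K a a')))"
proof -
  interpret prob_space M by (rule M)
  define Y where "Y \<omega> = ln (X \<omega>)" for \<omega>
  have Ym[measurable]: "Y \<in> borel_measurable M" unfolding Y_def using Xm by measurable
  have AEeq: "AE \<omega> in M. X \<omega> powr s = exp (s * Y \<omega>)" for s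
    using pos by eventually_elim (simp add: powr_def Y_def)
  have int: "integrable M (\<lambda>\<omega>. exp (s * Y \<omega>))" if "u < s" "s < v" for s
  proof -
    have "integrable M (\<lambda>\<omega>. X \<omega> powr s) \<longleftrightarrow> integrable M (\<lambda>\<omega>. exp (s * Y \<omega>))"
      by (rule integrable_cong_AE) (use Xm AEeq in auto)
    then show ?thesis using mom(1)[OF that] by blast
  qed
  have eq: "laplace M Y (of_real s) = F (of_real s)" if "u < s" "s < v" for s
  proof -
    have "integral\<^sup>L M (\<lambda>\<omega>. X \<omega> powr s) = (LINT \<omega>|M. exp (s * Y \<omega>))"
      by (rule integral_cong_AE) (use Xm AEeq in auto)
    then show ?thesis using mom(2)[OF that] by (simp add: laplace_of_real)
  qed
  \<comment> \<open>The moments in the given interval are positive, whereas C = 0 would make F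
    vanish identically.\<close>
  have C: "C \<noteq> 0"
  proof -
    obtain s where s: "u < s" "s < v" using dense[OF uv] by blast
    have "F (of_real s) \<noteq> 0"
      unfolding eq[OF s, symmetric] laplace_of_real of_real_eq_0_iff using integral_exp_pos[OF int[OF s]] by simp
    then show ?thesis by (rule C_nonzero)
  qed
  have poles: "z \<in> \<real> \<and> Re z \<le> 0" if "is_pole F z" for z
    using pole_F_imp_nonpos[OF rho that] by simp
  have cont: "integrable M (\<lambda>\<omega>. exp (z * of_real (Y \<omega>)))" "laplace M Y z = F z" if "Re z > 0" for z
  proof -
    show "integrable M (\<lambda>\<omega>. exp (z * of_real (Y \<omega>)))"
      by (rule laplace_eq_meromorphic_continuation(1)[OF Ym uv F_nicely_meromorphic]) (fact poles int eq that)+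
    show "laplace M Y z = F z"
      by (rule laplace_eq_meromorphic_continuation(2)[OF Ym uv F_nicely_meromorphic]) (fact poles int eq that)+
  qed
  have rint: "integrable M (\<lambda>\<omega>. exp (s * Y \<omega>))" if "s > 0" for s
    using cont(1)[of "of_real s"] that unfolding integrable_exp_complex_iff by simp
  have Fpos: "\<exists>y>0. F (of_real x) = of_real y" if "x > 0" for x
    using cont(2)[of "of_real x"] integral_exp_pos[OF rint[OF that]] that unfolding laplace_of_real by auto
  obtain r B s1 where asy: "s1 > 0" "\<And>s. Re s \<ge> s1 \<Longrightarrow> F s = of_real (C1_param J K C a b a' b') * exp (asymptotic_exponent s + r s)"
    "\<And>s. Re s \<ge> s1 \<Longrightarrow> norm (r s) \<le> B / Re s"
  proof (rule F_asymptotics[OF rho C])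
    show "\<exists>y>0. F (of_real x) = of_real y" if "x > 0" for x using that by (rule Fpos)
  qed (rule that)
  have fm[measurable]: "f \<in> borel_measurable borel" by (rule borel_measurable_continuous_onI[OF fc])
  have dY: "distributed M lborel Y (\<lambda>y. ennreal (f y))" using d unfolding Y_def[abs_def] .
  interpret saddle_point f F r "gamma_param J K a a'" "delta_param J K b b'" "kappa_param J K D a a'" "C1_param J K C a b a' b'" B s1
  proof
    show "gamma_param J K a a' > 0" by (rule \<gamma>)
    show "C1_param J K C a b a' b' > 0" by (rule C1_param_pos[OF C])
    show "s1 > 0" by (rule asy)
    show "f y \<ge> 0" for y by (rule f0)
    show "continuous_on UNIV f" by (rule fc)
    show "integrable lborel (\<lambda>y. exp (s * y) * f y)" if "s > 0" for s
    proof -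
      have "integrable lborel (\<lambda>y. f y * exp (s * y)) \<longleftrightarrow> integrable M (\<lambda>\<omega>. exp (s * Y \<omega>))"
        by (rule distributed_integrable[OF dY]) (use f0 in auto)
      then show ?thesis using rint[OF that] by (simp add: mult.commute)
    qed
    show "F z = (CLINT y|lborel. of_real (f y) * exp (z * of_real y))" if "Re z > 0" for z
    proof -
      have "F z = (CLINT y|distr M lborel Y. exp (z * of_real y))"
        unfolding cont(2)[OF that, symmetric] laplace_def by (rule integral_distr[symmetric]) measurable
      also have "distr M lborel Y = density lborel (\<lambda>y. ennreal (f y))"
        by (rule distributed_distr_eq_density[OF dY])
      also have "(CLINT y|density lborel (\<lambda>y. ennreal (f y)). exp (z * of_real y)) = (CLINT y|lborel. f y *\<^sub>R exp (z * of_real y))"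
        by (rule integral_density) (use f0 in auto)
      finally show ?thesis by (simp only: scaleR_conv_of_real)
    qed
    show "F holomorphic_on {z. Re z > 0}" by (rule F_holomorphic[OF rho])
    show "F z = of_real (C1_param J K C a b a' b') * exp (of_real (gamma_param J K a a') * (z * Ln z - z) +
        of_real (delta_param J K b b') * Ln z + of_real (kappa_param J K D a a') * z + r z)" if "s1 \<le> Re z" for z
      using asy(2)[OF that] unfolding asymptotic_exponent_def .
    show "norm (r z) \<le> B / Re z" if "s1 \<le> Re z" for z by (rule asy(3)[OF that])
  qed
  show ?thesis by (rule density_asymptotics)
qed

end

section \<open>From the density of log X to the density of X\<close>

lemma exp_ln_substitution:
  fixes x \<gamma> \<kappa> c1 A :: real
  assumes x: "x > 0"
  shows "A * exp (c1 * (ln x - \<kappa>) - \<gamma> * exp ((ln x - \<kappa>) / \<gamma>)) / x =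
    A * exp (- c1 * \<kappa>) * x powr (c1 - 1) * exp (- (\<gamma> * exp (- \<kappa> / \<gamma>)) * x powr (1 / \<gamma>))"
proof -
  have 1: "exp ((ln x - \<kappa>) / \<gamma>) = exp (- \<kappa> / \<gamma>) * x powr (1 / \<gamma>)"
    using x by (simp add: powr_def diff_divide_distrib flip: exp_add)
  have 2: "exp (c1 * (ln x - \<kappa>)) / x = exp (- c1 * \<kappa>) * x powr (c1 - 1)"
  proof -
    have "exp (c1 * (ln x - \<kappa>)) = exp (- c1 * \<kappa>) * x powr c1"
      using x by (simp add: powr_def algebra_simps flip: exp_add)
    then show ?thesis using x by (simp add: powr_diff)
  qed
  have "A * exp (c1 * (ln x - \<kappa>) - \<gamma> * exp ((ln x - \<kappa>) / \<gamma>)) / x =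
      A * (exp (c1 * (ln x - \<kappa>)) / x) * exp (- (\<gamma> * exp ((ln x - \<kappa>) / \<gamma>)))"
    by (simp add: exp_diff exp_minus divide_inverse mult_ac)
  also have "\<dots> = A * exp (- c1 * \<kappa>) * x powr (c1 - 1) * exp (- (\<gamma> * exp (- \<kappa> / \<gamma>)) * x powr (1 / \<gamma>))"
    unfolding 1 2 by (simp add: mult_ac)
  finally show ?thesis .
qed

theorem theorem6p1:
  fixes M :: "'w measure" and X :: "'w \<Rightarrow> real"
    and J K :: nat and C D :: real and a b a' b' :: "nat \<Rightarrow> real"
    and \<gamma> \<delta> \<kappa> C1 c1 c2 C2 :: real
    and fX fY :: "real \<Rightarrow> real"
  assumes "prob_space M"
    and "X \<in> borel_measurable M"
    and "AE \<omega> in M. X \<omega> > 0"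
    and "moments_of_gamma_type M X J K C D a b a' b'"
    and "\<gamma> = gamma_param J K a a'"
    and "\<delta> = delta_param J K b b'"
    and "\<kappa> = kappa_param J K D a a'"
    and "C1 = C1_param J K C a b a' b'"
    and "rho_plus (gamma_type_fun J K C D a b a' b') = \<infinity>"
    and "\<gamma> > 0"
    and "distributed M lborel X (\<lambda>x. ennreal (fX x))"
    and "\<And>x. fX x \<ge> 0" and "continuous_on {0<..} fX"
    and "distributed M lborel (\<lambda>\<omega>. ln (X \<omega>)) (\<lambda>y. ennreal (fY y))"
    and "\<And>y. fY y \<ge> 0" and "continuous_on UNIV fY"
    and "c1 = (\<delta> + 1 / 2) / \<gamma>"
    and "c2 = \<gamma> * exp (- \<kappa> / \<gamma>)"
    and "C2 = C1 / sqrt (2 * pi * \<gamma>) * exp (- c1 * \<kappa>)"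
  shows "fX \<sim>[at_top] (\<lambda>x. C2 * x powr (c1 - 1) * exp (- c2 * x powr (1 / \<gamma>)))
    \<and> fY \<sim>[at_top] (\<lambda>y. C1 / sqrt (2 * pi * \<gamma>) *
          exp (c1 * (y - \<kappa>) - \<gamma> * exp ((y - \<kappa>) / \<gamma>)))"
proof -
  note M = assms(1) and Xm = assms(2) and pos = assms(3) and mom = assms(4) and rho = assms(9) and gpos = assms(10)
  note dX = assms(11-13) and dY = assms(14-16)
  interpret gamma_type_parameters J K C D a b a' b'
    by standard (use mom in \<open>auto simp: moments_of_gamma_type_def\<close>)
  obtain u v where uv: "u < v"
    and m: "\<And>s. u < s \<Longrightarrow> s < v \<Longrightarrow> integrable M (\<lambda>\<omega>. X \<omega> powr s)"
      "\<And>s. u < s \<Longrightarrow> s < v \<Longrightarrow> of_real (integral\<^sup>L M (\<lambda>\<omega>. X \<omega> powr s)) = F (of_real s)"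
    using mom unfolding moments_of_gamma_type_def greaterThanLessThan_iff Ball_def by blast
  let ?h = "\<lambda>y. C1 / sqrt (2 * pi * \<gamma>) * exp (c1 * (y - \<kappa>) - \<gamma> * exp ((y - \<kappa>) / \<gamma>))"
  have fY: "fY \<sim>[at_top] ?h"
    using log_density_asymptotics[OF M Xm pos uv m rho gpos[unfolded assms(5)] dY]
    unfolding assms(17) unfolding assms(5-8) .
  \<comment> \<open>The equivalence is composed with ln and divided by the Jacobian x, which lowers
    the power of x from c1 to c1 - 1.\<close>
  have "(\<lambda>x. fY (ln x) / x) \<sim>[at_top] (\<lambda>x. ?h (ln x) / x)"
    by (intro asymp_equiv_divide asymp_equiv_refl asymp_equiv_compose'[OF fY ln_at_top])
  moreover have "\<forall>\<^sub>F x in at_top. fY (ln x) / x = fX x"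
    using eventually_gt_at_top[of 0]
    by eventually_elim (simp add: prob_space.density_of_ln[OF M Xm pos dX dY])
  moreover have "\<forall>\<^sub>F x in at_top. ?h (ln x) / x = C2 * x powr (c1 - 1) * exp (- c2 * x powr (1 / \<gamma>))"
    using eventually_gt_at_top[of 0]
    by eventually_elim (simp only: exp_ln_substitution assms(18,19))
  ultimately have "fX \<sim>[at_top] (\<lambda>x. C2 * x powr (c1 - 1) * exp (- c2 * x powr (1 / \<gamma>)))"
    by (simp only: asymp_equiv_cong)
  then show ?thesis using fY by blast
qed

end
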